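(* Let $(\mathbb{M},\mathcal{H},g,\mathcal{V})$ be a sub-Riemannian manifold with transverse symmetries, with sub-Laplacian $L$ and forms $\Gamma,\Gamma^Z,\Gamma_2,\Gamma_2^Z,\mathcal{R},\mathcal{S}$ as defined in the context. Then for every $f\in C^\infty(\mathbb{M})$: $$\Gamma_2(f)=\|\nabla^2_{\mathcal H}f\|^2+\mathcal{R}(f)+\mathcal{S}(f)\qquad\text{(horizontal Bochner formula)},$$ $$\Gamma_2^Z(f)=\|\nabla_{\mathcal H}\nabla_{\mathcal V}f\|^2\qquad\text{(vertical Bochner formula)}.$$
   Context: Setting. $\mathbb{M}$ is a smooth connected manifold, $\mathcal{H}$ a bracket generating distribution of rank $d$ (horizontal directions), $g$ a fiberwise inner product on $\mathcal{H}$. A vector field $Z$ is a sub-Riemannian Killing field if $(\mathcal{L}_Zg)(u,v)=0$ for all $x$ and $u,v\in\mathcal{H}(x)$, and $[Z,X]\in\mathcal{H}$ for every horizontal field $X$; $\mathfrak{iso}$ is the Lie algebra of such fields. It is assumed that there is a Lie subalgebra $\mathcal{V}\subset\mathfrak{iso}$ (vertical directions) with $T_x\mathbb{M}=\mathcal{H}(x)\oplus\mathcal{V}(x)$ for all $x$, where $\mathcal{V}(x)=\{Z(x):Z\in\mathcal{V}\}$ has dimension $\mathfrak{h}=\dim\mathcal{V}$. Fix an inner product on the Lie algebra $\mathcal{V}$; it induces a Riemannian metric $g_R=\langle\cdot,\cdot\rangle$ extending $g$, making $\mathcal{H}(x)\perp\mathcal{V}(x)$ and the evaluation $\mathcal{V}\to\mathcal{V}(x)$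 isometric. $\mu$ is the Riemannian measure of $g_R$. $\nabla_{\mathcal H}f$, $\nabla_{\mathcal V}f$ are the projections of the Riemannian gradient of $f$ on $\mathcal{H}$ and $\mathcal{V}$. The sub-Laplacian $L$ is the diffusion operator, symmetric with respect to $\mu$, with $\frac12(L(fg)-fLg-gLf)=\langle\nabla_{\mathcal H}f,\nabla_{\mathcal H}g\rangle=:\Gamma(f,g)$ (so $Lf=\mathrm{div}_\mu\nabla_{\mathcal H}f$). Put $\Gamma^Z(f,g)=\langle\nabla_{\mathcal V}f,\nabla_{\mathcal V}g\rangle$, $\Gamma(f)=\Gamma(f,f)$, $\Gamma^Z(f)=\Gamma^Z(f,f)$, and $$\Gamma_2(f)=\tfrac12[L\Gamma(f)-2\Gamma(f,Lf)],\qquad \Gamma_2^Z(f)=\tfrac12[L\Gamma^Z(f)-2\Gamma^Z(f,Lf)].$$ Adapted frames. Near each point there is a local frame $\{X_1,\dots,X_d,Z_1,\dots,Z_{\mathfrak h}\}$ with $Z_m\in\mathcal{V}$, $\{X_i\}$ orthonormal for $\mathcal{H}$, $\{Z_m\}$ orthonormal for $\mathcal{V}(x)$, and $[X_i,X_j]=\sum_\ell\omega_{ij}^\ell X_\ell+\sum_m\gamma_{ij}^mZ_m$, $[X_i,Z_m]=\sum_\ell\delta_{im}^\ell X_\ell$ with smooth coefficients, $\delta_{im}^\ell=-\delta_{\ell m}^i$. Canonical connection. $\nabla$ is the unique affine connection such that: $\nabla g=0$; $\nabla_XY$ is horizontal for horizontal $X,Y$; $\nabla Z=0$ for $Z\in\mathcal{V}$;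 the torsion $T(X,Y)$ is vertical and $T(X,Z)=0$ for horizontal $X,Y$ and $Z\in\mathcal{V}$. $\mathrm{Ric}$ and $T$ denote its Ricci and torsion tensors ($T(X,Y)=\nabla_XY-\nabla_YX-[X,Y]$). Forms. For a local orthonormal horizontal frame $X_1,\dots,X_d$ (the result is frame independent), $$\mathcal{R}(f)=\mathrm{Ric}(\nabla_{\mathcal H}f,\nabla_{\mathcal H}f)+\sum_{\ell,k=1}^d\Big(-\big((\nabla_{X_\ell}T)(X_\ell,X_k)f\big)(X_kf)+\tfrac14\big(T(X_\ell,X_k)f\big)^2\Big),$$ $$\mathcal{S}(f)=-2\sum_{i=1}^d\langle\nabla_{X_i}\nabla_{\mathcal V}f,\,T(X_i,\nabla_{\mathcal H}f)\rangle .$$ In an adapted frame the squared Hilbert-Schmidt norm of the symmetrized horizontal Hessian is $$\|\nabla^2_{\mathcal H}f\|^2=\sum_{\ell=1}^d\Big(X_\ell^2f-\sum_{i=1}^d\omega_{i\ell}^\ell X_if\Big)^2+2\sum_{1\le\ell<j\le d}\Big(\tfrac{X_jX_\ell+X_\ell X_j}{2}f-\sum_{i=1}^d\tfrac{\omega_{ij}^\ell+\omega_{i\ell}^j}{2}X_if\Big)^2,$$ and $\|\nabla_{\mathcal H}\nabla_{\mathcal V}f\|^2=\sum_{i=1}^d\sum_{m=1}^{\mathfrak h}(X_iZ_mf)^2$. *)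

theory Defs
  imports "HOL-Analysis.Analysis" "HOL-Library.Function_Algebras"
begin

text \<open>Pointwise scaling. It makes \<^const>\<open>subspace\<close>, \<^const>\<open>span\<close> and \<^const>\<open>dim\<close> available both for
  tangent vectors at a point and for vector fields.\<close>

instantiation "fun" :: (type, real_vector) real_vector
begin

definition scaleR_fun_def: "c *\<^sub>R f = (\<lambda>x. c *\<^sub>R f x)"

instance
  by standard (simp_all add: scaleR_fun_def fun_eq_iff scaleR_add_right scaleR_add_left)

end

lemma scaleR_fun_apply [simp]: "(c *\<^sub>R f) x = c *\<^sub>R f x"
  by (simp add: scaleR_fun_def)


section \<open>Smooth manifolds\<close>

text \<open>Meant for open sets only.\<close>

primrec Ck_on :: "nat \<Rightarrow> 'a::euclidean_space set \<Rightarrow> ('a \<Rightarrow> 'b::real_normed_vector) \<Rightarrow> bool" where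
  "Ck_on 0 S f \<longleftrightarrow> continuous_on S f"
| "Ck_on (Suc k) S f \<longleftrightarrow>
     (\<forall>x\<in>S. f differentiable (at x)) \<and>
     (\<forall>v. Ck_on k S (\<lambda>x. frechet_derivative f (at x) v))"

definition Cinf_on :: "'a::euclidean_space set \<Rightarrow> ('a \<Rightarrow> 'b::real_normed_vector) \<Rightarrow> bool" where
  "Cinf_on S f \<longleftrightarrow> (\<forall>k. Ck_on k S f)"

type_synonym ('m, 'n) chart = "'m set \<times> ('m \<Rightarrow> real ^ 'n)"

abbreviation chart_inv :: "('m, 'n::finite) chart \<Rightarrow> real ^ 'n \<Rightarrow> 'm" where
  "chart_inv c \<equiv> inv_into (fst c) (snd c)"

text \<open>The manifold is the whole type \<open>'m\<close>, its dimension is \<open>CARD('n)\<close>.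
  The Hausdorff and second countability axioms are the sort of \<open>'m\<close>.\<close>

definition smooth_manifold ::
  "('m::{t2_space,second_countable_topology}, 'n::finite) chart set \<Rightarrow> bool" where
  "smooth_manifold A \<longleftrightarrow>
     (\<Union>c\<in>A. fst c) = UNIV \<and>
     (\<forall>c\<in>A. open (fst c) \<and> open (snd c ` fst c) \<and>
        homeomorphism (fst c) (snd c ` fst c) (snd c) (chart_inv c)) \<and>
     (\<forall>c\<in>A. \<forall>c'\<in>A. Cinf_on (snd c ` (fst c \<inter> fst c')) (snd c' \<circ> chart_inv c))"

text \<open>Smoothness of \<open>f\<close> on an open set \<open>U\<close>; values of \<open>f\<close> outside \<open>U\<close> are irrelevant.\<close>

definition smooth ::
  "('m::topological_space, 'n::finite) chart set \<Rightarrow> 'm set \<Rightarrow> ('m \<Rightarrow> real) \<Rightarrow> bool" where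
  "smooth A U f \<longleftrightarrow> (\<forall>c\<in>A. Cinf_on (snd c ` (U \<inter> fst c)) (f \<circ> chart_inv c))"

definition smooth_near ::
  "('m::topological_space, 'n::finite) chart set \<Rightarrow> 'm \<Rightarrow> ('m \<Rightarrow> real) \<Rightarrow> bool" where
  "smooth_near A p f \<longleftrightarrow> (\<exists>U. open U \<and> p \<in> U \<and> smooth A U f)"


section \<open>Tangent vectors and vector fields\<close>

text \<open>A tangent vector at \<open>p\<close> is a directional derivative at \<open>p\<close>, acting on the functions that are
  smooth near \<open>p\<close> and extended by 0 to all other functions, so that equality of tangent vectors is
  equality in HOL.\<close>

type_synonym 'm tvec = "('m \<Rightarrow> real) \<Rightarrow> real"
type_synonym 'm vfield = "'m \<Rightarrow> 'm tvec"

definition chart_deriv ::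
  "('m::topological_space, 'n::finite) chart set \<Rightarrow> ('m, 'n) chart \<Rightarrow> real ^ 'n \<Rightarrow> 'm vfield" where
  "chart_deriv A c w p = (\<lambda>f. if smooth_near A p f
     then frechet_derivative (f \<circ> chart_inv c) (at (snd c p)) w else 0)"

definition tangent_space ::
  "('m::topological_space, 'n::finite) chart set \<Rightarrow> 'm \<Rightarrow> 'm tvec set" where
  "tangent_space A p = {chart_deriv A c w p | c w. c \<in> A \<and> p \<in> fst c}"

definition app :: "'m vfield \<Rightarrow> ('m \<Rightarrow> real) \<Rightarrow> 'm \<Rightarrow> real" where
  "app X f = (\<lambda>p. X p f)"

definition fscale :: "('m \<Rightarrow> real) \<Rightarrow> 'm vfield \<Rightarrow> 'm vfield" where
  "fscale f X = (\<lambda>p. f p *\<^sub>R X p)"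

text \<open>Local vector fields on an open set \<open>U\<close> are total functions, unconstrained outside \<open>U\<close>.\<close>

definition vfields ::
  "('m::topological_space, 'n::finite) chart set \<Rightarrow> 'm set \<Rightarrow> 'm vfield set" where
  "vfields A U = {X. (\<forall>p\<in>U. X p \<in> tangent_space A p) \<and>
     (\<forall>U' f. open U' \<and> U' \<subseteq> U \<and> smooth A U' f \<longrightarrow> smooth A U' (app X f))}"

definition lie_bracket ::
  "('m::topological_space, 'n::finite) chart set \<Rightarrow> 'm vfield \<Rightarrow> 'm vfield \<Rightarrow> 'm vfield" where
  "lie_bracket A X Y p = (\<lambda>f. if smooth_near A p f then X p (app Y f) - Y p (app X f) else 0)"


section \<open>Sub-Riemannian manifolds with transverse symmetries\<close>

text \<open>\<open>hmet p\<close> is only meaningful on \<open>hor p\<close>, and \<open>vmet\<close> only on \<open>vert\<close>.\<close>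

record ('m, 'n) subriem =
  atlas :: "('m, 'n) chart set"
  hor :: "'m \<Rightarrow> 'm tvec set"
  hmet :: "'m \<Rightarrow> 'm tvec \<Rightarrow> 'm tvec \<Rightarrow> real"
  vert :: "'m vfield set"
  vmet :: "'m vfield \<Rightarrow> 'm vfield \<Rightarrow> real"

definition inner_product_on :: "'v::real_vector set \<Rightarrow> ('v \<Rightarrow> 'v \<Rightarrow> real) \<Rightarrow> bool" where
  "inner_product_on S b \<longleftrightarrow>
     (\<forall>u\<in>S. \<forall>v\<in>S. b u v = b v u) \<and>
     (\<forall>u\<in>S. \<forall>v\<in>S. \<forall>w\<in>S. b (u + v) w = b u w + b v w) \<and>
     (\<forall>u\<in>S. \<forall>v\<in>S. \<forall>c. b (c *\<^sub>R u) v = c * b u v) \<and>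
     (\<forall>u\<in>S. u \<noteq> 0 \<longrightarrow> 0 < b u u)"

definition hfields ::
  "('m::topological_space, 'n::finite) subriem \<Rightarrow> 'm set \<Rightarrow> 'm vfield set" where
  "hfields M U = {X \<in> vfields (atlas M) U. \<forall>p\<in>U. X p \<in> hor M p}"

definition is_distribution ::
  "('m::topological_space, 'n::finite) subriem \<Rightarrow> nat \<Rightarrow> bool" where
  "is_distribution M d \<longleftrightarrow>
     (\<forall>p. subspace (hor M p) \<and> hor M p \<subseteq> tangent_space (atlas M) p \<and> dim (hor M p) = d) \<and>
     (\<forall>p. \<exists>U X. open U \<and> p \<in> U \<and> (\<forall>i<d. X i \<in> hfields M U) \<and>
        (\<forall>q\<in>U. span ((\<lambda>i. X i q) ` {..<d}) = hor M q))"

inductive_set iterated_brackets ::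
  "('m::topological_space, 'n::finite) subriem \<Rightarrow> 'm set \<Rightarrow> 'm vfield set"
  for M U where
  horizontal: "X \<in> hfields M U \<Longrightarrow> X \<in> iterated_brackets M U"
| bracket: "X \<in> iterated_brackets M U \<Longrightarrow> Y \<in> iterated_brackets M U \<Longrightarrow>
    lie_bracket (atlas M) X Y \<in> iterated_brackets M U"

definition bracket_generating ::
  "('m::topological_space, 'n::finite) subriem \<Rightarrow> bool" where
  "bracket_generating M \<longleftrightarrow> (\<forall>p. \<exists>U. open U \<and> p \<in> U \<and>
     span ((\<lambda>X. X p) ` iterated_brackets M U) = tangent_space (atlas M) p)"

definition is_fiber_metric ::
  "('m::topological_space, 'n::finite) subriem \<Rightarrow> bool" where
  "is_fiber_metric M \<longleftrightarrow>
     (\<forall>p. inner_product_on (hor M p) (hmet M p)) \<and>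
     (\<forall>U X Y. open U \<and> X \<in> hfields M U \<and> Y \<in> hfields M U \<longrightarrow>
        smooth (atlas M) U (\<lambda>p. hmet M p (X p) (Y p)))"

text \<open>\<open>(L\<^sub>Z g)(X, Y)\<close> for horizontal fields \<open>X\<close>, \<open>Y\<close>.\<close>

definition lie_deriv_metric ::
  "('m::topological_space, 'n::finite) subriem \<Rightarrow> 'm vfield \<Rightarrow> 'm vfield \<Rightarrow> 'm vfield \<Rightarrow> 'm \<Rightarrow> real" where
  "lie_deriv_metric M Z X Y p =
     Z p (\<lambda>q. hmet M q (X q) (Y q))
     - hmet M p (lie_bracket (atlas M) Z X p) (Y p)
     - hmet M p (X p) (lie_bracket (atlas M) Z Y p)"

definition killing_fields ::
  "('m::topological_space, 'n::finite) subriem \<Rightarrow> 'm vfield set" where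
  "killing_fields M = {Z \<in> vfields (atlas M) UNIV. \<forall>U. open U \<longrightarrow>
     (\<forall>X\<in>hfields M U. lie_bracket (atlas M) Z X \<in> hfields M U) \<and>
     (\<forall>X\<in>hfields M U. \<forall>Y\<in>hfields M U. \<forall>p\<in>U. lie_deriv_metric M Z X Y p = 0)}"

definition vspace :: "('m, 'n) subriem \<Rightarrow> 'm \<Rightarrow> 'm tvec set" where
  "vspace M p = (\<lambda>Z. Z p) ` vert M"

text \<open>The finite spanning set is required explicitly because \<^const>\<open>dim\<close> is 0 on infinite-dimensional
  spaces.\<close>

definition transverse_symmetries ::
  "('m::{t2_space,second_countable_topology}, 'n::finite) subriem \<Rightarrow> nat \<Rightarrow> nat \<Rightarrow> bool" where
  "transverse_symmetries M d h \<longleftrightarrow>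
     smooth_manifold (atlas M) \<and> connected (UNIV :: 'm set) \<and>
     is_distribution M d \<and> bracket_generating M \<and> is_fiber_metric M \<and>
     subspace (vert M) \<and> vert M \<subseteq> killing_fields M \<and>
     (\<forall>Z\<in>vert M. \<forall>Z'\<in>vert M. lie_bracket (atlas M) Z Z' \<in> vert M) \<and>
     (\<exists>B. finite B \<and> span B = vert M) \<and> dim (vert M) = h \<and>
     (\<forall>p. dim (vspace M p) = h \<and> hor M p \<inter> vspace M p = {0} \<and>
        {u + w | u w. u \<in> hor M p \<and> w \<in> vspace M p} = tangent_space (atlas M) p) \<and>
     inner_product_on (vert M) (vmet M)"


section \<open>The Riemannian extension and its measure\<close>

definition hpart :: "('m, 'n) subriem \<Rightarrow> 'm \<Rightarrow> 'm tvec \<Rightarrow> 'm tvec" where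
  "hpart M p v = (THE u. u \<in> hor M p \<and> v - u \<in> vspace M p)"

definition vpart :: "('m, 'n) subriem \<Rightarrow> 'm \<Rightarrow> 'm tvec \<Rightarrow> 'm tvec" where
  "vpart M p v = v - hpart M p v"

definition vert_field :: "('m, 'n) subriem \<Rightarrow> 'm \<Rightarrow> 'm tvec \<Rightarrow> 'm vfield" where
  "vert_field M p w = (THE Z. Z \<in> vert M \<and> Z p = w)"

definition gR :: "('m, 'n) subriem \<Rightarrow> 'm \<Rightarrow> 'm tvec \<Rightarrow> 'm tvec \<Rightarrow> real" where
  "gR M p v w = hmet M p (hpart M p v) (hpart M p w)
     + vmet M (vert_field M p (vpart M p v)) (vert_field M p (vpart M p w))"

definition coord_field ::
  "('m::topological_space, 'n::finite) chart set \<Rightarrow> ('m, 'n) chart \<Rightarrow> 'n \<Rightarrow> 'm vfield" where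
  "coord_field A c i = chart_deriv A c (axis i 1)"

definition gram_det ::
  "('m::topological_space, 'n::finite) subriem \<Rightarrow> ('m, 'n) chart \<Rightarrow> 'm \<Rightarrow> real" where
  "gram_det M c p = det ((\<chi> i j.
     gR M p (coord_field (atlas M) c i p) (coord_field (atlas M) c j p)) :: real ^ 'n ^ 'n)"

definition riemannian_measure ::
  "('m::topological_space, 'n::finite) subriem \<Rightarrow> 'm measure \<Rightarrow> bool" where
  "riemannian_measure M \<mu> \<longleftrightarrow> sets \<mu> = sets borel \<and>
     (\<forall>c\<in>atlas M. \<forall>B\<in>sets borel. B \<subseteq> fst c \<longrightarrow>
        emeasure \<mu> B =
          (\<integral>\<^sup>+ x \<in> snd c ` B. ennreal (sqrt (gram_det M c (chart_inv c x))) \<partial>lborel))"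

definition grad :: "('m::topological_space, 'n::finite) subriem \<Rightarrow> ('m \<Rightarrow> real) \<Rightarrow> 'm vfield" where
  "grad M f p = (THE v. v \<in> tangent_space (atlas M) p \<and>
     (\<forall>w\<in>tangent_space (atlas M) p. gR M p v w = w f))"

definition hgrad :: "('m::topological_space, 'n::finite) subriem \<Rightarrow> ('m \<Rightarrow> real) \<Rightarrow> 'm vfield" where
  "hgrad M f p = hpart M p (grad M f p)"

definition vgrad :: "('m::topological_space, 'n::finite) subriem \<Rightarrow> ('m \<Rightarrow> real) \<Rightarrow> 'm vfield" where
  "vgrad M f p = vpart M p (grad M f p)"


section \<open>The sub-Laplacian and the forms derived from it\<close>

definition Gam ::
  "('m::topological_space, 'n::finite) subriem \<Rightarrow> ('m \<Rightarrow> real) \<Rightarrow> ('m \<Rightarrow> real) \<Rightarrow> 'm \<Rightarrow> real" where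
  "Gam M f g = (\<lambda>p. gR M p (hgrad M f p) (hgrad M g p))"

definition GamZ ::
  "('m::topological_space, 'n::finite) subriem \<Rightarrow> ('m \<Rightarrow> real) \<Rightarrow> ('m \<Rightarrow> real) \<Rightarrow> 'm \<Rightarrow> real" where
  "GamZ M f g = (\<lambda>p. gR M p (vgrad M f p) (vgrad M g p))"

abbreviation smooth_functions ::
  "('m::topological_space, 'n::finite) subriem \<Rightarrow> ('m \<Rightarrow> real) set" where
  "smooth_functions M \<equiv> {f. smooth (atlas M) UNIV f}"

definition test_functions ::
  "('m::topological_space, 'n::finite) subriem \<Rightarrow> ('m \<Rightarrow> real) set" where
  "test_functions M = {f \<in> smooth_functions M. compact (closure {p. f p \<noteq> 0})}"

text \<open>As \<^const>\<open>Gam\<close> is a derivation in each argument, the second condition makes \<open>L\<close> a second-order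
  differential operator with \<open>L 1 = 0\<close>; together with symmetry it determines \<open>L\<close> on smooth
  functions.\<close>

definition sub_laplacian ::
  "('m::topological_space, 'n::finite) subriem \<Rightarrow> 'm measure \<Rightarrow>
    (('m \<Rightarrow> real) \<Rightarrow> 'm \<Rightarrow> real) \<Rightarrow> bool" where
  "sub_laplacian M \<mu> L \<longleftrightarrow>
     (\<forall>f\<in>smooth_functions M. L f \<in> smooth_functions M \<and> (\<forall>c. L (c *\<^sub>R f) = c *\<^sub>R L f) \<and>
        (\<forall>g\<in>smooth_functions M. L (f + g) = L f + L g)) \<and>
     (\<forall>f\<in>smooth_functions M. \<forall>g\<in>smooth_functions M. \<forall>p.
        (L (\<lambda>q. f q * g q) p - f p * L g p - g p * L f p) / 2 = Gam M f g p) \<and>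
     (\<forall>f\<in>test_functions M. \<forall>g\<in>test_functions M.
        (LINT p|\<mu>. f p * L g p) = (LINT p|\<mu>. g p * L f p))"

definition Gam2 ::
  "('m::topological_space, 'n::finite) subriem \<Rightarrow> (('m \<Rightarrow> real) \<Rightarrow> 'm \<Rightarrow> real) \<Rightarrow>
    ('m \<Rightarrow> real) \<Rightarrow> 'm \<Rightarrow> real" where
  "Gam2 M L f p = (L (Gam M f f) p - 2 * Gam M f (L f) p) / 2"

definition Gam2Z ::
  "('m::topological_space, 'n::finite) subriem \<Rightarrow> (('m \<Rightarrow> real) \<Rightarrow> 'm \<Rightarrow> real) \<Rightarrow>
    ('m \<Rightarrow> real) \<Rightarrow> 'm \<Rightarrow> real" where
  "Gam2Z M L f p = (L (GamZ M f f) p - 2 * GamZ M f (L f) p) / 2"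


section \<open>Frames\<close>

definition horizontal_frame ::
  "('m::topological_space, 'n::finite) subriem \<Rightarrow> nat \<Rightarrow> 'm set \<Rightarrow> (nat \<Rightarrow> 'm vfield) \<Rightarrow> bool" where
  "horizontal_frame M d U X \<longleftrightarrow> open U \<and> (\<forall>i<d. X i \<in> hfields M U) \<and>
     (\<forall>p\<in>U. \<forall>i<d. \<forall>j<d. gR M p (X i p) (X j p) = (if i = j then 1 else 0))"

text \<open>Indices start at 0; an upper index is the last argument, e.g. \<open>\<omega> i j l\<close> for \<open>\<omega>\<^sub>i\<^sub>j\<^sup>l\<close>.\<close>

definition adapted_frame ::
  "('m::topological_space, 'n::finite) subriem \<Rightarrow> nat \<Rightarrow> nat \<Rightarrow> 'm set \<Rightarrow>
    (nat \<Rightarrow> 'm vfield) \<Rightarrow> (nat \<Rightarrow> 'm vfield) \<Rightarrow>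
    (nat \<Rightarrow> nat \<Rightarrow> nat \<Rightarrow> 'm \<Rightarrow> real) \<Rightarrow> (nat \<Rightarrow> nat \<Rightarrow> nat \<Rightarrow> 'm \<Rightarrow> real) \<Rightarrow>
    (nat \<Rightarrow> nat \<Rightarrow> nat \<Rightarrow> 'm \<Rightarrow> real) \<Rightarrow> bool" where
  "adapted_frame M d h U X Z \<omega> \<gamma> \<delta> \<longleftrightarrow>
     horizontal_frame M d U X \<and>
     (\<forall>m<h. Z m \<in> vert M) \<and>
     (\<forall>p\<in>U. \<forall>m<h. \<forall>n<h. gR M p (Z m p) (Z n p) = (if m = n then 1 else 0)) \<and>
     (\<forall>i<d. \<forall>j<d. \<forall>l<d. smooth (atlas M) U (\<omega> i j l)) \<and>
     (\<forall>i<d. \<forall>j<d. \<forall>m<h. smooth (atlas M) U (\<gamma> i j m)) \<and>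
     (\<forall>i<d. \<forall>m<h. \<forall>l<d. smooth (atlas M) U (\<delta> i m l)) \<and>
     (\<forall>p\<in>U. \<forall>i<d. \<forall>j<d. lie_bracket (atlas M) (X i) (X j) p =
        (\<Sum>l<d. \<omega> i j l p *\<^sub>R X l p) + (\<Sum>m<h. \<gamma> i j m p *\<^sub>R Z m p)) \<and>
     (\<forall>p\<in>U. \<forall>i<d. \<forall>m<h. lie_bracket (atlas M) (X i) (Z m) p =
        (\<Sum>l<d. \<delta> i m l p *\<^sub>R X l p)) \<and>
     (\<forall>p\<in>U. \<forall>i<d. \<forall>m<h. \<forall>l<d. \<delta> i m l p = - \<delta> l m i p)"


section \<open>The canonical connection\<close>

text \<open>A connection \<open>D X Y\<close> (standing for \<open>\<nabla>\<^sub>X Y\<close>) acts on local fields over every open set.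
  The value at \<open>p\<close> depends only on the germs of \<open>X\<close> and \<open>Y\<close> at \<open>p\<close>: apply \<open>C\<^sup>\<infinity>\<close>-linearity, respectively
  the Leibniz rule, with the indicator of the complement of a neighbourhood of \<open>p\<close>.\<close>

type_synonym 'm connection = "'m vfield \<Rightarrow> 'm vfield \<Rightarrow> 'm vfield"

definition affine_connection ::
  "('m::topological_space, 'n::finite) chart set \<Rightarrow> 'm connection \<Rightarrow> bool" where
  "affine_connection A D \<longleftrightarrow> (\<forall>U. open U \<longrightarrow>
     (\<forall>X\<in>vfields A U. \<forall>Y\<in>vfields A U. D X Y \<in> vfields A U \<and>
        (\<forall>X'\<in>vfields A U. \<forall>p\<in>U. D (X + X') Y p = D X Y p + D X' Y p) \<and>
        (\<forall>Y'\<in>vfields A U. \<forall>p\<in>U. D X (Y + Y') p = D X Y p + D X Y' p) \<and>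
        (\<forall>f. smooth A U f \<longrightarrow> (\<forall>p\<in>U.
           D (fscale f X) Y p = f p *\<^sub>R D X Y p \<and>
           D X (fscale f Y) p = X p f *\<^sub>R Y p + f p *\<^sub>R D X Y p))))"

definition torsion ::
  "('m::topological_space, 'n::finite) chart set \<Rightarrow> 'm connection \<Rightarrow>
    'm vfield \<Rightarrow> 'm vfield \<Rightarrow> 'm vfield" where
  "torsion A D X Y = D X Y - D Y X - lie_bracket A X Y"

text \<open>\<open>(\<nabla>\<^sub>W T)(X, Y)\<close>\<close>

definition deriv_torsion ::
  "('m::topological_space, 'n::finite) chart set \<Rightarrow> 'm connection \<Rightarrow>
    'm vfield \<Rightarrow> 'm vfield \<Rightarrow> 'm vfield \<Rightarrow> 'm vfield" where
  "deriv_torsion A D W X Y =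
     D W (torsion A D X Y) - torsion A D (D W X) Y - torsion A D X (D W Y)"

definition canonical_connection ::
  "('m::topological_space, 'n::finite) subriem \<Rightarrow> 'm connection \<Rightarrow> bool" where
  "canonical_connection M D \<longleftrightarrow> affine_connection (atlas M) D \<and>
     (\<forall>U. open U \<longrightarrow>
        (\<forall>W\<in>vfields (atlas M) U. \<forall>X\<in>hfields M U. \<forall>Y\<in>hfields M U. \<forall>p\<in>U.
           W p (\<lambda>q. hmet M q (X q) (Y q)) = hmet M p (D W X p) (Y p) + hmet M p (X p) (D W Y p)) \<and>
        (\<forall>X\<in>hfields M U. \<forall>Y\<in>hfields M U. D X Y \<in> hfields M U) \<and>
        (\<forall>W\<in>vfields (atlas M) U. \<forall>Z\<in>vert M. \<forall>p\<in>U. D W Z p = 0) \<and>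
        (\<forall>X\<in>hfields M U. \<forall>Y\<in>hfields M U. \<forall>p\<in>U. torsion (atlas M) D X Y p \<in> vspace M p) \<and>
        (\<forall>X\<in>hfields M U. \<forall>Z\<in>vert M. \<forall>p\<in>U. torsion (atlas M) D X Z p = 0))"

definition curvature ::
  "('m::topological_space, 'n::finite) chart set \<Rightarrow> 'm connection \<Rightarrow>
    'm vfield \<Rightarrow> 'm vfield \<Rightarrow> 'm vfield \<Rightarrow> 'm vfield" where
  "curvature A D X Y W = D X (D Y W) - D Y (D X W) - D (lie_bracket A X Y) W"

text \<open>\<open>Ric(Y, W)\<close> is the trace of \<open>v \<mapsto> R(v, Y) W\<close> (positive on round spheres), computed in the
  coordinate basis of an arbitrary chart at \<open>p\<close>; applying a vector to the \<open>i\<close>-th coordinate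
  function gives its \<open>i\<close>-th component.\<close>

definition ricci ::
  "('m::topological_space, 'n::finite) chart set \<Rightarrow> 'm connection \<Rightarrow>
    'm vfield \<Rightarrow> 'm vfield \<Rightarrow> 'm \<Rightarrow> real" where
  "ricci A D Y W p =
     (let c = (SOME c. c \<in> A \<and> p \<in> fst c)
      in \<Sum>i\<in>UNIV. curvature A D (coord_field A c i) Y W p (\<lambda>q. snd c q $ i))"


section \<open>The terms of the Bochner formulas\<close>

definition R_form ::
  "('m::topological_space, 'n::finite) subriem \<Rightarrow> 'm connection \<Rightarrow> nat \<Rightarrow> (nat \<Rightarrow> 'm vfield) \<Rightarrow>
    ('m \<Rightarrow> real) \<Rightarrow> 'm \<Rightarrow> real" where
  "R_form M D d X f p =
     ricci (atlas M) D (hgrad M f) (hgrad M f) p +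
     (\<Sum>l<d. \<Sum>k<d.
        - (deriv_torsion (atlas M) D (X l) (X l) (X k) p f) * X k p f
        + 1/4 * (torsion (atlas M) D (X l) (X k) p f)\<^sup>2)"

definition S_form ::
  "('m::topological_space, 'n::finite) subriem \<Rightarrow> 'm connection \<Rightarrow> nat \<Rightarrow> (nat \<Rightarrow> 'm vfield) \<Rightarrow>
    ('m \<Rightarrow> real) \<Rightarrow> 'm \<Rightarrow> real" where
  "S_form M D d X f p =
     - 2 * (\<Sum>i<d. gR M p (D (X i) (vgrad M f) p) (torsion (atlas M) D (X i) (hgrad M f) p))"

definition hessian_norm2 ::
  "nat \<Rightarrow> (nat \<Rightarrow> 'm vfield) \<Rightarrow> (nat \<Rightarrow> nat \<Rightarrow> nat \<Rightarrow> 'm \<Rightarrow> real) \<Rightarrow>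
    ('m \<Rightarrow> real) \<Rightarrow> 'm \<Rightarrow> real" where
  "hessian_norm2 d X \<omega> f p =
     (\<Sum>l<d. (X l p (app (X l) f) - (\<Sum>i<d. \<omega> i l l p * X i p f))\<^sup>2) +
     2 * (\<Sum>j<d. \<Sum>l<j.
        ((X j p (app (X l) f) + X l p (app (X j) f)) / 2
         - (\<Sum>i<d. (\<omega> i j l p + \<omega> i l j p) / 2 * X i p f))\<^sup>2)"

definition mixed_norm2 ::
  "nat \<Rightarrow> nat \<Rightarrow> (nat \<Rightarrow> 'm vfield) \<Rightarrow> (nat \<Rightarrow> 'm vfield) \<Rightarrow> ('m \<Rightarrow> real) \<Rightarrow> 'm \<Rightarrow> real" where
  "mixed_norm2 d h X Z f p = (\<Sum>i<d. \<Sum>m<h. (X i p (app (Z m) f))\<^sup>2)"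

end

theory Submission
  imports Defs
begin

text \<open>Symmetry with respect to \<open>\<mu>\<close> enters only through the first-order part of \<open>L\<close>: integrating by parts
  against test functions supported in a chart gives \<open>L f = \<Sum>\<^sub>i (X\<^sub>i X\<^sub>i f + div(X\<^sub>i) X\<^sub>i f)\<close> in an adapted frame, and the
  frame components of \<open>\<nabla>\<close> turn this into \<open>L f = \<Sum>\<^sub>l H(X\<^sub>l, X\<^sub>l)\<close> with the non-symmetric Hessian
  \<open>H(B, C) = B C f - (\<nabla>\<^sub>B C) f\<close>. As \<open>\<nabla>\<close> is metric, \<open>\<Gamma>\<^sub>2(f)\<close> is \<open>\<Sum> H(X\<^sub>l, X\<^sub>k)\<^sup>2\<close> plus
  \<open>\<Sum> (X\<^sub>k f) ((\<nabla>\<^sub>l H)(X\<^sub>l, X\<^sub>k) - (\<nabla>\<^sub>k H)(X\<^sub>l, X\<^sub>l))\<close>. Exchanging the arguments of \<open>H\<close> costs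
  \<open>H(B, C) - H(C, B) = - T(B, C) f\<close>, exchanging the derivatives costs curvature and torsion (the Ricci identity),
  and the skew part of \<open>H\<close> accounts for the term \<open>(T(X\<^sub>l, X\<^sub>k) f)\<^sup>2 / 4\<close>. The vertical formula holds because
  \<open>L\<close> commutes with \<open>Z\<^sub>m\<close>, which is the Jacobi identity in components.\<close>


section \<open>Calculus of smooth functions\<close>

text \<open>\<open>L\<close> acts on globally smooth functions and is not assumed to be local, while
  frames, structure functions and \<open>D\<close> live on open sets. Locality is extracted from the
  product identity with bump functions, because \<open>Gam\<close> vanishes wherever one argument is
  locally constant. All local work then takes place on an open set that lies in one chart and
  carries an adapted frame: the chart supplies Lebesgue measure, makes the frame components of
  smooth fields smooth, and so lets brackets of smooth fields be recognised as fields. For the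
  horizontal formula it has to be the chart that \<open>ricci\<close> selects. Terms with an
  undifferentiated connection coefficient keep disappearing for one reason: metric compatibility
  makes the coefficients skew, and they are summed against something symmetric. The same pattern
  removes the second-order part of the commutator of \<open>L\<close> and \<open>Z m\<close>, as
  \<open>\<delta>\<close> is skew; the Jacobi identity is needed for its first-order part. The
  Hessian norm uses one frame and \<open>R_form\<close>, \<open>S_form\<close> may use another, so
  the final step is the invariance of traces under an orthogonal change of frame.\<close>

lemma Ck_on_cong_imp:
  assumes "open S" "\<And>x. x \<in> S \<Longrightarrow> f x = g x" "Ck_on k S f"
  shows "Ck_on k S g"
  using assms(2,3)
proof (induction k arbitrary: f g)
  case 0
  then show ?case using continuous_on_cong[OF refl, of S f g] by simp
next
  case (Suc k)
  have d: "(g has_derivative frechet_derivative f (at x)) (at x)" if "x \<in> S" for x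
    using Suc.prems that assms(1)
    by (intro has_derivative_transform_within_open[of f _ x UNIV S g]) (auto simp: frechet_derivative_works)
  have "frechet_derivative g (at x) = frechet_derivative f (at x)" if "x \<in> S" for x
    using frechet_derivative_at[OF d[OF that]] by simp
  then have "Ck_on k S (\<lambda>x. frechet_derivative g (at x) v)" for v
    using Suc.prems Suc.IH[of "\<lambda>x. frechet_derivative f (at x) v" "\<lambda>x. frechet_derivative g (at x) v"] by simp
  then show ?case using d by (auto simp: differentiable_def)
qed

lemma Ck_on_cong:
  assumes "open S" "\<And>x. x \<in> S \<Longrightarrow> f x = g x"
  shows "Ck_on k S f \<longleftrightarrow> Ck_on k S g"
  using Ck_on_cong_imp[OF assms(1)] assms(2) by metis

text \<open>Any explicit derivative may stand in for \<open>frechet_derivative\<close>; this is how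
  the sum, product and chain rules enter the recursion.\<close>

lemma Ck_on_SucI:
  assumes "open S" "\<And>x. x \<in> S \<Longrightarrow> (f has_derivative f' x) (at x)" "\<And>v. Ck_on k S (\<lambda>x. f' x v)"
  shows "Ck_on (Suc k) S f"
proof -
  have "f' x v = frechet_derivative f (at x) v" if "x \<in> S" for x v
    using frechet_derivative_at[OF assms(2)[OF that]] by simp
  then have "Ck_on k S (\<lambda>x. frechet_derivative f (at x) v)" for v
    by (intro Ck_on_cong_imp[OF assms(1) _ assms(3)])
  then show ?thesis using assms(2) by (auto simp: differentiable_def)
qed

lemma Ck_on_SucE:
  assumes "Ck_on (Suc k) S f"
  shows "\<And>x. x \<in> S \<Longrightarrow> (f has_derivative frechet_derivative f (at x)) (at x)"
    "\<And>v. Ck_on k S (\<lambda>x. frechet_derivative f (at x) v)"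
  using assms by (auto simp: frechet_derivative_works)

lemma Ck_on_subset: "Ck_on k S f \<Longrightarrow> T \<subseteq> S \<Longrightarrow> Ck_on k T f"
  by (induction k arbitrary: f) (auto intro: continuous_on_subset)

lemma Ck_on_SucD: "Ck_on (Suc k) S f \<Longrightarrow> Ck_on k S f"
proof (induction k arbitrary: f)
  case 0
  then show ?case
    by (auto intro!: differentiable_imp_continuous_on simp: differentiable_on_def differentiable_at_withinI)
qed auto

lemma Ck_on_const [simp]: "Ck_on k S (\<lambda>x. c)"
  by (induction k arbitrary: c) auto

lemma Ck_on_bounded_linear: "bounded_linear T \<Longrightarrow> Ck_on k S T"
proof (cases k)
  case (Suc j)
  assume T: "bounded_linear T"
  then have "frechet_derivative T (at x) = T" for x
    using bounded_linear_imp_has_derivative frechet_derivative_at by metis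
  then show ?thesis using T Suc
    by (auto intro: bounded_linear_imp_differentiable)
qed (auto simp: linear_continuous_on)

lemma Ck_on_add: "Ck_on k S f \<Longrightarrow> Ck_on k S g \<Longrightarrow> open S \<Longrightarrow> Ck_on k S (\<lambda>x. f x + g x)"
proof (induction k arbitrary: f g)
  case (Suc k)
  show ?case
    by (rule Ck_on_SucI[OF Suc.prems(3) has_derivative_add[OF Ck_on_SucE(1)[OF Suc.prems(1)] Ck_on_SucE(1)[OF Suc.prems(2)]]])
       (auto intro!: Suc.IH Ck_on_SucE(2)[OF Suc.prems(1)] Ck_on_SucE(2)[OF Suc.prems(2)] Suc.prems(3))
qed (auto intro: continuous_on_add)

lemma Ck_on_compose_linear:
  "bounded_linear T \<Longrightarrow> Ck_on k S f \<Longrightarrow> open S \<Longrightarrow> Ck_on k S (\<lambda>x. T (f x))"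
proof (induction k arbitrary: f)
  case 0
  then show ?case using bounded_linear.continuous_on by auto
next
  case (Suc k)
  show ?case
    by (rule Ck_on_SucI[OF Suc.prems(3) bounded_linear.has_derivative[OF Suc.prems(1) Ck_on_SucE(1)[OF Suc.prems(2)]]])
       (auto intro!: Suc.IH Ck_on_SucE(2)[OF Suc.prems(2)] Suc.prems)
qed

lemma Ck_on_mult:
  fixes f g :: "'a::euclidean_space \<Rightarrow> real"
  shows "Ck_on k S f \<Longrightarrow> Ck_on k S g \<Longrightarrow> open S \<Longrightarrow> Ck_on k S (\<lambda>x. f x * g x)"
proof (induction k arbitrary: f g)
  case (Suc k)
  show ?case
    by (rule Ck_on_SucI[OF Suc.prems(3) has_derivative_mult[OF Ck_on_SucE(1)[OF Suc.prems(1)] Ck_on_SucE(1)[OF Suc.prems(2)]]])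
       (auto intro!: Ck_on_add Suc.IH Ck_on_SucE(2)[OF Suc.prems(1)] Ck_on_SucE(2)[OF Suc.prems(2)]
          Ck_on_SucD[OF Suc.prems(1)] Ck_on_SucD[OF Suc.prems(2)] Suc.prems(3))
qed (auto intro: continuous_on_mult)

lemma Ck_on_local:
  assumes "\<And>x. x \<in> S \<Longrightarrow> \<exists>T. open T \<and> x \<in> T \<and> Ck_on k T f"
  shows "Ck_on k S f"
  using assms
proof (induction k arbitrary: f)
  case 0
  then show ?case
    unfolding Ck_on.simps continuous_on_eq_continuous_within
    by (meson continuous_at_imp_continuous_at_within continuous_on_eq_continuous_at continuous_on_eq_continuous_within)
next
  case (Suc k)
  have "Ck_on k S (\<lambda>x. frechet_derivative f (at x) v)" for v
    by (rule Suc.IH) (use Suc.prems in fastforce)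
  then show ?case using Suc.prems by fastforce
qed

text \<open>Expanded in the standard basis, a directional derivative of the composition is a finite
  sum of products: a component of the derivative of \<open>g\<close> times a partial derivative of
  \<open>f\<close> composed with the same \<open>g\<close>. Hence only \<open>f\<close> varies in
  the induction.\<close>

lemma Ck_on_compose:
  fixes f :: "'b::euclidean_space \<Rightarrow> real" and g :: "'a::euclidean_space \<Rightarrow> 'b"
  assumes "open S"
  shows "Ck_on k T f \<Longrightarrow> Ck_on k S g \<Longrightarrow> g ` S \<subseteq> T \<Longrightarrow> Ck_on k S (\<lambda>x. f (g x))"
proof (induction k arbitrary: f)
  case 0
  then show ?case by (auto intro: continuous_on_compose2)
next
  case (Suc k)
  let ?D = "\<lambda>x v. \<Sum>b\<in>Basis. (frechet_derivative g (at x) v \<bullet> b) * frechet_derivative f (at (g x)) b"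
  have d: "((\<lambda>x. f (g x)) has_derivative ?D x) (at x)" if "x \<in> S" for x
  proof -
    have f: "(f has_derivative frechet_derivative f (at (g x))) (at (g x))"
      and g: "(g has_derivative frechet_derivative g (at x)) (at x)"
      using Suc.prems that by (auto simp: frechet_derivative_works)
    have l: "linear (frechet_derivative f (at (g x)))" by (rule has_derivative_linear[OF f])
    have "frechet_derivative f (at (g x)) (\<Sum>b\<in>Basis. (w \<bullet> b) *\<^sub>R b)
        = (\<Sum>b\<in>Basis. (w \<bullet> b) * frechet_derivative f (at (g x)) b)" for w
      by (simp add: linear_sum[OF l] linear_cmul[OF l])
    then have "frechet_derivative f (at (g x)) w = (\<Sum>b\<in>Basis. (w \<bullet> b) * frechet_derivative f (at (g x)) b)" for w
      unfolding euclidean_representation .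
    then have "frechet_derivative f (at (g x)) \<circ> frechet_derivative g (at x) = ?D x"
      unfolding comp_def by (intro ext)
    then show ?thesis using diff_chain_at[OF g f] unfolding comp_def by metis
  qed
  have "Ck_on k S (\<lambda>x. ?D x v)" for v
  proof -
    have "Ck_on k S (\<lambda>x. \<Sum>b\<in>B. (frechet_derivative g (at x) v \<bullet> b) * frechet_derivative f (at (g x)) b)"
      if "finite B" for B
      using that
    proof induction
      case (insert b B)
      have "Ck_on k S (\<lambda>x. (frechet_derivative g (at x) v \<bullet> b) * frechet_derivative f (at (g x)) b)"
        using Suc.prems assms Ck_on_SucD[OF Suc.prems(2)]
        by (intro Ck_on_mult Suc.IH[of "\<lambda>y. frechet_derivative f (at y) b"]
            Ck_on_compose_linear[OF bounded_linear_inner_left]) auto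
      with insert assms show ?case by (simp add: Ck_on_add)
    qed simp
    then show ?thesis by simp
  qed
  then show ?case using Ck_on_SucI[OF assms d] by blast
qed

text \<open>The derivative is a product of two copies of \<open>inverse\<close> and a constant, so
  the induction feeds on itself.\<close>

lemma Ck_on_inverse: "Ck_on k (- {0::real}) inverse"
proof (induction k)
  case (Suc k)
  have d: "(inverse has_derivative (\<lambda>v. - v * (inverse x * inverse x))) (at x)" if "x \<noteq> 0" for x :: real
    using that by (auto intro!: derivative_eq_intros)
  have o: "open (- {0::real})" by auto
  show ?case
    by (rule Ck_on_SucI[OF o, where f'="\<lambda>x v. - v * (inverse x * inverse x)"])
       (intro d Ck_on_mult Suc Ck_on_const o; simp)+
qed (auto intro!: continuous_intros)

lemma Cinf_on_cong:
  assumes "open S" "\<And>x. x \<in> S \<Longrightarrow> f x = g x"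
  shows "Cinf_on S f \<longleftrightarrow> Cinf_on S g"
  using Ck_on_cong[OF assms] by (simp add: Cinf_on_def)

lemma Cinf_on_subset: "Cinf_on S f \<Longrightarrow> T \<subseteq> S \<Longrightarrow> Cinf_on T f"
  by (auto simp: Cinf_on_def intro: Ck_on_subset)

lemma Cinf_on_const [simp]: "Cinf_on S (\<lambda>x. c)"
  by (simp add: Cinf_on_def)

lemma Cinf_on_bounded_linear: "bounded_linear T \<Longrightarrow> Cinf_on S T"
  by (simp add: Cinf_on_def Ck_on_bounded_linear)

lemma Cinf_on_compose_linear:
  "bounded_linear T \<Longrightarrow> Cinf_on S f \<Longrightarrow> open S \<Longrightarrow> Cinf_on S (\<lambda>x. T (f x))"
  by (simp add: Cinf_on_def Ck_on_compose_linear)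

lemma Cinf_on_add: "Cinf_on S f \<Longrightarrow> Cinf_on S g \<Longrightarrow> open S \<Longrightarrow> Cinf_on S (\<lambda>x. f x + g x)"
  by (simp add: Cinf_on_def Ck_on_add)

lemma Cinf_on_mult:
  fixes f g :: "'a::euclidean_space \<Rightarrow> real"
  shows "Cinf_on S f \<Longrightarrow> Cinf_on S g \<Longrightarrow> open S \<Longrightarrow> Cinf_on S (\<lambda>x. f x * g x)"
  by (simp add: Cinf_on_def Ck_on_mult)

lemma Cinf_on_local:
  assumes "\<And>x. x \<in> S \<Longrightarrow> \<exists>T. open T \<and> x \<in> T \<and> Cinf_on T f"
  shows "Cinf_on S f"
  unfolding Cinf_on_def using assms by (auto intro!: Ck_on_local simp: Cinf_on_def)

lemma Cinf_on_compose:
  fixes f :: "'b::euclidean_space \<Rightarrow> real" and g :: "'a::euclidean_space \<Rightarrow> 'b"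
  shows "Cinf_on T f \<Longrightarrow> Cinf_on S g \<Longrightarrow> open S \<Longrightarrow> g ` S \<subseteq> T \<Longrightarrow> Cinf_on S (\<lambda>x. f (g x))"
  unfolding Cinf_on_def by (blast intro: Ck_on_compose)

lemma Cinf_on_inverse:
  fixes f :: "'a::euclidean_space \<Rightarrow> real"
  assumes "Cinf_on S f" "open S" "\<And>x. x \<in> S \<Longrightarrow> f x \<noteq> 0"
  shows "Cinf_on S (\<lambda>x. inverse (f x))"
  using assms by (rule_tac Cinf_on_compose[of "- {0}" inverse]) (auto simp: Cinf_on_def Ck_on_inverse)

lemma Cinf_on_differentiable: "Cinf_on S f \<Longrightarrow> x \<in> S \<Longrightarrow> f differentiable (at x)"
  by (auto simp: Cinf_on_def dest: spec[of _ "Suc 0"])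

lemma Cinf_on_frechet_derivative: "Cinf_on S f \<Longrightarrow> Cinf_on S (\<lambda>x. frechet_derivative f (at x) v)"
  unfolding Cinf_on_def using Ck_on.simps(2) by blast

lemma Cinf_on_continuous_on: "Cinf_on S f \<Longrightarrow> continuous_on S f"
  by (auto simp: Cinf_on_def dest: spec[of _ 0])


subsection \<open>Bump functions\<close>

text \<open>A single term of the exponential series; at \<open>inverse t\<close> it shows that
  \<open>exp (- inverse t)\<close> beats every power of \<open>inverse t\<close>.\<close>

lemma power_div_fact_le_exp:
  fixes x :: real
  assumes "0 \<le> x"
  shows "x ^ m / fact m \<le> exp x"
proof -
  have "(\<Sum>n\<in>{m}. x ^ n /\<^sub>R fact n) \<le> (\<Sum>n. x ^ n /\<^sub>R fact n)"
    by (rule sum_le_suminf) (use assms summable_exp_generic[of x] in auto)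
  then show ?thesis by (simp add: exp_def field_simps)
qed

text \<open>The powers of \<open>inverse t\<close> are carried along because the derivative of
  \<open>flat_exp n\<close> is a combination of \<open>flat_exp (n + 2)\<close> and
  \<open>flat_exp (n + 1)\<close>: the family is closed under differentiation, so smoothness of all
  members follows by one induction.\<close>

definition flat_exp :: "nat \<Rightarrow> real \<Rightarrow> real" where
  "flat_exp n t = (if t \<le> 0 then 0 else exp (- inverse t) * inverse t ^ n)"

text \<open>Two spare powers of \<open>t\<close> are kept: one is consumed by the difference
  quotient at 0, the other makes the quotient tend to 0.\<close>

lemma flat_exp_le:
  "\<bar>flat_exp n t\<bar> \<le> fact (n + 2) * t\<^sup>2"
proof (cases "t \<le> 0")
  case False
  then have t: "t > 0" by simp
  have "inverse t ^ (n + 2) / fact (n + 2) \<le> exp (inverse t)"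
    using t by (intro power_div_fact_le_exp) simp
  then have "inverse t ^ n * exp (- inverse t) \<le> fact (n + 2) * t\<^sup>2"
    using t by (simp add: exp_minus field_simps power_add power2_eq_square del: fact_Suc)
  then show ?thesis using t by (simp add: flat_exp_def mult.commute del: fact_Suc)
qed (simp add: flat_exp_def)

lemma flat_exp_has_derivative:
  "(flat_exp n has_real_derivative (flat_exp (n + 2) t - n * flat_exp (n + 1) t)) (at t)"
proof -
  consider "t > 0" | "t < 0" | "t = 0" by linarith
  then show ?thesis
  proof cases
    case 1
    have "((\<lambda>t. exp (- inverse t) * inverse t ^ n) has_real_derivative
        (flat_exp (n + 2) t - n * flat_exp (n + 1) t)) (at t)"
    proof -
      have "real n * inverse t ^ (n - Suc 0) * (inverse t * inverse t) = real n * inverse t ^ (n + 1)"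
        by (cases n) auto
      then show ?thesis
        using 1 by (auto intro!: derivative_eq_intros simp: flat_exp_def algebra_simps)
    qed
    then show ?thesis
      by (rule has_field_derivative_transform_within_open[of _ _ _ "{0<..}"]) (use 1 in \<open>auto simp: flat_exp_def\<close>)
  next
    case 2
    have "((\<lambda>t. 0) has_real_derivative (flat_exp (n + 2) t - n * flat_exp (n + 1) t)) (at t)"
      using 2 by (auto simp: flat_exp_def)
    then show ?thesis
      by (rule has_field_derivative_transform_within_open[of _ _ _ "{..<0}"]) (use 2 in \<open>auto simp: flat_exp_def\<close>)
  next
    case 3
    have "((\<lambda>h. (flat_exp n (0 + h) - flat_exp n 0) / h) \<longlongrightarrow> 0) (at 0)"
    proof (rule Lim_null_comparison)
      have "\<bar>flat_exp n h / h\<bar> \<le> fact (n + 2) * \<bar>h\<bar>" for h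
        using flat_exp_le[of n h]
        by (cases "h = 0") (simp_all add: abs_divide divide_le_eq power2_eq_square mult.assoc flip: abs_mult)
      then show "\<forall>\<^sub>F h in at 0. norm ((flat_exp n (0 + h) - flat_exp n 0) / h) \<le> fact (n + 2) * \<bar>h\<bar>"
        by (simp add: flat_exp_def del: fact_Suc)
      show "((\<lambda>h. fact (n + 2) * \<bar>h\<bar>) \<longlongrightarrow> (0::real)) (at 0)"
        by (auto intro!: tendsto_eq_intros)
    qed
    then show ?thesis using 3 by (simp add: DERIV_def flat_exp_def)
  qed
qed

lemma Cinf_flat_exp: "Cinf_on UNIV (flat_exp n)"
proof -
  have "Ck_on k UNIV (flat_exp n)" for k
  proof (induction k arbitrary: n)
    case 0
    then show ?case by (auto intro!: continuous_at_imp_continuous_on DERIV_isCont[OF flat_exp_has_derivative])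
  next
    case (Suc k)
    have d: "(flat_exp n has_derivative (\<lambda>v. v * (flat_exp (n + 2) t + (- real n) * flat_exp (n + 1) t))) (at t)" for t
      using flat_exp_has_derivative[of n t] by (simp add: has_field_derivative_def mult_commute_abs)
    show ?case
      by (rule Ck_on_SucI[OF open_UNIV d]) (intro Ck_on_mult Ck_on_add Suc Ck_on_const, auto)
  qed
  then show ?thesis by (simp add: Cinf_on_def)
qed

lemma smooth_bump:
  fixes x0 :: "'a::euclidean_space"
  assumes "0 < r" "r < R"
  obtains \<eta> :: "'a \<Rightarrow> real" where "Cinf_on UNIV \<eta>" "\<And>x. 0 \<le> \<eta> x"
    "\<And>x. dist x x0 \<le> r \<Longrightarrow> \<eta> x = 1" "\<And>x. R \<le> dist x x0 \<Longrightarrow> \<eta> x = 0"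
proof -
  define s where "s x = R\<^sup>2 + - ((x - x0) \<bullet> (x - x0))" for x :: 'a
  \<comment> \<open>The first term of the denominator vanishes exactly outside the open ball of
    radius \<open>R\<close>, the second, whose argument is the squared distance minus
    \<open>r\<^sup>2\<close>, exactly on the closed ball of radius \<open>r\<close>. As
    \<open>r < R\<close>, they never vanish together.\<close>
  define \<eta> where "\<eta> x = flat_exp 0 (s x) * inverse (flat_exp 0 (s x) + flat_exp 0 (R\<^sup>2 - r\<^sup>2 + - s x))" for x
  have sq: "r\<^sup>2 < R\<^sup>2" using assms by (simp add: power_strict_mono)
  have s: "s x = R\<^sup>2 - (dist x x0)\<^sup>2" for x
    by (simp add: s_def dist_norm power2_norm_eq_inner)
  have pos: "flat_exp 0 t > 0 \<longleftrightarrow> t > 0" "0 \<le> flat_exp 0 t" "flat_exp 0 t = 0 \<longleftrightarrow> t \<le> 0" for t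
    by (auto simp: flat_exp_def)
  have den: "flat_exp 0 (s x) + flat_exp 0 (R\<^sup>2 - r\<^sup>2 + - s x) > 0" for x
    using sq pos by (smt (verit))
  have lin: "Cinf_on UNIV (\<lambda>x. (x - x0) \<bullet> (x - x0))"
  proof -
    have "Cinf_on UNIV (\<lambda>x. \<Sum>b\<in>B. ((x - x0) \<bullet> b) * ((x - x0) \<bullet> b))" if "finite B" for B :: "'a set"
      using that
    proof induction
      case (insert b B)
      have "Cinf_on UNIV (\<lambda>x. (x + - x0) \<bullet> b)"
        by (intro Cinf_on_compose_linear[OF bounded_linear_inner_left] Cinf_on_add
            Cinf_on_bounded_linear[OF bounded_linear_ident]) auto
      with insert show ?case by (auto intro!: Cinf_on_add Cinf_on_mult)
    qed simp
    moreover have "(\<lambda>x. (x - x0) \<bullet> (x - x0)) = (\<lambda>x. \<Sum>b\<in>Basis. ((x - x0) \<bullet> b) * ((x - x0) \<bullet> b))"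
      by (rule ext) (rule euclidean_inner)
    ultimately show ?thesis by simp
  qed
  have cs: "Cinf_on UNIV s"
    unfolding s_def by (intro Cinf_on_add Cinf_on_compose_linear[OF bounded_linear_minus[OF bounded_linear_ident]] lin) auto
  have e1: "Cinf_on UNIV (\<lambda>x. flat_exp 0 (s x))"
    by (rule Cinf_on_compose[OF Cinf_flat_exp cs]) auto
  have "Cinf_on UNIV (\<lambda>x. R\<^sup>2 - r\<^sup>2 + - s x)"
    by (intro Cinf_on_add Cinf_on_const Cinf_on_compose_linear[OF bounded_linear_minus[OF bounded_linear_ident] cs]) auto
  then have "Cinf_on UNIV (\<lambda>x. flat_exp 0 (R\<^sup>2 - r\<^sup>2 + - s x))"
    by (rule Cinf_on_compose[OF Cinf_flat_exp]) auto
  then have "Cinf_on UNIV (\<lambda>x. flat_exp 0 (s x) + flat_exp 0 (R\<^sup>2 - r\<^sup>2 + - s x))"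
    by (rule Cinf_on_add[OF e1]) auto
  then have "Cinf_on UNIV (\<lambda>x. inverse (flat_exp 0 (s x) + flat_exp 0 (R\<^sup>2 - r\<^sup>2 + - s x)))"
    by (rule Cinf_on_inverse) (use den in \<open>auto simp: less_le\<close>)
  then have "Cinf_on UNIV \<eta>"
    unfolding \<eta>_def by (rule Cinf_on_mult[OF e1]) auto
  moreover have "0 \<le> \<eta> x" for x using den[of x] pos by (simp add: \<eta>_def)
  moreover have "\<eta> x = 1" if "dist x x0 \<le> r" for x
  proof -
    have "(dist x x0)\<^sup>2 \<le> r\<^sup>2" using that by (simp add: power_mono)
    then have "R\<^sup>2 - r\<^sup>2 + - s x \<le> 0" "0 < s x" using s[of x] sq by linarith+
    then show ?thesis using pos(3)[of "s x"] pos(3)[of "R\<^sup>2 - r\<^sup>2 + - s x"] by (simp add: \<eta>_def)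
  qed
  moreover have "\<eta> x = 0" if "R \<le> dist x x0" for x
  proof -
    have "R\<^sup>2 \<le> (dist x x0)\<^sup>2" using that assms by (simp add: power_mono)
    then show ?thesis using s pos(3)[of "s x"] by (simp add: \<eta>_def)
  qed
  ultimately show ?thesis by (rule that)
qed


subsection \<open>Integration by parts and determinants\<close>

lemma integrable_compact_support:
  fixes f :: "'a::euclidean_space \<Rightarrow> real"
  assumes "continuous_on K f" "compact K" "\<And>x. x \<notin> K \<Longrightarrow> f x = 0"
  shows "integrable lborel f"
proof -
  have "(\<lambda>x. indicator K x *\<^sub>R f x) = f" using assms(3) by (auto simp: fun_eq_iff indicator_def)
  then show ?thesis using borel_integrable_compact[OF assms(2,1)] by simp
qed

text \<open>Provides the compact sets that contain the supports of all difference quotients with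
  step at most 1.\<close>

lemma compact_translates:
  fixes K :: "'a::euclidean_space set"
  assumes "compact K"
  shows "compact {y + s *\<^sub>R v | y s. y \<in> K \<and> s \<in> {-1..1::real}}"
proof -
  have "compact ((\<lambda>z. fst z + snd z *\<^sub>R v) ` (K \<times> {-1..1}))"
    using assms by (intro compact_continuous_image compact_Times) (auto intro!: continuous_intros)
  also have "(\<lambda>z. fst z + snd z *\<^sub>R v) ` (K \<times> {-1..1}) = {y + s *\<^sub>R v | y s. y \<in> K \<and> s \<in> {-1..1}}"
  proof (intro set_eqI iffI)
    fix x assume "x \<in> (\<lambda>z. fst z + snd z *\<^sub>R v) ` (K \<times> {-1..1})"
    then obtain z where "z \<in> K \<times> {-1..1}" "x = fst z + snd z *\<^sub>R v" by blast
    then show "x \<in> {y + s *\<^sub>R v | y s. y \<in> K \<and> s \<in> {-1..1}}"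
      by (intro CollectI exI[of _ "fst z"] exI[of _ "snd z"]) auto
  next
    fix x assume "x \<in> {y + s *\<^sub>R v | y s. y \<in> K \<and> s \<in> {-1..1}}"
    then obtain y s where "y \<in> K" "s \<in> {-1..1}" "x = y + s *\<^sub>R v" by blast
    then show "x \<in> (\<lambda>z. fst z + snd z *\<^sub>R v) ` (K \<times> {-1..1})"
      by (intro image_eqI[of _ _ "(y, s)"]) auto
  qed
  finally show ?thesis .
qed

text \<open>The integral of \<open>F\<close> is invariant under translations by \<open>t v\<close>; differentiate at \<open>t = 0\<close>.\<close>

lemma integral_directional_derivative_eq_0:
  fixes F :: "'a::euclidean_space \<Rightarrow> real"
  assumes F: "\<And>x. (F has_derivative F' x) (at x)" and F': "continuous_on UNIV (\<lambda>x. F' x v)"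
    and K: "compact K" "\<And>x. x \<notin> K \<Longrightarrow> F x = 0"
  shows "(\<integral>x. F' x v \<partial>lborel) = 0"
proof -
  define t where "t n = inverse (real (Suc n))" for n
  have t: "0 < t n" "t n \<le> 1" "t n \<noteq> 0" for n by (auto simp: t_def field_simps)
  have t_lim: "filterlim t (at 0) sequentially"
    unfolding t_def filterlim_at by (intro conjI LIMSEQ_inverse_real_of_nat) auto
  define q where "q n x = (F (x + t n *\<^sub>R v) - F x) / t n" for n x
  have D: "((\<lambda>s. F (x + s *\<^sub>R v)) has_real_derivative F' (x + s *\<^sub>R v) v) (at s)" for x s
  proof -
    have "((\<lambda>s. x + s *\<^sub>R v) has_derivative (\<lambda>s. s *\<^sub>R v)) (at s)"
      by (auto intro!: derivative_eq_intros)
    from diff_chain_at[OF this F]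
    have "((\<lambda>s. F (x + s *\<^sub>R v)) has_derivative (\<lambda>h. F' (x + s *\<^sub>R v) (h *\<^sub>R v))) (at s)"
      by (simp add: comp_def)
    then show ?thesis
      by (simp add: has_field_derivative_def linear_cmul[OF has_derivative_linear[OF F]] mult_commute_abs)
  qed
  have contF: "continuous_on S F" for S
    using F has_derivative_continuous_on[of S F F'] has_derivative_at_withinI by blast
  have lim: "(\<lambda>n. q n x) \<longlonglongrightarrow> F' x v" for x
  proof -
    have "((\<lambda>h. (F (x + h *\<^sub>R v) - F x) / h) \<longlongrightarrow> F' x v) (at 0)"
      using D[of x 0] by (simp add: DERIV_def)
    from filterlim_compose[OF this t_lim] show ?thesis by (simp add: q_def)
  qed
  \<comment> \<open>\<open>K1\<close> contains the support of every difference quotient;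
    \<open>K2\<close> contains the intermediate points at which the mean value theorem evaluates the
    derivative. A bound on \<open>K2\<close> thus dominates all quotients by a multiple of the
    indicator of \<open>K1\<close>.\<close>
  define K1 where "K1 = {y + s *\<^sub>R v | y s. y \<in> K \<and> s \<in> {-1..1::real}}"
  define K2 where "K2 = {y + s *\<^sub>R v | y s. y \<in> K1 \<and> s \<in> {-1..1::real}}"
  have K12: "compact K1" "compact K2"
    using compact_translates[OF K(1)] compact_translates[of K1] by (auto simp: K1_def K2_def)
  obtain C where C: "\<And>x. x \<in> K2 \<Longrightarrow> \<bar>F' x v\<bar> \<le> C"
    using compact_imp_bounded[OF compact_continuous_image[OF continuous_on_subset[OF F'] K12(2)]]
    by (auto simp: bounded_iff)
  have bound: "norm (q n x) \<le> indicator K1 x *\<^sub>R C" for n x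
  proof (cases "x \<in> K1")
    case True
    have "\<exists>z>0. z < t n \<and> F (x + t n *\<^sub>R v) - F (x + 0 *\<^sub>R v) = (t n - 0) * F' (x + z *\<^sub>R v) v"
      using t by (intro MVT2 D) auto
    then obtain z where z: "0 < z" "z < t n" "F (x + t n *\<^sub>R v) - F x = t n * F' (x + z *\<^sub>R v) v"
      by auto
    have "x + z *\<^sub>R v \<in> K2" unfolding K2_def using True z t[of n] by (intro CollectI exI[of _ x] exI[of _ z]) auto
    then show ?thesis using True z(3) t[of n] C by (simp add: q_def)
  next
    case False
    have "x + s *\<^sub>R v \<notin> K" if "0 \<le> s" "s \<le> 1" for s
    proof
      assume "x + s *\<^sub>R v \<in> K"
      then have "x \<in> K1" unfolding K1_def using that
        by (intro CollectI exI[of _ "x + s *\<^sub>R v"] exI[of _ "- s"]) auto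
      with False show False ..
    qed
    from this[of "t n"] this[of 0] show ?thesis using False t[of n] K(2) by (simp add: q_def)
  qed
  have intF: "integrable lborel F" by (rule integrable_compact_support[OF contF K])
  have shift: "integrable lborel (\<lambda>x. F (x + w))" "(\<integral>x. F (x + w) \<partial>lborel) = (\<integral>x. F x \<partial>lborel)" for w
  proof -
    have m: "(+) w \<in> lborel \<rightarrow>\<^sub>M borel" by simp
    have F_m: "F \<in> borel_measurable borel" using contF[of UNIV] by (rule borel_measurable_continuous_onI)
    show "integrable lborel (\<lambda>x. F (x + w))"
      using integrable_distr[OF m, of F] intF by (simp add: lborel_distr_plus add.commute)
    show "(\<integral>x. F (x + w) \<partial>lborel) = (\<integral>x. F x \<partial>lborel)"
      using integral_distr[OF m F_m] by (simp add: lborel_distr_plus add.commute)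
  qed
  have q0: "(\<integral>x. q n x \<partial>lborel) = 0" for n
    using shift intF by (simp add: q_def)
  have "(\<lambda>n. \<integral>x. q n x \<partial>lborel) \<longlonglongrightarrow> (\<integral>x. F' x v \<partial>lborel)"
  proof (rule integral_dominated_convergence)
    show "integrable lborel (\<lambda>x. indicator K1 x *\<^sub>R C)"
      using borel_integrable_compact[OF K12(1) continuous_on_const] .
    show "(\<lambda>x. F' x v) \<in> borel_measurable lborel"
      using F' by (simp add: borel_measurable_continuous_onI)
    have "continuous_on UNIV (q n)" for n
      unfolding q_def using t by (intro continuous_intros continuous_on_compose2[OF contF[of UNIV]]) auto
    then show "\<And>n. q n \<in> borel_measurable lborel"
      by (simp add: borel_measurable_continuous_onI)
  qed (use lim bound in auto)
  then show ?thesis using LIMSEQ_unique[OF _ tendsto_const] by (simp add: q0)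
qed

text \<open>The set where \<open>G\<close> is nonzero is open and a null set, hence empty.\<close>

lemma integral_eq_0_imp_eq_0:
  fixes G :: "'a::euclidean_space \<Rightarrow> real"
  assumes "continuous_on UNIV G" "\<And>x. 0 \<le> G x" "compact K" "\<And>x. x \<notin> K \<Longrightarrow> G x = 0"
    "(\<integral>x. G x \<partial>lborel) = 0"
  shows "G x = 0"
proof -
  have "integrable lborel G"
    using integrable_compact_support[of K G] assms continuous_on_subset by blast
  then have "AE x in lborel. G x = 0"
    using assms integral_nonneg_eq_0_iff_AE[of lborel G] by auto
  then have "AE x in lborel. x \<notin> {x. G x \<noteq> 0}" by simp
  moreover have o: "open {x. G x \<noteq> 0}"
    using assms(1) by (intro open_Collect_neq) auto
  ultimately have "{x. G x \<noteq> 0} \<in> null_sets lborel"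
    by (subst AE_iff_null_sets) auto
  then have "negligible {x. G x \<noteq> 0}"
    by (simp add: negligible_iff_null_sets null_sets_completionI)
  with o have "{x. G x \<noteq> 0} = {}" using open_not_negligible by blast
  then show ?thesis by auto
qed

text \<open>Jacobi's formula. Multiplication by the inverse \<open>B\<close> moves the base point to
  the identity matrix. There a permutation other than the identity moves at least two indices, so
  after one factor is differentiated an off-diagonal zero remains, and only the trace
  survives.\<close>

lemma has_derivative_det:
  fixes A :: "'a::real_normed_vector \<Rightarrow> real ^ 'n ^ 'n"
  assumes A: "\<And>i j. ((\<lambda>x. A x $ i $ j) has_derivative A' i j) (at x0)"
    and B: "B ** A x0 = mat 1"
  shows "((\<lambda>x. det (A x)) has_derivative
    (\<lambda>v. det (A x0) * (\<Sum>i\<in>UNIV. \<Sum>j\<in>UNIV. B $ i $ j * A' j i v))) (at x0)"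
proof -
  define C where "C x = B ** A x" for x
  define C' where "C' i k v = (\<Sum>j\<in>UNIV. B $ i $ j * A' j k v)" for i k v
  have C: "((\<lambda>x. C x $ i $ k) has_derivative C' i k) (at x0)" for i k
    unfolding C_def C'_def matrix_matrix_mult_def
    by (auto intro!: derivative_eq_intros A)
  have C0: "C x0 = mat 1" using B by (simp add: C_def)
  define P where "P = {p. p permutes (UNIV :: 'n set)}"
  define dd where "dd p v = of_int (sign p) * (\<Sum>i\<in>UNIV. C' i (p i) v * (\<Prod>j\<in>UNIV - {i}. C x0 $ j $ p j))" for p v
  have "((\<lambda>x. det (C x)) has_derivative (\<lambda>v. \<Sum>p\<in>P. dd p v)) (at x0)"
    unfolding det_def P_def[symmetric] dd_def
    by (intro has_derivative_sum has_derivative_mult_right has_derivative_prod C)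
  moreover have "(\<Sum>p\<in>P. dd p v) = (\<Sum>i\<in>UNIV. C' i i v)" for v
  proof -
    have "dd p v = 0" if p: "p \<in> P - {id}" for p
    proof -
      have moved: "\<exists>j. j \<noteq> i \<and> p j \<noteq> j" for i
      proof (rule ccontr)
        assume "\<not> ?thesis"
        then have *: "\<And>j. j \<noteq> i \<Longrightarrow> p j = j" by auto
        have "inj p" using p by (auto simp: P_def permutes_inj)
        then have "p i = i" using * by (metis injD)
        with * have "p x = x" for x by (cases "x = i") auto
        then have "p = id" by (simp add: fun_eq_iff)
        with p show False by simp
      qed
      have "(\<Prod>j\<in>UNIV - {i}. C x0 $ j $ p j) = 0" for i
      proof -
        obtain j where "j \<noteq> i" "p j \<noteq> j" using moved by blast
        then show ?thesis by (intro prod_zero bexI[of _ j]) (auto simp: C0 mat_def)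
      qed
      then show ?thesis by (simp only: dd_def mult_zero_right sum.neutral_const)
    qed
    then have "(\<Sum>p\<in>P. dd p v) = (\<Sum>p\<in>{id}. dd p v)"
      by (intro sum.mono_neutral_right) (auto simp: P_def finite_permutations permutes_id)
    then show ?thesis by (simp add: dd_def C0 mat_def sign_id)
  qed
  ultimately have "((\<lambda>x. det (C x)) has_derivative (\<lambda>v. \<Sum>i\<in>UNIV. C' i i v)) (at x0)" by simp
  then have "((\<lambda>x. det (A x0) * det (C x)) has_derivative (\<lambda>v. det (A x0) * (\<Sum>i\<in>UNIV. C' i i v))) (at x0)"
    by (rule has_derivative_mult_right)
  moreover have "det (A x0) * det B = 1"
    using B by (metis det_I det_mul mult.commute)
  then have "det (A x0) * det (C x) = det (A x)" for x
    by (simp add: C_def det_mul mult.assoc[symmetric])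
  ultimately show ?thesis by (simp add: C'_def)
qed


section \<open>Functions, tangent vectors and vector fields on a smooth manifold\<close>

locale manifold =
  fixes A :: "('m::{t2_space,second_countable_topology}, 'n::finite) chart set"
  assumes smooth_manifold: "smooth_manifold A"
begin

lemma chart_cover: obtains c where "c \<in> A" "p \<in> fst c"
proof -
  have "p \<in> (\<Union>c\<in>A. fst c)" using smooth_manifold by (simp add: smooth_manifold_def)
  then show ?thesis using that by blast
qed

context
  fixes c assumes c: "c \<in> A"
begin

lemma chart_homeomorphism: "homeomorphism (fst c) (snd c ` fst c) (snd c) (chart_inv c)"
  and open_chart: "open (fst c)"
  and open_chart_range: "open (snd c ` fst c)"
  using smooth_manifold c by (auto simp: smooth_manifold_def)

lemma chart_inv_chart: "q \<in> fst c \<Longrightarrow> chart_inv c (snd c q) = q"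
  using homeomorphism_apply1[OF chart_homeomorphism] .

lemma chart_chart_inv: "x \<in> snd c ` fst c \<Longrightarrow> snd c (chart_inv c x) = x"
  using homeomorphism_apply2[OF chart_homeomorphism] .

lemma open_chart_image: "open U \<Longrightarrow> open (snd c ` (U \<inter> fst c))"
proof -
  assume U: "open U"
  have "snd c ` (U \<inter> fst c) = snd c ` fst c \<inter> chart_inv c -` U"
    using chart_inv_chart by force
  then show ?thesis
    using continuous_open_preimage[OF homeomorphism_cont2[OF chart_homeomorphism] open_chart_range U] by simp
qed

lemma transition: "c' \<in> A \<Longrightarrow> Cinf_on (snd c ` (fst c \<inter> fst c')) (\<lambda>x. snd c' (chart_inv c x))"
  using smooth_manifold c by (auto simp: smooth_manifold_def comp_def)

end

lemma chart_inv_pair: "(S, \<phi>) \<in> A \<Longrightarrow> q \<in> S \<Longrightarrow> inv_into S \<phi> (\<phi> q) = q"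
  using chart_inv_chart[of "(S, \<phi>)" q] by simp

lemma smooth_iff:
  "smooth A U f \<longleftrightarrow> (\<forall>c\<in>A. Cinf_on (snd c ` (U \<inter> fst c)) (\<lambda>x. f (chart_inv c x)))"
  by (simp add: smooth_def comp_def)

lemma smooth_const [simp]: "smooth A U (\<lambda>q. a)"
  by (simp add: smooth_iff)

lemma smooth_add: "smooth A U f \<Longrightarrow> smooth A U g \<Longrightarrow> open U \<Longrightarrow> smooth A U (\<lambda>q. f q + g q)"
  by (auto simp: smooth_iff intro!: Cinf_on_add open_chart_image)

lemma smooth_mult: "smooth A U f \<Longrightarrow> smooth A U g \<Longrightarrow> open U \<Longrightarrow> smooth A U (\<lambda>q. f q * g q)"
  by (auto simp: smooth_iff intro!: Cinf_on_mult open_chart_image)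

lemma smooth_minus: "smooth A U f \<Longrightarrow> open U \<Longrightarrow> smooth A U (\<lambda>q. - f q)"
  using smooth_mult[OF smooth_const[of U "-1"]] by simp

lemma smooth_diff: "smooth A U f \<Longrightarrow> smooth A U g \<Longrightarrow> open U \<Longrightarrow> smooth A U (\<lambda>q. f q - g q)"
  using smooth_add[OF _ smooth_minus] by simp

lemma smooth_sum:
  "(\<And>i. i \<in> I \<Longrightarrow> smooth A U (f i)) \<Longrightarrow> open U \<Longrightarrow> smooth A U (\<lambda>q. \<Sum>i\<in>I. f i q)"
  by (induction I rule: infinite_finite_induct) (auto intro!: smooth_add)

lemma smooth_prod:
  "(\<And>i. i \<in> I \<Longrightarrow> smooth A U (f i)) \<Longrightarrow> open U \<Longrightarrow> smooth A U (\<lambda>q. \<Prod>i\<in>I. f i q)"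
  by (induction I rule: infinite_finite_induct) (auto intro!: smooth_mult)

lemma smooth_inverse:
  "smooth A U f \<Longrightarrow> open U \<Longrightarrow> (\<And>q. q \<in> U \<Longrightarrow> f q \<noteq> 0) \<Longrightarrow> smooth A U (\<lambda>q. inverse (f q))"
  unfolding smooth_iff
  by (intro ballI Cinf_on_inverse open_chart_image) (auto simp: chart_inv_pair)

lemma smooth_subset: "smooth A U f \<Longrightarrow> U' \<subseteq> U \<Longrightarrow> smooth A U' f"
  unfolding smooth_iff by (meson Cinf_on_subset Int_mono image_mono subset_refl)

lemma smooth_cong:
  assumes "open U" "\<And>q. q \<in> U \<Longrightarrow> f q = g q"
  shows "smooth A U f \<longleftrightarrow> smooth A U g"
  unfolding smooth_iff using assms
  by (intro ball_cong refl Cinf_on_cong open_chart_image) (auto simp: chart_inv_pair)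

text \<open>The expression in any other chart differs by a transition map, so a single chart
  suffices on a set inside its domain.\<close>

lemma smooth_chartI:
  assumes c: "c \<in> A" "U \<subseteq> fst c" "open U" and f: "Cinf_on (snd c ` U) (\<lambda>x. f (chart_inv c x))"
  shows "smooth A U f"
  unfolding smooth_iff
proof
  fix c' assume c': "c' \<in> A"
  have o: "open (snd c' ` (U \<inter> fst c'))" using open_chart_image[OF c'] c(3) .
  have "Cinf_on (snd c' ` (U \<inter> fst c')) (\<lambda>x. f (chart_inv c (snd c (chart_inv c' x))))"
    by (rule Cinf_on_compose[OF f Cinf_on_subset[OF transition[OF c' c(1)]] o])
       (use c c' in \<open>auto simp: chart_inv_chart\<close>)
  then show "Cinf_on (snd c' ` (U \<inter> fst c')) (\<lambda>x. f (chart_inv c' x))"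
    by (subst Cinf_on_cong[OF o, where g="\<lambda>x. f (chart_inv c (snd c (chart_inv c' x)))"])
       (use c c' in \<open>auto simp: chart_inv_chart subset_iff\<close>)
qed

lemma smooth_coord: "c \<in> A \<Longrightarrow> smooth A (fst c) (\<lambda>q. snd c q $ k)"
proof (rule smooth_chartI[of c])
  assume c: "c \<in> A"
  show "Cinf_on (snd c ` fst c) (\<lambda>x. snd c (chart_inv c x) $ k)"
    by (subst Cinf_on_cong[OF open_chart_range[OF c], where g="\<lambda>x. x $ k"])
       (auto simp: chart_inv_chart[OF c] intro: Cinf_on_bounded_linear bounded_linear_vec_nth)
qed (auto simp: open_chart)

lemma smooth_local:
  assumes "\<And>p. p \<in> U \<Longrightarrow> \<exists>V. open V \<and> p \<in> V \<and> smooth A V f"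
  shows "smooth A U f"
  unfolding smooth_iff
proof
  fix c assume c: "c \<in> A"
  show "Cinf_on (snd c ` (U \<inter> fst c)) (\<lambda>x. f (chart_inv c x))"
  proof (rule Cinf_on_local)
    fix x assume "x \<in> snd c ` (U \<inter> fst c)"
    then obtain p where p: "x = snd c p" "p \<in> U" "p \<in> fst c" by auto
    with assms obtain V where V: "open V" "p \<in> V" "smooth A V f" by blast
    then show "\<exists>T. open T \<and> x \<in> T \<and> Cinf_on T (\<lambda>x. f (chart_inv c x))"
      using p c open_chart_image[OF c V(1)] by (intro exI[of _ "snd c ` (V \<inter> fst c)"]) (auto simp: smooth_iff)
  qed
qed

lemma smooth_chart_smooth: "c \<in> A \<Longrightarrow> smooth A U f \<Longrightarrow> U \<subseteq> fst c \<Longrightarrow> Cinf_on (snd c ` U) (\<lambda>x. f (chart_inv c x))"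
  by (auto simp: smooth_iff Int_absorb2)

lemma smooth_continuous_on:
  assumes "open U" "smooth A U f"
  shows "continuous_on U f"
proof -
  have "isCont f p" if p: "p \<in> U" for p
  proof -
    obtain c where c: "c \<in> A" "p \<in> fst c" by (rule chart_cover)
    let ?V = "U \<inter> fst c"
    have "continuous_on (snd c ` ?V) (\<lambda>x. f (chart_inv c x))"
      using assms(2) c by (auto simp: smooth_iff intro: Cinf_on_continuous_on)
    moreover have "continuous_on ?V (snd c)"
      using homeomorphism_cont1[OF chart_homeomorphism[OF c(1)]] continuous_on_subset by blast
    ultimately have "continuous_on ?V (\<lambda>q. f (chart_inv c (snd c q)))"
      by (auto intro: continuous_on_compose2)
    then have "continuous_on ?V f"
      by (subst continuous_on_cong[OF refl, where g="\<lambda>q. f (chart_inv c (snd c q))"])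
         (auto simp: chart_inv_chart[OF c(1)])
    then show ?thesis
      using continuous_on_eq_continuous_at[of ?V f] open_chart[OF c(1)] assms(1) c p by auto
  qed
  then show ?thesis by (simp add: continuous_at_imp_continuous_on)
qed

lemma smooth_nearI: "smooth A U f \<Longrightarrow> open U \<Longrightarrow> p \<in> U \<Longrightarrow> smooth_near A p f"
  by (auto simp: smooth_near_def)

lemma smooth_nearE:
  assumes "smooth_near A p f" "open U" "p \<in> U"
  obtains V where "open V" "p \<in> V" "V \<subseteq> U" "smooth A V f"
proof -
  obtain V where "open V" "p \<in> V" "smooth A V f" using assms(1) by (auto simp: smooth_near_def)
  then show ?thesis using that[of "V \<inter> U"] assms smooth_subset[of V f] by auto
qed

lemma smooth_near_const [simp]: "smooth_near A p (\<lambda>q. a)"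
  by (rule smooth_nearI[of UNIV]) auto

lemma smooth_near_add: 
  assumes "smooth_near A p f" "smooth_near A p g"
  shows "smooth_near A p (\<lambda>q. f q + g q)"
proof -
  obtain U where U: "open U" "p \<in> U" "smooth A U f" using assms(1) by (auto simp: smooth_near_def)
  obtain V where V: "open V" "p \<in> V" "V \<subseteq> U" "smooth A V g" using smooth_nearE[OF assms(2) U(1,2)] .
  show ?thesis
    using V smooth_subset[OF U(3) V(3)] by (intro smooth_nearI[of V] smooth_add) auto
qed

lemma smooth_near_mult: 
  assumes "smooth_near A p f" "smooth_near A p g"
  shows "smooth_near A p (\<lambda>q. f q * g q)"
proof -
  obtain U where U: "open U" "p \<in> U" "smooth A U f" using assms(1) by (auto simp: smooth_near_def)
  obtain V where V: "open V" "p \<in> V" "V \<subseteq> U" "smooth A V g" using smooth_nearE[OF assms(2) U(1,2)] .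
  show ?thesis
    using V smooth_subset[OF U(3) V(3)] by (intro smooth_nearI[of V] smooth_mult) auto
qed

lemma smooth_near_sum: "(\<And>i. i \<in> I \<Longrightarrow> smooth_near A p (f i)) \<Longrightarrow> smooth_near A p (\<lambda>q. \<Sum>i\<in>I. f i q)"
  by (induction I rule: infinite_finite_induct) (auto intro!: smooth_near_add)

lemma smooth_near_cong:
  assumes "open U" "p \<in> U" "\<And>q. q \<in> U \<Longrightarrow> f q = g q"
  shows "smooth_near A p f \<longleftrightarrow> smooth_near A p g"
proof -
  have "smooth_near A p g" if f: "smooth_near A p f" "\<And>q. q \<in> U \<Longrightarrow> f q = g q" for f g
  proof -
    obtain V where V: "open V" "p \<in> V" "V \<subseteq> U" "smooth A V f" using smooth_nearE[OF f(1) assms(1,2)] .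
    have "smooth A V g" using smooth_cong[of V f g] V f(2) by (auto simp: subset_iff)
    with V show ?thesis by (auto intro: smooth_nearI)
  qed
  then show ?thesis using assms(3) by (metis)
qed

lemma smooth_near_has_derivative:
  assumes "c \<in> A" "p \<in> fst c" "smooth_near A p f"
  shows "((\<lambda>x. f (chart_inv c x)) has_derivative
    frechet_derivative (\<lambda>x. f (chart_inv c x)) (at (snd c p))) (at (snd c p))"
proof -
  obtain U where U: "open U" "p \<in> U" "smooth A U f" using assms(3) by (auto simp: smooth_near_def)
  have "(\<lambda>x. f (chart_inv c x)) differentiable (at (snd c p))"
    using U assms by (intro Cinf_on_differentiable[of "snd c ` (U \<inter> fst c)"]) (auto simp: smooth_iff)
  then show ?thesis by (simp add: frechet_derivative_works)
qed

lemma chart_deriv_apply: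
  "smooth_near A p f \<Longrightarrow> chart_deriv A c w p f = frechet_derivative (\<lambda>x. f (chart_inv c x)) (at (snd c p)) w"
  by (simp add: chart_deriv_def comp_def)

lemma chart_deriv_eqI:
  assumes "smooth_near A p f" "((\<lambda>x. f (chart_inv c x)) has_derivative f') (at (snd c p))"
  shows "chart_deriv A c w p f = f' w"
  using frechet_derivative_at[OF assms(2)] chart_deriv_apply[OF assms(1)] by simp

lemma chart_deriv_linear:
  assumes "c \<in> A" "p \<in> fst c"
  shows "linear (\<lambda>w. chart_deriv A c w p)"
proof -
  have l: "linear (frechet_derivative (\<lambda>x. f (chart_inv c x)) (at (snd c p)))" if "smooth_near A p f" for f
    using has_derivative_linear[OF smooth_near_has_derivative[OF assms that]] .
  show ?thesis
    by (rule linearI; rule ext)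
       (auto simp: chart_deriv_def comp_def linear_add[OF l] linear_cmul[OF l])
qed

lemma chart_deriv_coord:
  assumes "c \<in> A" "p \<in> fst c"
  shows "chart_deriv A c w p (\<lambda>q. snd c q $ k) = w $ k"
proof (rule chart_deriv_eqI)
  show "smooth_near A p (\<lambda>q. snd c q $ k)"
    using smooth_coord open_chart assms by (intro smooth_nearI[of "fst c"]) auto
  have "((\<lambda>x. x $ k) has_derivative (\<lambda>w. w $ k)) (at (snd c p))"
    by (rule bounded_linear_imp_has_derivative[OF bounded_linear_vec_nth])
  then show "((\<lambda>x. snd c (chart_inv c x) $ k) has_derivative (\<lambda>w. w $ k)) (at (snd c p))"
    by (rule has_derivative_transform_within_open[of _ _ _ _ "snd c ` fst c"])
       (use assms open_chart_range chart_chart_inv in auto)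
qed

text \<open>By the chain rule, the derivative of the transition map converts direction vectors of
  one chart into those of another. The union over charts in the definition therefore collapses to
  the range of one linear map, which makes it a subspace.\<close>

lemma tangent_space_chart:
  assumes c: "c \<in> A" "p \<in> fst c"
  shows "tangent_space A p = range (\<lambda>w. chart_deriv A c w p)"
proof -
  have "\<exists>w. chart_deriv A c' w' p = chart_deriv A c w p" if c': "c' \<in> A" "p \<in> fst c'" for c' w'
  proof -
    have "(\<lambda>x. snd c (chart_inv c' x)) differentiable (at (snd c' p))"
      using Cinf_on_differentiable[OF transition[OF c'(1) c(1)]] c c' by blast
    then obtain T where T: "((\<lambda>x. snd c (chart_inv c' x)) has_derivative T) (at (snd c' p))"
      by (auto simp: differentiable_def)
    have "chart_deriv A c' w' p f = chart_deriv A c (T w') p f" for f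
    proof (cases "smooth_near A p f")
      case True
      let ?f' = "frechet_derivative (\<lambda>x. f (chart_inv c x)) (at (snd c p))"
      have f': "((\<lambda>x. f (chart_inv c x)) has_derivative ?f') (at (snd c (chart_inv c' (snd c' p))))"
        using smooth_near_has_derivative[OF c True] c' by (simp add: chart_inv_chart)
      have "((\<lambda>x. f (chart_inv c (snd c (chart_inv c' x)))) has_derivative (\<lambda>w. ?f' (T w))) (at (snd c' p))"
        using diff_chain_at[OF T f'] by (simp add: comp_def)
      then have "((\<lambda>x. f (chart_inv c' x)) has_derivative (\<lambda>w. ?f' (T w))) (at (snd c' p))"
        by (rule has_derivative_transform_within_open[of _ _ _ _ "snd c' ` (fst c \<inter> fst c')"])
           (use c c' open_chart_image open_chart in \<open>auto simp: chart_inv_chart\<close>)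
      from chart_deriv_eqI[OF True this] show ?thesis by (simp add: chart_deriv_apply[OF True])
    qed (simp add: chart_deriv_def)
    then show ?thesis by (intro exI[of _ "T w'"] ext)
  qed
  note change = this
  show ?thesis
  proof (intro set_eqI iffI)
    fix v assume "v \<in> tangent_space A p"
    then obtain c' w' where "c' \<in> A" "p \<in> fst c'" "v = chart_deriv A c' w' p"
      unfolding tangent_space_def by blast
    then show "v \<in> range (\<lambda>w. chart_deriv A c w p)" using change by blast
  next
    fix v assume "v \<in> range (\<lambda>w. chart_deriv A c w p)"
    then show "v \<in> tangent_space A p" using c unfolding tangent_space_def by blast
  qed
qed

lemma subspace_tangent_space: "subspace (tangent_space A p)"
proof -
  obtain c where c: "c \<in> A" "p \<in> fst c" by (rule chart_cover)
  show ?thesis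
    unfolding tangent_space_chart[OF c]
    using linear_subspace_image[OF chart_deriv_linear[OF c] subspace_UNIV] .
qed

lemma tangent_eq_chart_deriv:
  assumes "v \<in> tangent_space A p" "c \<in> A" "p \<in> fst c"
  shows "v = chart_deriv A c (\<chi> k. v (\<lambda>q. snd c q $ k)) p"
proof -
  obtain w where w: "v = chart_deriv A c w p"
    using assms(1) tangent_space_chart[OF assms(2,3)] by auto
  then have "(\<chi> k. v (\<lambda>q. snd c q $ k)) = w"
    using chart_deriv_coord[OF assms(2,3)] by (simp add: vec_eq_iff)
  with w show ?thesis by simp
qed

lemma coord_field_coord:
  "c \<in> A \<Longrightarrow> p \<in> fst c \<Longrightarrow> coord_field A c i p (\<lambda>q. snd c q $ k) = (if i = k then 1 else 0)"
  by (simp add: coord_field_def chart_deriv_coord axis_def)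

lemma tangent_expand:
  assumes "v \<in> tangent_space A p" "c \<in> A" "p \<in> fst c"
  shows "v = (\<Sum>k\<in>UNIV. v (\<lambda>q. snd c q $ k) *\<^sub>R coord_field A c k p)"
proof -
  let ?w = "\<chi> k. v (\<lambda>q. snd c q $ k)"
  have "v = chart_deriv A c (\<Sum>k\<in>UNIV. ?w $ k *\<^sub>R axis k 1) p"
    using tangent_eq_chart_deriv[OF assms] basis_expansion[of ?w] by (simp add: scalar_mult_eq_scaleR)
  then show ?thesis
    by (simp add: linear_sum[OF chart_deriv_linear[OF assms(2,3)]]
        linear_cmul[OF chart_deriv_linear[OF assms(2,3)]] coord_field_def)
qed

lemma coord_field_tangent: "c \<in> A \<Longrightarrow> p \<in> fst c \<Longrightarrow> coord_field A c i p \<in> tangent_space A p"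
  unfolding coord_field_def tangent_space_def by blast

context
  fixes v p assumes v: "v \<in> tangent_space A p"
begin

lemma tangent_nonsmooth: "\<not> smooth_near A p f \<Longrightarrow> v f = 0"
  using v by (auto simp: tangent_space_def chart_deriv_def)

lemma tangent_const [simp]: "v (\<lambda>q. a) = 0"
proof -
  obtain c w where "c \<in> A" "p \<in> fst c" "v = chart_deriv A c w p" using v by (auto simp: tangent_space_def)
  then show ?thesis using chart_deriv_eqI[of p "\<lambda>q. a" c "\<lambda>w. 0" w] by simp
qed

lemma tangent_add:
  assumes "smooth_near A p f" "smooth_near A p g"
  shows "v (\<lambda>q. f q + g q) = v f + v g"
proof -
  obtain c w where c: "c \<in> A" "p \<in> fst c" "v = chart_deriv A c w p" using v by (auto simp: tangent_space_def)
  show ?thesis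
    using chart_deriv_eqI[OF smooth_near_add[OF assms]
        has_derivative_add[OF smooth_near_has_derivative[OF c(1,2) assms(1)] smooth_near_has_derivative[OF c(1,2) assms(2)]]]
    by (simp add: c(3) chart_deriv_apply assms)
qed

lemma tangent_mult:
  assumes "smooth_near A p f" "smooth_near A p g"
  shows "v (\<lambda>q. f q * g q) = v f * g p + f p * v g"
proof -
  obtain c w where c: "c \<in> A" "p \<in> fst c" "v = chart_deriv A c w p" using v by (auto simp: tangent_space_def)
  show ?thesis
    using chart_deriv_eqI[OF smooth_near_mult[OF assms]
        has_derivative_mult[OF smooth_near_has_derivative[OF c(1,2) assms(1)] smooth_near_has_derivative[OF c(1,2) assms(2)]]]
    by (simp add: c(3) chart_deriv_apply assms chart_inv_chart[OF c(1,2)])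
qed

lemma tangent_cmult: "smooth_near A p f \<Longrightarrow> v (\<lambda>q. a * f q) = a * v f"
  using tangent_mult[of "\<lambda>q. a" f] by simp

lemma tangent_minus: "smooth_near A p f \<Longrightarrow> v (\<lambda>q. - f q) = - v f"
  using tangent_cmult[of f "-1"] by simp

lemma tangent_diff:
  "smooth_near A p f \<Longrightarrow> smooth_near A p g \<Longrightarrow> v (\<lambda>q. f q - g q) = v f - v g"
  using tangent_add[of f "\<lambda>q. - g q"] tangent_minus[of g] smooth_near_mult[of p "\<lambda>q. -1" g] by simp

lemma tangent_sum:
  "(\<And>i. i \<in> I \<Longrightarrow> smooth_near A p (f i)) \<Longrightarrow> v (\<lambda>q. \<Sum>i\<in>I. f i q) = (\<Sum>i\<in>I. v (f i))"
  by (induction I rule: infinite_finite_induct) (auto simp: tangent_add smooth_near_sum)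

text \<open>Functions that are not smooth near \<open>p\<close> are covered too, since both values
  are then the default 0; later replacements of germs thus require no smoothness argument.\<close>

lemma tangent_cong:
  assumes "open U" "p \<in> U" "\<And>q. q \<in> U \<Longrightarrow> f q = g q"
  shows "v f = v g"
proof (cases "smooth_near A p f")
  case True
  then have g: "smooth_near A p g" using smooth_near_cong[of U p f g] assms by blast
  obtain c w where c: "c \<in> A" "p \<in> fst c" "v = chart_deriv A c w p" using v by (auto simp: tangent_space_def)
  have "((\<lambda>x. g (chart_inv c x)) has_derivative frechet_derivative (\<lambda>x. f (chart_inv c x)) (at (snd c p))) (at (snd c p))"
    by (rule has_derivative_transform_within_open[OF smooth_near_has_derivative[OF c(1,2) True]
          open_chart_image[OF c(1) assms(1)]])
       (use assms c in \<open>auto simp: chart_inv_chart\<close>)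
  then show ?thesis using chart_deriv_eqI[OF g] c(3) by (simp add: chart_deriv_apply[OF True])
next
  case False
  then have "\<not> smooth_near A p g" using smooth_near_cong[of U p f g] assms by blast
  with False show ?thesis by (simp add: tangent_nonsmooth)
qed

end

end


lemma sum_fun_apply: "(\<Sum>i\<in>I. f i) x = (\<Sum>i\<in>I. f i x)" for f :: "'i \<Rightarrow> 'a \<Rightarrow> 'b::comm_monoid_add"
  by (induction I rule: infinite_finite_induct) auto

lemma fscale_apply [simp]: "fscale f X p = f p *\<^sub>R X p"
  by (simp add: fscale_def)

context manifold
begin

lemma vfieldsI:
  assumes "\<And>p. p \<in> U \<Longrightarrow> X p \<in> tangent_space A p"
    "\<And>U' f. open U' \<Longrightarrow> U' \<subseteq> U \<Longrightarrow> smooth A U' f \<Longrightarrow> smooth A U' (\<lambda>p. X p f)"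
  shows "X \<in> vfields A U"
  using assms by (simp add: vfields_def app_def)

lemma vfields_tangent: "X \<in> vfields A U \<Longrightarrow> p \<in> U \<Longrightarrow> X p \<in> tangent_space A p"
  by (simp add: vfields_def)

lemma vfields_smooth:
  "X \<in> vfields A U \<Longrightarrow> open U' \<Longrightarrow> U' \<subseteq> U \<Longrightarrow> smooth A U' f \<Longrightarrow> smooth A U' (\<lambda>p. X p f)"
  by (simp add: vfields_def app_def)

lemma vfields_smooth_near:
  assumes "X \<in> vfields A U" "open U" "p \<in> U" "smooth_near A p f"
  shows "smooth_near A p (\<lambda>p. X p f)"
proof -
  obtain V where V: "open V" "p \<in> V" "V \<subseteq> U" "smooth A V f" using smooth_nearE[OF assms(4,2,3)] .
  show ?thesis by (rule smooth_nearI[OF vfields_smooth[OF assms(1) V(1,3,4)] V(1,2)])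
qed

lemma vfields_subset: "X \<in> vfields A U \<Longrightarrow> U' \<subseteq> U \<Longrightarrow> X \<in> vfields A U'"
  by (auto simp: vfields_def)

lemma vfields_cong:
  assumes "open U" "\<And>q. q \<in> U \<Longrightarrow> X q = Y q" "X \<in> vfields A U"
  shows "Y \<in> vfields A U"
proof (rule vfieldsI)
  show "Y p \<in> tangent_space A p" if "p \<in> U" for p
    using assms(2)[OF that] vfields_tangent[OF assms(3) that] by simp
  show "smooth A U' (\<lambda>p. Y p f)" if "open U'" "U' \<subseteq> U" "smooth A U' f" for U' f
    using smooth_cong[of U' "\<lambda>p. X p f" "\<lambda>p. Y p f"] vfields_smooth[OF assms(3) that] that assms(2)
    by (auto simp: subset_iff)
qed

lemma vfields_add: "X \<in> vfields A U \<Longrightarrow> Y \<in> vfields A U \<Longrightarrow> X + Y \<in> vfields A U"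
proof (rule vfieldsI)
  assume X: "X \<in> vfields A U" and Y: "Y \<in> vfields A U"
  show "(X + Y) p \<in> tangent_space A p" if "p \<in> U" for p
    using subspace_add[OF subspace_tangent_space vfields_tangent[OF X that] vfields_tangent[OF Y that]] by simp
  show "smooth A U' (\<lambda>p. (X + Y) p f)" if U: "open U'" "U' \<subseteq> U" "smooth A U' f" for U' f
    using smooth_add[OF vfields_smooth[OF X U] vfields_smooth[OF Y U] U(1)] by simp
qed

lemma vfields_fscale: "X \<in> vfields A U \<Longrightarrow> smooth A U \<phi> \<Longrightarrow> fscale \<phi> X \<in> vfields A U"
proof (rule vfieldsI)
  assume X: "X \<in> vfields A U" and \<phi>: "smooth A U \<phi>"
  show "fscale \<phi> X p \<in> tangent_space A p" if "p \<in> U" for p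
    using subspace_scale[OF subspace_tangent_space vfields_tangent[OF X that]] by simp
  show "smooth A U' (\<lambda>p. fscale \<phi> X p f)" if U: "open U'" "U' \<subseteq> U" "smooth A U' f" for U' f
    using smooth_mult[OF smooth_subset[OF \<phi> U(2)] vfields_smooth[OF X U] U(1)] by simp
qed

lemma vfields_zero [simp]: "0 \<in> vfields A U"
  by (rule vfieldsI) (auto intro: subspace_0[OF subspace_tangent_space])

lemma fscale_uminus: "fscale (\<lambda>q. -1) X = - X"
  by (simp add: fscale_def fun_eq_iff)

lemma vfields_uminus: "X \<in> vfields A U \<Longrightarrow> - X \<in> vfields A U"
  using vfields_fscale[of X U "\<lambda>q. -1"] by (simp add: fscale_uminus)

lemma vfields_diff: "X \<in> vfields A U \<Longrightarrow> Y \<in> vfields A U \<Longrightarrow> X - Y \<in> vfields A U"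
  using vfields_add[OF _ vfields_uminus] by simp

lemma vfields_sum:
  "(\<And>i. i \<in> I \<Longrightarrow> X i \<in> vfields A U) \<Longrightarrow> (\<Sum>i\<in>I. X i) \<in> vfields A U"
  by (induction I rule: infinite_finite_induct) (auto intro!: vfields_add)

lemma vfields_combination:
  assumes "open U" "\<And>i. i \<in> I \<Longrightarrow> smooth A U (\<phi> i)" "\<And>i. i \<in> I \<Longrightarrow> E i \<in> vfields A U"
    "\<And>q. q \<in> U \<Longrightarrow> X q = (\<Sum>i\<in>I. \<phi> i q *\<^sub>R E i q)"
  shows "X \<in> vfields A U"
  by (rule vfields_cong[OF assms(1), of "\<Sum>i\<in>I. fscale (\<phi> i) (E i)"])
     (use assms in \<open>auto intro!: vfields_sum vfields_fscale simp: sum_fun_apply\<close>)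

lemma coord_field_vfields: "c \<in> A \<Longrightarrow> coord_field A c i \<in> vfields A (fst c)"
proof (rule vfieldsI)
  assume c: "c \<in> A"
  fix U f assume U: "open U" "U \<subseteq> fst c" "smooth A U f"
  show "smooth A U (\<lambda>p. coord_field A c i p f)"
  proof (rule smooth_chartI[OF c U(2,1)])
    have o: "open (snd c ` U)" using open_chart_image[OF c U(1)] U(2) by (simp add: Int_absorb2)
    have "coord_field A c i (chart_inv c x) f = frechet_derivative (\<lambda>x. f (chart_inv c x)) (at x) (axis i 1)"
      if "x \<in> snd c ` U" for x
      using that U c by (auto simp: coord_field_def chart_inv_chart subset_iff intro!: chart_deriv_apply smooth_nearI[of U])
    then show "Cinf_on (snd c ` U) (\<lambda>x. coord_field A c i (chart_inv c x) f)"
      by (subst Cinf_on_cong[OF o])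
         (auto intro: Cinf_on_frechet_derivative smooth_chart_smooth[OF c U(3,2)])
  qed
qed (auto intro: coord_field_tangent)


subsection \<open>Lie brackets\<close>

lemma lie_bracket_apply:
  "smooth_near A p f \<Longrightarrow> lie_bracket A X Y p f = X p (\<lambda>q. Y q f) - Y p (\<lambda>q. X q f)"
  by (simp add: lie_bracket_def app_def)

lemma lie_bracket_nonsmooth: "\<not> smooth_near A p f \<Longrightarrow> lie_bracket A X Y p f = 0"
  by (simp add: lie_bracket_def)

lemma lie_bracket_swap: "lie_bracket A X Y p = - lie_bracket A Y X p"
  by (simp add: lie_bracket_def fun_eq_iff)

context
  fixes U :: "'m set" and p assumes U: "open U" "p \<in> U"
begin

lemma lie_bracket_add_left:
  assumes "X \<in> vfields A U" "X' \<in> vfields A U" "Y \<in> vfields A U"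
  shows "lie_bracket A (X + X') Y p = lie_bracket A X Y p + lie_bracket A X' Y p"
proof
  fix f
  show "lie_bracket A (X + X') Y p f = (lie_bracket A X Y p + lie_bracket A X' Y p) f"
  proof (cases "smooth_near A p f")
    case True
    then show ?thesis
      using tangent_add[OF vfields_tangent[OF assms(3) U(2)]
          vfields_smooth_near[OF assms(1) U True] vfields_smooth_near[OF assms(2) U True]]
      by (simp add: lie_bracket_apply)
  qed (simp add: lie_bracket_nonsmooth)
qed

lemma lie_bracket_fscale_left:
  assumes "X \<in> vfields A U" "Y \<in> vfields A U" "smooth A U \<phi>"
  shows "lie_bracket A (fscale \<phi> X) Y p = \<phi> p *\<^sub>R lie_bracket A X Y p - Y p \<phi> *\<^sub>R X p"
proof
  fix f
  show "lie_bracket A (fscale \<phi> X) Y p f = (\<phi> p *\<^sub>R lie_bracket A X Y p - Y p \<phi> *\<^sub>R X p) f"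
  proof (cases "smooth_near A p f")
    case True
    then show ?thesis
      using tangent_mult[OF vfields_tangent[OF assms(2) U(2)]
          smooth_nearI[OF assms(3) U] vfields_smooth_near[OF assms(1) U True]]
      by (simp add: lie_bracket_apply algebra_simps)
  qed (use tangent_nonsmooth[OF vfields_tangent[OF assms(1) U(2)]] in \<open>simp add: lie_bracket_nonsmooth\<close>)
qed

lemma lie_bracket_cong:
  assumes "X \<in> vfields A U" "Y \<in> vfields A U"
    "\<And>q. q \<in> U \<Longrightarrow> X q = X' q" "\<And>q. q \<in> U \<Longrightarrow> Y q = Y' q"
  shows "lie_bracket A X Y p = lie_bracket A X' Y' p"
proof
  fix f
  have "X p (\<lambda>q. Y q f) = X p (\<lambda>q. Y' q f)"
    by (rule tangent_cong[OF vfields_tangent[OF assms(1) U(2)] U]) (simp add: assms)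
  moreover have "Y p (\<lambda>q. X q f) = Y p (\<lambda>q. X' q f)"
    by (rule tangent_cong[OF vfields_tangent[OF assms(2) U(2)] U]) (simp add: assms)
  ultimately show "lie_bracket A X Y p f = lie_bracket A X' Y' p f"
    using assms(3,4)[OF U(2)] by (simp add: lie_bracket_def app_def)
qed

lemma lie_bracket_combination_left:
  assumes "finite I" "\<And>i. i \<in> I \<Longrightarrow> smooth A U (\<phi> i)" "\<And>i. i \<in> I \<Longrightarrow> E i \<in> vfields A U"
    "\<And>q. q \<in> U \<Longrightarrow> X q = (\<Sum>i\<in>I. \<phi> i q *\<^sub>R E i q)" "X \<in> vfields A U" "Y \<in> vfields A U"
  shows "lie_bracket A X Y p = (\<Sum>i\<in>I. \<phi> i p *\<^sub>R lie_bracket A (E i) Y p - Y p (\<phi> i) *\<^sub>R E i p)"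
proof -
  have "lie_bracket A (\<Sum>i\<in>J. fscale (\<phi> i) (E i)) Y p
      = (\<Sum>i\<in>J. \<phi> i p *\<^sub>R lie_bracket A (E i) Y p - Y p (\<phi> i) *\<^sub>R E i p)" if "J \<subseteq> I" for J
    using finite_subset[OF that assms(1)] that
  proof induction
    case empty
    show ?case using tangent_const[OF vfields_tangent[OF assms(6) U(2)]]
      by (simp add: fun_eq_iff lie_bracket_def app_def)
  next
    case (insert j J)
    then have S: "(\<Sum>i\<in>J. fscale (\<phi> i) (E i)) \<in> vfields A U" and j: "smooth A U (\<phi> j)" "E j \<in> vfields A U"
      and J: "J \<subseteq> I"
      using assms by (auto intro!: vfields_sum vfields_fscale)
    show ?case
      unfolding sum.insert[OF insert(1,2)] lie_bracket_add_left[OF vfields_fscale[OF j(2,1)] S assms(6)]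
        lie_bracket_fscale_left[OF j(2) assms(6) j(1)] insert.IH[OF J] ..
  qed
  from this[of I] show ?thesis
    using lie_bracket_cong[OF assms(5,6), of "\<Sum>i\<in>I. fscale (\<phi> i) (E i)" Y] assms(4)
    by (simp add: sum_fun_apply)
qed

lemma lie_bracket_combination_right:
  assumes "finite I" "\<And>i. i \<in> I \<Longrightarrow> smooth A U (\<phi> i)" "\<And>i. i \<in> I \<Longrightarrow> E i \<in> vfields A U"
    "\<And>q. q \<in> U \<Longrightarrow> Y q = (\<Sum>i\<in>I. \<phi> i q *\<^sub>R E i q)" "Y \<in> vfields A U" "X \<in> vfields A U"
  shows "lie_bracket A X Y p = (\<Sum>i\<in>I. \<phi> i p *\<^sub>R lie_bracket A X (E i) p + X p (\<phi> i) *\<^sub>R E i p)"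
proof -
  have "lie_bracket A X Y p = - (\<Sum>i\<in>I. \<phi> i p *\<^sub>R lie_bracket A (E i) X p - X p (\<phi> i) *\<^sub>R E i p)"
    using lie_bracket_combination_left[OF assms] lie_bracket_swap[of X] by simp
  also have "\<dots> = (\<Sum>i\<in>I. \<phi> i p *\<^sub>R lie_bracket A X (E i) p + X p (\<phi> i) *\<^sub>R E i p)"
    by (subst sum_negf[symmetric], rule sum.cong[OF refl]) (subst lie_bracket_swap[of X], simp)
  finally show ?thesis .
qed

lemma lie_bracket_jacobi:
  assumes "X \<in> vfields A U" "Y \<in> vfields A U" "Z \<in> vfields A U"
  shows "lie_bracket A (lie_bracket A X Y) Z p
    = lie_bracket A X (lie_bracket A Y Z) p - lie_bracket A Y (lie_bracket A X Z) p"
proof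
  fix f
  show "lie_bracket A (lie_bracket A X Y) Z p f
    = (lie_bracket A X (lie_bracket A Y Z) p - lie_bracket A Y (lie_bracket A X Z) p) f"
  proof (cases "smooth_near A p f")
    case True
    \<comment> \<open>\<open>lie_bracket\<close> is the commutator only at points near which
      \<open>f\<close> is smooth. An outer field differentiates the bracket along a whole
      neighbourhood, so one has to be fixed on which the commutator formula is valid.\<close>
    then obtain V where V: "open V" "p \<in> V" "V \<subseteq> U" "smooth A V f" by (rule smooth_nearE[OF _ U])
    have sn: "smooth_near A p (\<lambda>q. X' q (\<lambda>q. Y' q f))"
      if "X' \<in> vfields A U" "Y' \<in> vfields A U" for X' Y'
      using vfields_smooth_near[OF that(1) U vfields_smooth_near[OF that(2) U True]] .
    have B: "W p (\<lambda>q. lie_bracket A X' Y' q f) = W p (\<lambda>q. X' q (\<lambda>q. Y' q f)) - W p (\<lambda>q. Y' q (\<lambda>q. X' q f))"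
      if that: "W \<in> vfields A U" "X' \<in> vfields A U" "Y' \<in> vfields A U" for W X' Y'
    proof -
      have W: "W p \<in> tangent_space A p" using vfields_tangent[OF that(1) U(2)] .
      have "W p (\<lambda>q. lie_bracket A X' Y' q f) = W p (\<lambda>q. X' q (\<lambda>q. Y' q f) - Y' q (\<lambda>q. X' q f))"
        by (rule tangent_cong[OF W V(1,2)]) (rule lie_bracket_apply[OF smooth_nearI[OF V(4,1)]])
      then show ?thesis by (simp only: tangent_diff[OF W sn[OF that(2,3)] sn[OF that(3,2)]])
    qed
    have L: "lie_bracket A X' Y' p (\<lambda>q. W q f) = X' p (\<lambda>q. Y' q (\<lambda>q. W q f)) - Y' p (\<lambda>q. X' q (\<lambda>q. W q f))"
      if "W \<in> vfields A U" for W X' Y'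
      by (rule lie_bracket_apply[OF vfields_smooth_near[OF that U True]])
    show ?thesis
      by (simp only: lie_bracket_apply[OF True] B[OF assms(3,1,2)] B[OF assms(1,2,3)] B[OF assms(2,1,3)]
          L[OF assms(3)] L[OF assms(1)] L[OF assms(2)] fun_diff_def)
  qed (simp add: lie_bracket_nonsmooth)
qed

end


subsection \<open>Tensorial maps\<close>

text \<open>Linearity over smooth functions, evaluated at the point \<open>p\<close>. The values lie
  in an arbitrary real vector space, so that real-valued expressions and tangent vectors are treated
  alike.\<close>

definition tensorial :: "'m set \<Rightarrow> 'm \<Rightarrow> ('m vfield \<Rightarrow> 'v::real_vector) \<Rightarrow> bool" where
  "tensorial U p \<Phi> \<longleftrightarrow>
     (\<forall>X\<in>vfields A U. \<forall>Y\<in>vfields A U. \<Phi> (X + Y) = \<Phi> X + \<Phi> Y) \<and>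
     (\<forall>X\<in>vfields A U. \<forall>\<phi>. smooth A U \<phi> \<longrightarrow> \<Phi> (fscale \<phi> X) = \<phi> p *\<^sub>R \<Phi> X)"

lemma tensorialI:
  assumes "\<And>X Y. X \<in> vfields A U \<Longrightarrow> Y \<in> vfields A U \<Longrightarrow> \<Phi> (X + Y) = \<Phi> X + \<Phi> Y"
    "\<And>X \<phi>. X \<in> vfields A U \<Longrightarrow> smooth A U \<phi> \<Longrightarrow> \<Phi> (fscale \<phi> X) = \<phi> p *\<^sub>R \<Phi> X"
  shows "tensorial U p \<Phi>"
  using assms by (simp add: tensorial_def)

lemma tensorial_add:
  "tensorial U p \<Phi> \<Longrightarrow> X \<in> vfields A U \<Longrightarrow> Y \<in> vfields A U \<Longrightarrow> \<Phi> (X + Y) = \<Phi> X + \<Phi> Y"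
  by (simp add: tensorial_def)

lemma tensorial_fscale:
  "tensorial U p \<Phi> \<Longrightarrow> X \<in> vfields A U \<Longrightarrow> smooth A U \<phi> \<Longrightarrow> \<Phi> (fscale \<phi> X) = \<phi> p *\<^sub>R \<Phi> X"
  by (simp add: tensorial_def)

text \<open>The indicator of the complement of \<open>U\<close> is smooth on \<open>U\<close>, so that \<open>\<Phi>\<close> sees \<open>X\<close> only on \<open>U\<close>.\<close>

lemma tensorial_cong:
  assumes "tensorial U p \<Phi>" "open U" "p \<in> U" "X \<in> vfields A U" "Y \<in> vfields A U"
    "\<And>q. q \<in> U \<Longrightarrow> X q = Y q"
  shows "\<Phi> X = \<Phi> Y"
proof -
  let ?i = "\<lambda>q. if q \<in> U then 0 else 1 :: real"
  have s: "smooth A U ?i" using smooth_cong[of U ?i "\<lambda>q. 0"] assms(2) by simp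
  have v: "X - Y \<in> vfields A U" by (rule vfields_diff[OF assms(4,5)])
  have "X = Y + fscale ?i (X - Y)" using assms(6) by (auto simp: fun_eq_iff)
  then have "\<Phi> X = \<Phi> Y + \<Phi> (fscale ?i (X - Y))"
    using tensorial_add[OF assms(1,5) vfields_fscale[OF v s]] by simp
  also have "\<Phi> (fscale ?i (X - Y)) = 0"
    using tensorial_fscale[OF assms(1) v s] assms(3) by simp
  finally show ?thesis by simp
qed

text \<open>The principle behind all frame computations: only the values of the coefficients at
  \<open>p\<close> matter, even though the expansion of \<open>X\<close> holds on \<open>U\<close>
  alone.\<close>

lemma tensorial_combination:
  assumes \<Phi>: "tensorial U p \<Phi>" "open U" "p \<in> U" and "finite I"
    and \<phi>: "\<And>i. i \<in> I \<Longrightarrow> smooth A U (\<phi> i)" and E: "\<And>i. i \<in> I \<Longrightarrow> E i \<in> vfields A U"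
    and X: "\<And>q. q \<in> U \<Longrightarrow> X q = (\<Sum>i\<in>I. \<phi> i q *\<^sub>R E i q)"
  shows "\<Phi> X = (\<Sum>i\<in>I. \<phi> i p *\<^sub>R \<Phi> (E i))"
proof -
  have "\<Phi> (\<Sum>i\<in>J. fscale (\<phi> i) (E i)) = (\<Sum>i\<in>J. \<phi> i p *\<^sub>R \<Phi> (E i))" if "J \<subseteq> I" for J
    using finite_subset[OF that \<open>finite I\<close>] that
  proof induction
    case empty
    have "\<Phi> (fscale (\<lambda>q. 0) 0) = 0" by (subst tensorial_fscale[OF \<Phi>(1)]) auto
    then show ?case by (simp add: fscale_def zero_fun_def)
  next
    case (insert j J)
    then have S: "(\<Sum>i\<in>J. fscale (\<phi> i) (E i)) \<in> vfields A U" and j: "smooth A U (\<phi> j)" "E j \<in> vfields A U"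
      and J: "J \<subseteq> I"
      using \<phi> E by (auto intro!: vfields_sum vfields_fscale)
    show ?case
      unfolding sum.insert[OF insert(1,2)] tensorial_add[OF \<Phi>(1) vfields_fscale[OF j(2,1)] S]
        tensorial_fscale[OF \<Phi>(1) j(2,1)] insert.IH[OF J] ..
  qed
  moreover have "\<Phi> X = \<Phi> (\<Sum>i\<in>I. fscale (\<phi> i) (E i))"
  proof (rule tensorial_cong[OF \<Phi>])
    show "X \<in> vfields A U" using vfields_combination[OF \<Phi>(2) \<phi> E X] .
    show "(\<Sum>i\<in>I. fscale (\<phi> i) (E i)) \<in> vfields A U"
      using \<phi> E by (intro vfields_sum vfields_fscale) auto
  qed (simp add: X sum_fun_apply)
  ultimately show ?thesis by simp
qed

end


section \<open>Orthonormal families\<close>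

text \<open>Relative to a subspace of any real vector space, because the same arguments serve
  \<open>hmet M p\<close> on horizontal vectors, \<open>vmet M\<close> on a space of vector fields
  and \<open>gR M p\<close> on the tangent space.\<close>

locale inner_space =
  fixes S :: "'v::real_vector set" and b :: "'v \<Rightarrow> 'v \<Rightarrow> real"
  assumes subspace: "subspace S" and inner_product: "inner_product_on S b"
begin

lemma sym: "u \<in> S \<Longrightarrow> v \<in> S \<Longrightarrow> b u v = b v u"
  using inner_product[unfolded inner_product_on_def, THEN conjunct1] by blast

lemma add_left: "u \<in> S \<Longrightarrow> v \<in> S \<Longrightarrow> w \<in> S \<Longrightarrow> b (u + v) w = b u w + b v w"
  using inner_product[unfolded inner_product_on_def, THEN conjunct2, THEN conjunct1] by blast

lemma scale_left: "u \<in> S \<Longrightarrow> v \<in> S \<Longrightarrow> b (c *\<^sub>R u) v = c * b u v"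
  using inner_product[unfolded inner_product_on_def, THEN conjunct2, THEN conjunct2, THEN conjunct1] by blast

lemma pos: "u \<in> S \<Longrightarrow> u \<noteq> 0 \<Longrightarrow> 0 < b u u"
  using inner_product[unfolded inner_product_on_def, THEN conjunct2, THEN conjunct2, THEN conjunct2] by blast

lemmas closed = subspace_add[OF subspace] subspace_scale[OF subspace] subspace_0[OF subspace]
  subspace_sum[OF subspace] subspace_diff[OF subspace] subspace_neg[OF subspace]

lemma zero_left: "v \<in> S \<Longrightarrow> b 0 v = 0"
  using scale_left[of 0 v 0] closed by simp

lemma sum_left:
  "(\<And>i. i \<in> I \<Longrightarrow> f i \<in> S) \<Longrightarrow> w \<in> S \<Longrightarrow> b (\<Sum>i\<in>I. f i) w = (\<Sum>i\<in>I. b (f i) w)"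
  by (induction I rule: infinite_finite_induct) (auto simp: zero_left add_left closed)

lemma combination_left:
  assumes "\<And>i. i \<in> I \<Longrightarrow> f i \<in> S" "w \<in> S"
  shows "b (\<Sum>i\<in>I. a i *\<^sub>R f i) w = (\<Sum>i\<in>I. a i * b (f i) w)"
  using assms by (subst sum_left) (auto simp: closed scale_left)

lemma combination_right:
  assumes "\<And>i. i \<in> I \<Longrightarrow> f i \<in> S" "w \<in> S"
  shows "b w (\<Sum>i\<in>I. a i *\<^sub>R f i) = (\<Sum>i\<in>I. a i * b w (f i))"
proof -
  have "b w (\<Sum>i\<in>I. a i *\<^sub>R f i) = b (\<Sum>i\<in>I. a i *\<^sub>R f i) w"
    using assms by (intro sym closed) auto
  also have "\<dots> = (\<Sum>i\<in>I. a i * b (f i) w)" by (rule combination_left[OF assms])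
  also have "\<dots> = (\<Sum>i\<in>I. a i * b w (f i))"
    using assms sym by (intro sum.cong) auto
  finally show ?thesis .
qed

lemma diff_left: "u \<in> S \<Longrightarrow> v \<in> S \<Longrightarrow> w \<in> S \<Longrightarrow> b (u - v) w = b u w - b v w"
  using add_left[of u "-1 *\<^sub>R v" w] scale_left[of v w "-1"] closed by simp

lemma eqI:
  assumes "u \<in> S" "v \<in> S" "\<And>w. w \<in> S \<Longrightarrow> b u w = b v w"
  shows "u = v"
proof (rule ccontr)
  assume "u \<noteq> v"
  then have "0 < b (u - v) (u - v)" using assms by (intro pos closed) auto
  with assms show False by (simp add: diff_left closed)
qed

definition orthonormal :: "nat \<Rightarrow> (nat \<Rightarrow> 'v) \<Rightarrow> bool" where
  "orthonormal k e \<longleftrightarrow> (\<forall>i<k. e i \<in> S) \<and> (\<forall>i<k. \<forall>j<k. b (e i) (e j) = (if i = j then 1 else 0))"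

lemma orthonormal_coeff:
  assumes "orthonormal k e" "j < k"
  shows "b (\<Sum>i<k. a i *\<^sub>R e i) (e j) = a j"
proof -
  have "b (\<Sum>i<k. a i *\<^sub>R e i) (e j) = (\<Sum>i<k. a i * b (e i) (e j))"
    using assms by (intro combination_left) (auto simp: orthonormal_def)
  also have "\<dots> = (\<Sum>i<k. if i = j then a i else 0)"
    using assms by (intro sum.cong) (auto simp: orthonormal_def)
  finally show ?thesis using assms(2) by (simp add: sum.delta)
qed

lemma orthonormal_independent:
  assumes "orthonormal k e"
  shows "inj_on e {..<k}" "independent (e ` {..<k})"
proof -
  show inj: "inj_on e {..<k}"
  proof (rule inj_onI)
    fix i j assume "i \<in> {..<k}" "j \<in> {..<k}" "e i = e j"
    then show "i = j"
      using assms unfolding orthonormal_def by (metis lessThan_iff zero_neq_one)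
  qed
  show "independent (e ` {..<k})"
  proof (rule real_vector.independent_if_scalars_zero)
    fix f x assume f: "(\<Sum>x\<in>e ` {..<k}. f x *\<^sub>R x) = 0" and "x \<in> e ` {..<k}"
    then obtain j where j: "j < k" "x = e j" by auto
    have "(\<Sum>i<k. f (e i) *\<^sub>R e i) = 0" using f by (simp add: sum.reindex[OF inj])
    then have "b 0 (e j) = f (e j)" using orthonormal_coeff[OF assms j(1), of "\<lambda>i. f (e i)"] by simp
    then show "f x = 0" using zero_left assms j by (simp add: orthonormal_def)
  qed simp
qed

text \<open>One Gram-Schmidt step: what remains of \<open>u\<close> after subtracting its
  projections is nonzero and orthogonal to the family, and is then normalised.\<close>

lemma orthonormal_extend:
  assumes e: "orthonormal k e" and u: "u \<in> S" "u \<noteq> (\<Sum>i<k. b u (e i) *\<^sub>R e i)"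
  obtains e' where "orthonormal (Suc k) e'"
proof -
  define w where "w = u - (\<Sum>i<k. b u (e i) *\<^sub>R e i)"
  have eS: "e i \<in> S" if "i < k" for i using e that by (simp add: orthonormal_def)
  have sS: "(\<Sum>i<k. b u (e i) *\<^sub>R e i) \<in> S" using eS by (auto intro!: closed)
  have w: "w \<in> S" "w \<noteq> 0" using u sS by (auto simp: w_def closed)
  have wj: "b w (e j) = 0" if "j < k" for j
    using orthonormal_coeff[OF e that] diff_left[OF u(1) sS eS[OF that]] by (simp add: w_def)
  define c where "c = inverse (sqrt (b w w))"
  have c: "c * c * b w w = 1" using pos[OF w] by (simp add: c_def field_simps)
  define e' where "e' i = (if i < k then e i else c *\<^sub>R w)" for i
  have "b (e' i) (e' j) = (if i = j then 1 else 0)" if ij: "i < Suc k" "j < Suc k" for i j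
  proof -
    consider "i < k" "j < k" | "i < k" "j = k" | "i = k" "j < k" | "i = k" "j = k" using ij by linarith
    then show ?thesis
    proof cases
      case 1
      then show ?thesis using e by (simp add: e'_def orthonormal_def)
    next
      case 2
      have "b (e i) (c *\<^sub>R w) = b (c *\<^sub>R w) (e i)" using 2 eS w by (intro sym closed) auto
      with 2 show ?thesis using eS w wj by (simp add: e'_def scale_left)
    next
      case 3
      then show ?thesis using eS w wj by (simp add: e'_def scale_left)
    next
      case 4
      have "b (c *\<^sub>R w) (c *\<^sub>R w) = c * (c * b w w)"
        using w sym[of w "c *\<^sub>R w"] by (simp add: scale_left closed)
      with 4 c show ?thesis by (simp add: e'_def)
    qed
  qed
  moreover have "e' i \<in> S" if "i < Suc k" for i using eS w by (auto simp: e'_def closed)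
  ultimately show ?thesis by (intro that[of e']) (simp add: orthonormal_def)
qed

lemma orthonormal_bound:
  assumes "orthonormal k e" "S \<subseteq> span T" "finite T"
  shows "k \<le> card T"
proof -
  have "e ` {..<k} \<subseteq> span T" using assms by (auto simp: orthonormal_def)
  then have "card (e ` {..<k}) \<le> card T"
    using real_vector.independent_span_bound[OF assms(3) orthonormal_independent(2)[OF assms(1)]] by simp
  then show ?thesis using card_image[OF orthonormal_independent(1)[OF assms(1)]] by simp
qed

text \<open>A vector outside the span of the family would allow a Gram-Schmidt step to
  \<open>k + 1\<close> orthonormal vectors in dimension \<open>k\<close>. The finite set
  \<open>T\<close> guarantees that \<open>dim\<close> is a genuine dimension and not the default
  0.\<close>

lemma orthonormal_expansion:
  assumes e: "orthonormal k e" and T: "S \<subseteq> span T" "finite T" and k: "dim S = k" and u: "u \<in> S"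
  shows "u = (\<Sum>i<k. b u (e i) *\<^sub>R e i)"
proof (rule ccontr)
  assume "u \<noteq> (\<Sum>i<k. b u (e i) *\<^sub>R e i)"
  then obtain e' where e': "orthonormal (Suc k) e'" using orthonormal_extend[OF e u] by blast
  obtain B where B: "B \<subseteq> S" "independent B" "S \<subseteq> span B" "card B = dim S"
    by (rule real_vector.basis_exists[of S])
  have "finite B" using real_vector.independent_span_bound[OF T(2) B(2)] B(1) T(1) by auto
  from orthonormal_bound[OF e' B(3) this] show False using B k by simp
qed

text \<open>Lengths of orthonormal families are bounded by \<open>card T\<close>; a longest one
  expands every vector, again by Gram-Schmidt, and the representing vector has the values of
  \<open>\<phi>\<close> as its coefficients.\<close>

lemma riesz:
  assumes T: "S \<subseteq> span T" "finite T" and \<phi>: "linear \<phi>"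
  obtains v where "v \<in> S" "\<And>w. w \<in> S \<Longrightarrow> b v w = \<phi> w"
proof -
  define P where "P k \<longleftrightarrow> (\<exists>e. orthonormal k e)" for k
  have bnd: "\<And>k. P k \<Longrightarrow> k \<le> card T" using orthonormal_bound[OF _ T] by (auto simp: P_def)
  have "P 0" by (simp add: P_def orthonormal_def)
  define k where "k = (GREATEST k. P k)"
  have "P k" using GreatestI_nat[of P 0 "card T"] \<open>P 0\<close> bnd by (simp add: k_def)
  moreover have "\<not> P (Suc k)" using Greatest_le_nat[of P "Suc k" "card T"] bnd by (auto simp: k_def)
  ultimately obtain e where e: "orthonormal k e" and max: "\<not> P (Suc k)" by (auto simp: P_def)
  have ex: "w = (\<Sum>i<k. b w (e i) *\<^sub>R e i)" if "w \<in> S" for w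
    using orthonormal_extend[OF e that] max by (auto simp: P_def)
  have eS: "e i \<in> S" if "i < k" for i using e that by (simp add: orthonormal_def)
  show ?thesis
  proof (rule that[of "\<Sum>i<k. \<phi> (e i) *\<^sub>R e i"])
    show vS: "(\<Sum>i<k. \<phi> (e i) *\<^sub>R e i) \<in> S" using eS by (auto intro!: closed)
    fix w assume w: "w \<in> S"
    have "b (\<Sum>i<k. \<phi> (e i) *\<^sub>R e i) w = (\<Sum>i<k. \<phi> (e i) * b (e i) w)"
      using eS w by (intro combination_left) auto
    also have "\<dots> = (\<Sum>i<k. b w (e i) * \<phi> (e i))"
      using eS w sym by (intro sum.cong) auto
    also have "\<dots> = \<phi> (\<Sum>i<k. b w (e i) *\<^sub>R e i)"
      by (simp add: linear_sum[OF \<phi>] linear_cmul[OF \<phi>])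
    also have "\<dots> = \<phi> w" using ex[OF w] by simp
    finally show "b (\<Sum>i<k. \<phi> (e i) *\<^sub>R e i) w = \<phi> w" .
  qed
qed

end


section \<open>The Riemannian extension and gradients\<close>

locale subriemannian =
  fixes M :: "('m::{t2_space,second_countable_topology}, 'n::finite) subriem" and d h :: nat
  assumes transverse_symmetries: "transverse_symmetries M d h"
begin

abbreviation "A \<equiv> atlas M"

sublocale manifold "atlas M"
  using transverse_symmetries by unfold_locales (simp add: transverse_symmetries_def)

lemmas ts_unfolded = transverse_symmetries[unfolded transverse_symmetries_def]

lemma distribution: "is_distribution M d"
  and fiber_metric: "is_fiber_metric M"
  and subspace_vert: "subspace (vert M)"
  and vert_killing: "vert M \<subseteq> killing_fields M"
  and dim_vert: "dim (vert M) = h"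
  and vmet_inner: "inner_product_on (vert M) (vmet M)"
  using ts_unfolded by - (elim conjE; assumption)+

lemma vert_bracket: "Z \<in> vert M \<Longrightarrow> Z' \<in> vert M \<Longrightarrow> lie_bracket A Z Z' \<in> vert M"
  using ts_unfolded by (elim conjE) blast

lemma dim_vspace: "dim (vspace M p) = h"
  and hor_vspace: "hor M p \<inter> vspace M p = {0}"
  and hor_plus_vspace: "{u + w | u w. u \<in> hor M p \<and> w \<in> vspace M p} = tangent_space A p"
proof -
  have "\<forall>p. dim (vspace M p) = h \<and> hor M p \<inter> vspace M p = {0} \<and>
      {u + w | u w. u \<in> hor M p \<and> w \<in> vspace M p} = tangent_space A p"
    using ts_unfolded by (elim conjE)
  note this[THEN spec[of _ p]]
  then show "dim (vspace M p) = h" "hor M p \<inter> vspace M p = {0}"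
    "{u + w | u w. u \<in> hor M p \<and> w \<in> vspace M p} = tangent_space A p"
    by - (elim conjE; assumption)+
qed

lemma vert_span: obtains B where "finite B" "span B = vert M"
proof -
  have "\<exists>B. finite B \<and> span B = vert M" using ts_unfolded by (elim conjE)
  then show ?thesis using that by blast
qed

lemma hor_subspace: "subspace (hor M p)" and hor_tangent: "u \<in> hor M p \<Longrightarrow> u \<in> tangent_space A p"
  and dim_hor: "dim (hor M p) = d"
  using distribution[unfolded is_distribution_def, THEN conjunct1, THEN spec[of _ p]] by auto

lemma vert_vfields: "Z \<in> vert M \<Longrightarrow> Z \<in> vfields A U"
  using vert_killing vfields_subset[of Z UNIV U] by (auto simp: killing_fields_def)

lemma linear_eval: "linear (\<lambda>Z. Z p :: 'm tvec)"
  by (rule linearI) auto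

lemma vspace_subspace: "subspace (vspace M p)"
  unfolding vspace_def by (rule linear_subspace_image[OF linear_eval subspace_vert])

lemma tangent_decompose:
  assumes "v \<in> tangent_space A p"
  obtains u Z where "u \<in> hor M p" "Z \<in> vert M" "v = u + Z p"
  using assms unfolding hor_plus_vspace[symmetric] vspace_def by blast

text \<open>Evaluation at \<open>p\<close> maps the vertical algebra onto a space of the same dimension.\<close>

lemma vert_eval_eq_0:
  assumes Z: "Z \<in> vert M" "Z p = 0"
  shows "Z = 0"
proof (rule ccontr)
  assume nz: "Z \<noteq> 0"
  \<comment> \<open>A basis of the vertical algebra through the supposed kernel element
    \<open>Z\<close>. Its image under evaluation spans \<open>vspace M p\<close>, but
    \<open>Z\<close> contributes only 0, so fewer than \<open>h\<close> vectors would span a space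
    of dimension \<open>h\<close>.\<close>
  obtain C where C: "{Z} \<subseteq> C" "C \<subseteq> vert M" "independent C" "vert M \<subseteq> span C"
    using real_vector.maximal_independent_subset_extend[of "{Z}" "vert M"] Z nz by auto
  obtain B where B: "finite B" "span B = vert M" by (rule vert_span)
  have fin: "finite C" using real_vector.independent_span_bound[OF B(1) C(3)] C(2) B(2) by auto
  have card: "card C = h" using real_vector.basis_card_eq_dim[OF C(2,4,3)] dim_vert by simp
  let ?ev = "\<lambda>Z. Z p"
  have "vspace M p \<subseteq> span (?ev ` C)"
    unfolding vspace_def linear_span_image[OF linear_eval] using C(4) by auto
  also have "?ev ` C = insert 0 (?ev ` (C - {Z}))" using C(1) Z(2) by force
  finally have "vspace M p \<subseteq> span (?ev ` (C - {Z}))" by (simp only: real_vector.span_insert_0)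
  then have "h \<le> card (?ev ` (C - {Z}))"
    using real_vector.dim_le_card[of "vspace M p"] fin dim_vspace by simp
  also have "\<dots> \<le> card (C - {Z})" using fin by (simp add: card_image_le)
  also have "\<dots> < card C" using C(1) fin by (intro psubset_card_mono) auto
  finally show False using card by simp
qed

lemma vert_eval_inj:
  assumes "Z \<in> vert M" "Z' \<in> vert M" "Z p = Z' p"
  shows "Z = Z'"
  using vert_eval_eq_0[of "Z - Z'" p] assms subspace_diff[OF subspace_vert] by simp

lemma hpart_eq: "u \<in> hor M p \<Longrightarrow> w \<in> vspace M p \<Longrightarrow> hpart M p (u + w) = u"
  unfolding hpart_def
proof (rule the_equality)
  fix u' assume a: "u \<in> hor M p" "w \<in> vspace M p" "u' \<in> hor M p \<and> u + w - u' \<in> vspace M p"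
  have "u - u' \<in> hor M p" using a subspace_diff[OF hor_subspace] by blast
  moreover have "u - u' \<in> vspace M p"
    using a subspace_diff[OF vspace_subspace, of "u + w - u'" p w] by simp
  ultimately have "u - u' \<in> {0}" unfolding hor_vspace[of p, symmetric] by blast
  then show "u' = u" by simp
qed simp

lemma vpart_eq: "u \<in> hor M p \<Longrightarrow> w \<in> vspace M p \<Longrightarrow> vpart M p (u + w) = w"
  by (simp add: vpart_def hpart_eq)

lemma vert_field_eq: "Z \<in> vert M \<Longrightarrow> vert_field M p (Z p) = Z"
  unfolding vert_field_def using vert_eval_inj by (intro the_equality) auto

lemma vspaceI: "Z \<in> vert M \<Longrightarrow> Z p \<in> vspace M p"
  by (simp add: vspace_def)

lemma gR_eq:
  assumes "u \<in> hor M p" "u' \<in> hor M p" "Z \<in> vert M" "Z' \<in> vert M"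
  shows "gR M p (u + Z p) (u' + Z' p) = hmet M p u u' + vmet M Z Z'"
  using assms by (simp add: gR_def hpart_eq vpart_eq vspaceI vert_field_eq)

sublocale hmet: inner_space "hor M p" "hmet M p" for p
  using hor_subspace fiber_metric by unfold_locales (auto simp: is_fiber_metric_def)

sublocale vmet: inner_space "vert M" "vmet M"
  using subspace_vert vmet_inner by unfold_locales

sublocale gR: inner_space "tangent_space A p" "gR M p" for p
proof
  show "subspace (tangent_space A p)" by (rule subspace_tangent_space)
  show "inner_product_on (tangent_space A p) (gR M p)"
    unfolding inner_product_on_def
  proof (intro conjI ballI allI impI)
    fix v w assume "v \<in> tangent_space A p" "w \<in> tangent_space A p"
    then obtain u Z u' Z' where dec: "u \<in> hor M p" "Z \<in> vert M" "v = u + Z p"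
      "u' \<in> hor M p" "Z' \<in> vert M" "w = u' + Z' p"
      by (metis tangent_decompose)
    then show "gR M p v w = gR M p w v" using hmet.sym vmet.sym by (simp add: gR_eq)
    fix c
    have "c *\<^sub>R v = c *\<^sub>R u + (c *\<^sub>R Z) p" using dec by (simp add: scaleR_add_right)
    then show "gR M p (c *\<^sub>R v) w = c * gR M p v w"
      using dec gR_eq[of "c *\<^sub>R u" p u' "c *\<^sub>R Z" Z'] hmet.closed vmet.closed
      by (simp add: gR_eq hmet.scale_left vmet.scale_left algebra_simps)
  next
    fix v v' w assume "v \<in> tangent_space A p" "v' \<in> tangent_space A p" "w \<in> tangent_space A p"
    then obtain u Z u' Z' u1 Z1 where dec: "u \<in> hor M p" "Z \<in> vert M" "v = u + Z p"
      "u' \<in> hor M p" "Z' \<in> vert M" "w = u' + Z' p" "u1 \<in> hor M p" "Z1 \<in> vert M" "v' = u1 + Z1 p"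
      by (metis tangent_decompose)
    have "v + v' = (u + u1) + (Z + Z1) p" using dec by simp
    then show "gR M p (v + v') w = gR M p v w + gR M p v' w"
      using dec gR_eq[of "u + u1" p u' "Z + Z1" Z'] hmet.closed vmet.closed
      by (simp add: gR_eq hmet.add_left vmet.add_left algebra_simps)
  next
    fix v assume "v \<in> tangent_space A p" "v \<noteq> 0"
    then obtain u Z where dec: "u \<in> hor M p" "Z \<in> vert M" "v = u + Z p" by (metis tangent_decompose)
    have "0 \<le> hmet M p u u" "0 \<le> vmet M Z Z"
      using dec hmet.pos[of u p] vmet.pos[of Z] hmet.zero_left[of 0 p] vmet.zero_left[of 0]
        hmet.closed vmet.closed by (cases "u = 0"; cases "Z = 0"; force)+
    moreover have "u \<noteq> 0 \<or> Z \<noteq> 0" using dec \<open>v \<noteq> 0\<close> by auto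
    ultimately show "0 < gR M p v v"
      using dec hmet.pos[of u p] vmet.pos[of Z] by (auto simp: gR_eq)
  qed
qed

lemma vert_tangent: "Z \<in> vert M \<Longrightarrow> Z p \<in> tangent_space A p"
  using vert_vfields[of Z UNIV] vfields_tangent by blast

lemma gR_hor: "u \<in> hor M p \<Longrightarrow> u' \<in> hor M p \<Longrightarrow> gR M p u u' = hmet M p u u'"
  using gR_eq[of u p u' 0 0] vmet.closed vmet.zero_left by simp

lemma gR_vert: "Z \<in> vert M \<Longrightarrow> Z' \<in> vert M \<Longrightarrow> gR M p (Z p) (Z' p) = vmet M Z Z'"
  using gR_eq[of 0 p 0 Z Z'] hmet.closed hmet.zero_left by simp

lemma gR_hor_vert: "u \<in> hor M p \<Longrightarrow> Z \<in> vert M \<Longrightarrow> gR M p u (Z p) = 0"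
  using gR_eq[of u p 0 0 Z] hmet.closed vmet.closed vmet.zero_left hmet.sym[of u p 0] hmet.zero_left by simp

lemma gR_vert_hor: "u \<in> hor M p \<Longrightarrow> Z \<in> vert M \<Longrightarrow> gR M p (Z p) u = 0"
  using gR_hor_vert gR.sym[of u p "Z p"] hor_tangent vert_tangent by metis

lemma tangent_span: "\<exists>T. finite T \<and> tangent_space A p \<subseteq> span T"
proof -
  obtain c where c: "c \<in> A" "p \<in> fst c" by (rule chart_cover)
  let ?T = "range (\<lambda>k. coord_field A c k p)"
  have "v \<in> span ?T" if "v \<in> tangent_space A p" for v
    by (subst tangent_expand[OF that c], rule span_sum) (rule span_scale, rule span_base, rule rangeI)
  then show ?thesis by (intro exI[of _ ?T]) auto
qed

text \<open>Riesz representation supplies the vector that the definite description asks for, and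
  nondegeneracy its uniqueness. Evaluation at \<open>f\<close> is linear in the tangent vector for
  every \<open>f\<close>, so no smoothness is involved.\<close>

lemma grad_spec:
  "grad M f p \<in> tangent_space A p" "w \<in> tangent_space A p \<Longrightarrow> gR M p (grad M f p) w = w f"
proof -
  obtain T where T: "finite T" "tangent_space A p \<subseteq> span T" using tangent_span by blast
  have "linear (\<lambda>w :: 'm tvec. w f)" by (rule linearI) auto
  from gR.riesz[OF T(2,1) this] obtain v where
    v: "v \<in> tangent_space A p" "\<And>w. w \<in> tangent_space A p \<Longrightarrow> gR M p v w = w f" by metis
  have "\<exists>!v. v \<in> tangent_space A p \<and> (\<forall>w\<in>tangent_space A p. gR M p v w = w f)"
    using v by (intro ex1I[of _ v]) (auto intro: gR.eqI)
  from theI'[OF this] show "grad M f p \<in> tangent_space A p"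
    "w \<in> tangent_space A p \<Longrightarrow> gR M p (grad M f p) w = w f"
    by (auto simp: grad_def)
qed

lemma grad_eqI:
  assumes "v \<in> tangent_space A p" "\<And>w. w \<in> tangent_space A p \<Longrightarrow> gR M p v w = w f"
  shows "grad M f p = v"
  using assms grad_spec by (intro gR.eqI) auto

lemma grad_locally_const:
  assumes "open U" "p \<in> U" "\<And>q. q \<in> U \<Longrightarrow> f q = a"
  shows "grad M f p = 0"
proof (rule grad_eqI)
  fix w assume w: "w \<in> tangent_space A p"
  have "w f = w (\<lambda>q. a)" by (rule tangent_cong[OF w assms])
  then show "gR M p 0 w = w f" using w gR.zero_left tangent_const[OF w] by simp
qed (auto intro: gR.closed)

text \<open>The source of locality for \<open>L\<close>: the cross term of the product identity
  vanishes wherever one factor is locally constant.\<close>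

lemma Gam_locally_const:
  assumes "open U" "p \<in> U" "\<And>q. q \<in> U \<Longrightarrow> f q = a"
  shows "Gam M f g p = 0" "Gam M g f p = 0"
proof -
  have h0: "hgrad M f p = 0"
    using grad_locally_const[OF assms] hpart_eq[of 0 p 0] hmet.closed subspace_0[OF vspace_subspace]
    by (simp add: hgrad_def)
  have "hgrad M g p \<in> hor M p"
    using tangent_decompose[OF grad_spec(1)[of g p]] hpart_eq vspaceI unfolding hgrad_def by metis
  then show "Gam M f g p = 0" "Gam M g f p = 0"
    using gR.zero_left[of "hgrad M g p" p] gR.sym[of "hgrad M g p" p 0] h0 hor_tangent gR.closed(3)
    by (auto simp: Gam_def)
qed

end


section \<open>Restriction of fields and frames to smaller open sets, and two facts of linear
  algebra\<close>

lemma hfieldsD: "X \<in> hfields M U \<Longrightarrow> X \<in> vfields (atlas M) U" "X \<in> hfields M U \<Longrightarrow> p \<in> U \<Longrightarrow> X p \<in> hor M p"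
  by (auto simp: hfields_def)

lemma hfields_subset: "X \<in> hfields M U \<Longrightarrow> V \<subseteq> U \<Longrightarrow> X \<in> hfields M V"
  by (auto simp: hfields_def vfields_def)

lemma horizontal_frame_subset:
  "horizontal_frame M d U X \<Longrightarrow> open V \<Longrightarrow> V \<subseteq> U \<Longrightarrow> horizontal_frame M d V X"
  unfolding horizontal_frame_def using hfields_subset by blast

lemma smooth_on_subset: "smooth A U f \<Longrightarrow> V \<subseteq> U \<Longrightarrow> smooth A V f"
  unfolding smooth_def by (meson Cinf_on_subset Int_mono image_mono subset_refl)

lemma adapted_frame_subset:
  assumes "adapted_frame M d h U X Z \<omega> \<gamma> \<delta>" "open V" "V \<subseteq> U"
  shows "adapted_frame M d h V X Z \<omega> \<gamma> \<delta>"
  unfolding adapted_frame_def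
proof (intro conjI)
  note f = assms(1)[unfolded adapted_frame_def]
  have "horizontal_frame M d U X" using f by (elim conjE)
  then show "horizontal_frame M d V X" using horizontal_frame_subset assms(2,3) by blast
  show "\<forall>m<h. Z m \<in> vert M" using f by (elim conjE)
  have "\<forall>i<d. \<forall>j<d. \<forall>l<d. smooth (atlas M) U (\<omega> i j l)"
    "\<forall>i<d. \<forall>j<d. \<forall>m<h. smooth (atlas M) U (\<gamma> i j m)"
    "\<forall>i<d. \<forall>m<h. \<forall>l<d. smooth (atlas M) U (\<delta> i m l)"
    using f by - (elim conjE; assumption)+
  then show "\<forall>i<d. \<forall>j<d. \<forall>l<d. smooth (atlas M) V (\<omega> i j l)"
    "\<forall>i<d. \<forall>j<d. \<forall>m<h. smooth (atlas M) V (\<gamma> i j m)"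
    "\<forall>i<d. \<forall>m<h. \<forall>l<d. smooth (atlas M) V (\<delta> i m l)"
    by (simp_all add: smooth_on_subset[OF _ assms(3)])
  have "\<forall>p\<in>U. \<forall>m<h. \<forall>n<h. gR M p (Z m p) (Z n p) = (if m = n then 1 else 0)"
    "\<forall>p\<in>U. \<forall>i<d. \<forall>j<d. lie_bracket (atlas M) (X i) (X j) p =
      (\<Sum>l<d. \<omega> i j l p *\<^sub>R X l p) + (\<Sum>m<h. \<gamma> i j m p *\<^sub>R Z m p)"
    "\<forall>p\<in>U. \<forall>i<d. \<forall>m<h. lie_bracket (atlas M) (X i) (Z m) p = (\<Sum>l<d. \<delta> i m l p *\<^sub>R X l p)"
    "\<forall>p\<in>U. \<forall>i<d. \<forall>m<h. \<forall>l<d. \<delta> i m l p = - \<delta> l m i p"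
    using f by - (elim conjE; assumption)+
  then show "\<forall>p\<in>V. \<forall>m<h. \<forall>n<h. gR M p (Z m p) (Z n p) = (if m = n then 1 else 0)"
    "\<forall>p\<in>V. \<forall>i<d. \<forall>j<d. lie_bracket (atlas M) (X i) (X j) p =
      (\<Sum>l<d. \<omega> i j l p *\<^sub>R X l p) + (\<Sum>m<h. \<gamma> i j m p *\<^sub>R Z m p)"
    "\<forall>p\<in>V. \<forall>i<d. \<forall>m<h. lie_bracket (atlas M) (X i) (Z m) p = (\<Sum>l<d. \<delta> i m l p *\<^sub>R X l p)"
    "\<forall>p\<in>V. \<forall>i<d. \<forall>m<h. \<forall>l<d. \<delta> i m l p = - \<delta> l m i p"
    using assms(3) by (meson subsetD)+
qed

lemma sum_lessThan_add: "(\<Sum>a<d+h. F a) = (\<Sum>i<d. F i) + (\<Sum>m<h. F (d + m))"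
  for F :: "nat \<Rightarrow> 'a::comm_monoid_add"
  by (induction h) (auto simp: add.assoc)

text \<open>Applying a dual functional to a vanishing combination reads off one coefficient. It is
  used for coordinate fields, with the coordinate functions as dual family.\<close>

lemma independent_dual:
  fixes e :: "'i \<Rightarrow> 'v::real_vector" and \<phi> :: "'i \<Rightarrow> 'v \<Rightarrow> real"
  assumes "finite I" "\<And>i. linear (\<phi> i)"
    and dual: "\<And>i j. i \<in> I \<Longrightarrow> j \<in> I \<Longrightarrow> \<phi> i (e j) = (if j = i then 1 else 0)"
  shows "inj_on e I" "independent (e ` I)"
proof -
  show inj: "inj_on e I"
    using dual by (intro inj_onI) (metis zero_neq_one)
  show "independent (e ` I)"
  proof (rule real_vector.independent_if_scalars_zero)
    fix g x assume g: "(\<Sum>x\<in>e ` I. g x *\<^sub>R x) = 0" and "x \<in> e ` I"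
    then obtain k where k: "x = e k" "k \<in> I" by auto
    have "(\<Sum>i\<in>I. g (e i) *\<^sub>R e i) = 0" using g by (simp add: sum.reindex[OF inj])
    then have "(\<Sum>i\<in>I. g (e i) * \<phi> k (e i)) = 0"
      using linear_0[OF assms(2), of k] linear_sum[OF assms(2), of k "\<lambda>i. g (e i) *\<^sub>R e i" I]
      by (simp add: linear_cmul[OF assms(2)])
    moreover have "(\<Sum>i\<in>I. g (e i) * \<phi> k (e i)) = (\<Sum>i\<in>I. if i = k then g (e i) else 0)"
      using k dual by (intro sum.cong) auto
    ultimately show "g x = 0" using k assms(1) by simp
  qed (use assms in simp)
qed

section \<open>Adapted frames\<close>

context subriemannian
begin

lemma horizontal_frame_expand:
  assumes "horizontal_frame M d U X" "p \<in> U" "u \<in> hor M p"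
  shows "u = (\<Sum>i<d. gR M p u (X i p) *\<^sub>R X i p)"
proof -
  have X: "X i p \<in> hor M p" if "i < d" for i
    using assms that hfieldsD(2)[of "X i" M U p] by (auto simp: horizontal_frame_def)
  then have "hmet.orthonormal p d (\<lambda>i. X i p)"
    using assms by (auto simp: hmet.orthonormal_def horizontal_frame_def gR_hor[symmetric])
  moreover obtain T where "finite T" "hor M p \<subseteq> span T" using tangent_span[of p] hor_tangent by blast
  ultimately have "u = (\<Sum>i<d. hmet M p u (X i p) *\<^sub>R X i p)"
    using dim_hor assms(3) by (intro hmet.orthonormal_expansion)
  then show ?thesis using X assms(3) by (simp add: gR_hor)
qed

end

locale adapted = subriemannian M d h
  for M :: "('m::{t2_space,second_countable_topology}, 'n::finite) subriem" and d h +
  fixes U :: "'m set" and X Z \<omega> \<gamma> \<delta>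
  assumes adapted_frame: "adapted_frame M d h U X Z \<omega> \<gamma> \<delta>"
begin

lemma horizontal_frame: "horizontal_frame M d U X"
  using adapted_frame by (simp add: adapted_frame_def)

lemma open_U: "open U"
  using horizontal_frame by (simp add: horizontal_frame_def)

lemma X_hfields: "i < d \<Longrightarrow> X i \<in> hfields M U"
  using horizontal_frame by (simp add: horizontal_frame_def)

lemma X_vfields: "i < d \<Longrightarrow> X i \<in> vfields A U"
  using X_hfields hfieldsD(1) by blast

lemma X_hor: "i < d \<Longrightarrow> p \<in> U \<Longrightarrow> X i p \<in> hor M p"
  using X_hfields hfieldsD(2) by blast

lemma Z_vert: "m < h \<Longrightarrow> Z m \<in> vert M"
  using adapted_frame by (simp add: adapted_frame_def)

lemma Z_vfields: "m < h \<Longrightarrow> Z m \<in> vfields A V"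
  using Z_vert vert_vfields by blast

lemmas adapted_frameD = adapted_frame[unfolded adapted_frame_def]

lemma structure_smooth:
  "i < d \<Longrightarrow> j < d \<Longrightarrow> l < d \<Longrightarrow> smooth A U (\<omega> i j l)"
  "i < d \<Longrightarrow> j < d \<Longrightarrow> m < h \<Longrightarrow> smooth A U (\<gamma> i j m)"
  "i < d \<Longrightarrow> m < h \<Longrightarrow> l < d \<Longrightarrow> smooth A U (\<delta> i m l)"
proof -
  have "\<forall>i<d. \<forall>j<d. \<forall>l<d. smooth A U (\<omega> i j l)"
    "\<forall>i<d. \<forall>j<d. \<forall>m<h. smooth A U (\<gamma> i j m)" "\<forall>i<d. \<forall>m<h. \<forall>l<d. smooth A U (\<delta> i m l)"
    using adapted_frameD by - (elim conjE; assumption)+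
  then show "i < d \<Longrightarrow> j < d \<Longrightarrow> l < d \<Longrightarrow> smooth A U (\<omega> i j l)"
    "i < d \<Longrightarrow> j < d \<Longrightarrow> m < h \<Longrightarrow> smooth A U (\<gamma> i j m)"
    "i < d \<Longrightarrow> m < h \<Longrightarrow> l < d \<Longrightarrow> smooth A U (\<delta> i m l)" by simp_all
qed

lemma bracket_XX:
  assumes "p \<in> U" "i < d" "j < d"
  shows "lie_bracket A (X i) (X j) p =
    (\<Sum>l<d. \<omega> i j l p *\<^sub>R X l p) + (\<Sum>m<h. \<gamma> i j m p *\<^sub>R Z m p)"
proof -
  have "\<forall>p\<in>U. \<forall>i<d. \<forall>j<d. lie_bracket A (X i) (X j) p =
      (\<Sum>l<d. \<omega> i j l p *\<^sub>R X l p) + (\<Sum>m<h. \<gamma> i j m p *\<^sub>R Z m p)"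
    using adapted_frameD by (elim conjE)
  then show ?thesis using assms by blast
qed

lemma X_smooth: "i < d \<Longrightarrow> smooth A U f \<Longrightarrow> smooth A U (\<lambda>q. X i q f)"
  by (rule vfields_smooth[OF X_vfields open_U subset_refl])

lemma Z_smooth: "m < h \<Longrightarrow> smooth A U f \<Longrightarrow> smooth A U (\<lambda>q. Z m q f)"
  by (rule vfields_smooth[OF Z_vfields open_U subset_refl])

lemma bracket_XZ:
  assumes "p \<in> U" "i < d" "m < h"
  shows "lie_bracket A (X i) (Z m) p = (\<Sum>l<d. \<delta> i m l p *\<^sub>R X l p)"
proof -
  have "\<forall>p\<in>U. \<forall>i<d. \<forall>m<h. lie_bracket A (X i) (Z m) p = (\<Sum>l<d. \<delta> i m l p *\<^sub>R X l p)"
    using adapted_frameD by (elim conjE)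
  then show ?thesis using assms by blast
qed

lemma \<delta>_skew:
  assumes "p \<in> U" "i < d" "m < h" "l < d"
  shows "\<delta> i m l p = - \<delta> l m i p"
proof -
  have "\<forall>p\<in>U. \<forall>i<d. \<forall>m<h. \<forall>l<d. \<delta> i m l p = - \<delta> l m i p"
    using adapted_frameD by (elim conjE)
  then show ?thesis using assms by blast
qed

lemma gR_XX: "p \<in> U \<Longrightarrow> i < d \<Longrightarrow> j < d \<Longrightarrow> gR M p (X i p) (X j p) = (if i = j then 1 else 0)"
  using horizontal_frame by (simp add: horizontal_frame_def)

lemma gR_ZZ:
  assumes "p \<in> U" "m < h" "n < h"
  shows "gR M p (Z m p) (Z n p) = (if m = n then 1 else 0)"
proof -
  have "\<forall>p\<in>U. \<forall>m<h. \<forall>n<h. gR M p (Z m p) (Z n p) = (if m = n then 1 else 0)"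
    using adapted_frameD by (elim conjE)
  then show ?thesis using assms by blast
qed

lemma hor_expand:
  "p \<in> U \<Longrightarrow> u \<in> hor M p \<Longrightarrow> u = (\<Sum>i<d. gR M p u (X i p) *\<^sub>R X i p)"
  using horizontal_frame_expand[OF horizontal_frame] .

lemma vmet_ZZ: "p \<in> U \<Longrightarrow> m < h \<Longrightarrow> n < h \<Longrightarrow> vmet M (Z m) (Z n) = (if m = n then 1 else 0)"
  using gR_ZZ gR_vert[of "Z m" "Z n" p] Z_vert by simp

lemma vert_expand:
  assumes "p \<in> U" "W \<in> vert M"
  shows "W = (\<Sum>m<h. vmet M W (Z m) *\<^sub>R Z m)"
proof -
  have "vmet.orthonormal h Z"
    using vmet_ZZ[OF assms(1)] Z_vert by (auto simp: vmet.orthonormal_def)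
  moreover obtain T where "finite T" "vert M \<subseteq> span T" using vert_span by (metis order_refl)
  ultimately show ?thesis using dim_vert assms(2) by (intro vmet.orthonormal_expansion)
qed

text \<open>A single index for the whole orthonormal frame; \<open>sum_lessThan_add\<close>
  separates the horizontal and vertical parts again.\<close>

definition E :: "nat \<Rightarrow> 'm vfield" where "E a = (if a < d then X a else Z (a - d))"

lemma E_simps [simp]: "i < d \<Longrightarrow> E i = X i" "E (d + m) = Z m"
  by (auto simp: E_def)

lemma E_cases:
  assumes "a < d + h"
  obtains i where "i < d" "a = i" | m where "m < h" "a = d + m"
  using assms by (metis add_diff_inverse_nat nat_add_left_cancel_less)

lemma E_vfields: "a < d + h \<Longrightarrow> E a \<in> vfields A U"
  by (erule E_cases) (auto simp: X_vfields Z_vfields)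

lemma E_tangent: "p \<in> U \<Longrightarrow> a < d + h \<Longrightarrow> E a p \<in> tangent_space A p"
  using E_vfields vfields_tangent by blast

lemma gR_EE:
  assumes "p \<in> U" "a < d + h" "b < d + h"
  shows "gR M p (E a p) (E b p) = (if a = b then 1 else 0)"
  using assms(2,3)
  by (elim E_cases) (use assms(1) in \<open>auto simp: gR_XX gR_ZZ gR_hor_vert gR_vert_hor X_hor Z_vert\<close>)

lemma frame_expand:
  assumes "p \<in> U" "v \<in> tangent_space A p"
  shows "v = (\<Sum>a<d+h. gR M p v (E a p) *\<^sub>R E a p)"
proof -
  obtain u W where v: "u \<in> hor M p" "W \<in> vert M" "v = u + W p" using tangent_decompose[OF assms(2)] .
  have W: "W p = (\<Sum>m<h. vmet M W (Z m) *\<^sub>R Z m p)"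
    by (subst vert_expand[OF assms(1) v(2)]) (simp add: sum_fun_apply)
  have X: "gR M p v (X i p) = gR M p u (X i p)" if "i < d" for i
    using gR_eq[of u p "X i p" W 0] v X_hor[OF that assms(1)] that vmet.closed(3) vmet.zero_left
      vmet.sym[of W 0] by (simp add: gR_hor)
  have Z: "gR M p v (Z m p) = vmet M W (Z m)" if "m < h" for m
    using gR_eq[of u p 0 W "Z m"] v Z_vert[OF that] hmet.closed(3)[of p] hmet.zero_left
      hmet.sym[of u p 0] by simp
  have "v = (\<Sum>i<d. gR M p u (X i p) *\<^sub>R X i p) + (\<Sum>m<h. vmet M W (Z m) *\<^sub>R Z m p)"
    unfolding v(3) W[symmetric] hor_expand[OF assms(1) v(1), symmetric] ..
  also have "\<dots> = (\<Sum>a<d+h. gR M p v (E a p) *\<^sub>R E a p)"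
    unfolding sum_lessThan_add using X Z by simp
  finally show ?thesis .
qed

lemma gR_expand:
  assumes "p \<in> U" "v \<in> tangent_space A p" "w \<in> tangent_space A p"
  shows "gR M p v w = (\<Sum>a<d+h. gR M p v (E a p) * gR M p w (E a p))"
proof -
  have "gR M p v w = gR M p (\<Sum>a<d+h. gR M p v (E a p) *\<^sub>R E a p) w"
    by (subst (1) frame_expand[OF assms(1,2)]) (rule refl)
  also have "\<dots> = (\<Sum>a<d+h. gR M p v (E a p) * gR M p (E a p) w)"
    using assms E_tangent by (intro gR.combination_left) auto
  also have "\<dots> = (\<Sum>a<d+h. gR M p v (E a p) * gR M p w (E a p))"
    using assms E_tangent gR.sym by (intro sum.cong) auto
  finally show ?thesis .
qed

lemma grad_frame: "p \<in> U \<Longrightarrow> grad M f p = (\<Sum>i<d. X i p f *\<^sub>R X i p) + (\<Sum>m<h. Z m p f *\<^sub>R Z m p)"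
proof -
  assume p: "p \<in> U"
  have "grad M f p = (\<Sum>a<d+h. gR M p (grad M f p) (E a p) *\<^sub>R E a p)"
    by (rule frame_expand[OF p grad_spec(1)])
  also have "\<dots> = (\<Sum>a<d+h. E a p f *\<^sub>R E a p)"
    using grad_spec(2) E_tangent[OF p] by (intro sum.cong) auto
  finally show ?thesis by (simp add: sum_lessThan_add)
qed

lemma vert_combination: "(\<Sum>m<h. a m *\<^sub>R Z m p) \<in> vspace M p"
  using Z_vert by (intro subspace_sum[OF vspace_subspace] subspace_scale[OF vspace_subspace] vspaceI) auto

lemma hor_combination: "p \<in> U \<Longrightarrow> (\<Sum>i<d. a i *\<^sub>R X i p) \<in> hor M p"
  using X_hor by (intro subspace_sum[OF hor_subspace] subspace_scale[OF hor_subspace]) auto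

lemma hgrad_frame: "p \<in> U \<Longrightarrow> hgrad M f p = (\<Sum>i<d. X i p f *\<^sub>R X i p)"
  by (simp add: hgrad_def grad_frame hpart_eq hor_combination vert_combination)

lemma vgrad_frame: "p \<in> U \<Longrightarrow> vgrad M f p = (\<Sum>m<h. Z m p f *\<^sub>R Z m p)"
  by (simp add: vgrad_def grad_frame vpart_eq hor_combination vert_combination)

lemma Gam_frame:
  assumes p: "p \<in> U"
  shows "Gam M f g p = (\<Sum>i<d. X i p f * X i p g)"
proof -
  have t: "X i p \<in> tangent_space A p" if "i < d" for i using X_hor[OF that p] hor_tangent by blast
  have "Gam M f g p = (\<Sum>j<d. X j p f * (gR M p (X j p) (\<Sum>i<d. X i p g *\<^sub>R X i p)))"
    unfolding Gam_def hgrad_frame[OF p]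
    using t hor_tangent[OF hor_combination[OF p]] by (intro gR.combination_left) auto
  also have "\<dots> = (\<Sum>j<d. X j p f * (\<Sum>i<d. X i p g * gR M p (X j p) (X i p)))"
    using t gR.combination_right by (intro sum.cong) (auto intro!: gR.combination_right)
  also have "\<dots> = (\<Sum>j<d. X j p f * X j p g)"
    using p by (intro sum.cong) (auto simp: gR_XX if_distrib cong: if_cong)
  finally show ?thesis .
qed

lemma X_tangent: "i < d \<Longrightarrow> p \<in> U \<Longrightarrow> X i p \<in> tangent_space A p"
  using X_hor hor_tangent by blast

lemma X_coeff:
  assumes p: "p \<in> U" and k: "k < d"
  shows "gR M p (\<Sum>i<d. a i *\<^sub>R X i p) (X k p) = a k"
proof -
  have "gR.orthonormal p d (\<lambda>i. X i p)"
    using gR_XX[OF p] X_tangent[OF _ p] by (simp add: gR.orthonormal_def)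
  from gR.orthonormal_coeff[OF this k] show ?thesis .
qed

lemma bracket_XX_coeff:
  assumes p: "p \<in> U" and i: "i < d" "j < d" and l: "l < d"
  shows "gR M p (lie_bracket A (X i) (X j) p) (X l p) = \<omega> i j l p"
proof -
  obtain W where W: "W \<in> vert M" "(\<Sum>m<h. \<gamma> i j m p *\<^sub>R Z m p) = W p"
    using vert_combination[of "\<lambda>m. \<gamma> i j m p" p] by (auto simp: vspace_def)
  show ?thesis
    unfolding bracket_XX[OF p i] W(2)
    using gR.add_left[OF hor_tangent[OF hor_combination[OF p]] vert_tangent[OF W(1)] X_tangent[OF l p]]
      gR_vert_hor[OF X_hor[OF l p] W(1)] X_coeff[OF p l] by simp
qed

text \<open>The fields \<open>Z m\<close> are global and orthonormal for \<open>vmet M\<close>,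
  which does not refer to a point. Orthonormality seen at one point of \<open>U\<close> therefore
  gives the formula at every \<open>q\<close>. This matters because \<open>L\<close> is applied to
  \<open>GamZ M f f\<close> as a function on all of the manifold.\<close>

lemma vgrad_global:
  assumes "p \<in> U"
  shows "vgrad M f q = (\<Sum>m<h. Z m q f *\<^sub>R Z m q)"
proof -
  obtain u W where v: "u \<in> hor M q" "W \<in> vert M" "grad M f q = u + W q"
    using tangent_decompose[OF grad_spec(1)] .
  have "vmet M W (Z m) = Z m q f" if "m < h" for m
  proof -
    have "gR M q (u + W q) (Z m q) = Z m q f"
      unfolding v(3)[symmetric] by (rule grad_spec(2)[OF vert_tangent[OF Z_vert[OF that]]])
    then show ?thesis
      using gR_eq[of u q 0 W "Z m"] v Z_vert[OF that] hmet.closed(3)[of q] hmet.zero_left[of 0 q]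
        hmet.sym[of u q 0] hmet.zero_left[of u q] by simp
  qed
  moreover have "W q = (\<Sum>m<h. vmet M W (Z m) *\<^sub>R Z m q)"
    by (subst vert_expand[OF assms v(2)]) (simp add: sum_fun_apply)
  moreover have "vgrad M f q = W q"
    unfolding vgrad_def v(3) by (rule vpart_eq[OF v(1) vspaceI[OF v(2)]])
  ultimately show ?thesis by simp
qed

lemma GamZ_global:
  assumes "p \<in> U"
  shows "GamZ M f g q = (\<Sum>m<h. Z m q f * Z m q g)"
proof -
  have ZZ: "gR M q (Z m q) (Z n q) = (if m = n then 1 else 0)" if "m < h" "n < h" for m n
    using vmet_ZZ[OF assms that] gR_vert Z_vert that by simp
  have t: "Z m q \<in> tangent_space A q" if "m < h" for m using vert_tangent[OF Z_vert[OF that]] .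
  have "GamZ M f g q = (\<Sum>j<h. Z j q f * (gR M q (Z j q) (\<Sum>i<h. Z i q g *\<^sub>R Z i q)))"
    unfolding GamZ_def vgrad_global[OF assms]
    using t by (intro gR.combination_left) (auto intro!: gR.closed)
  also have "\<dots> = (\<Sum>j<h. Z j q f * (\<Sum>i<h. Z i q g * gR M q (Z j q) (Z i q)))"
    using t by (intro sum.cong) (auto intro!: gR.combination_right)
  also have "\<dots> = (\<Sum>j<h. Z j q f * Z j q g)"
    by (intro sum.cong) (auto simp: ZZ if_distrib cong: if_cong)
  finally show ?thesis .
qed

end


subsection \<open>Frames in a chart\<close>

context manifold
begin

lemma smooth_det:
  assumes "open V" "\<And>i j. smooth A V (\<lambda>q. F q $ i $ j)"
  shows "smooth A V (\<lambda>q. det (F q :: real ^ 'k ^ 'k))"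
  unfolding det_def using assms by (intro smooth_sum smooth_mult smooth_prod) auto

text \<open>Cramer's rule writes the entries of the inverse as quotients of determinants of smooth
  matrices.\<close>

lemma smooth_right_inverse_matrix:
  assumes "open V" "\<And>i j. smooth A V (\<lambda>q. F q $ i $ j)" "\<And>q. q \<in> V \<Longrightarrow> F q ** G q = mat 1"
  shows "smooth A V (\<lambda>q. (G q :: real ^ 'k ^ 'k) $ i $ j)"
proof -
  have det: "det (F q) \<noteq> 0" if "q \<in> V" for q
    using assms(3)[OF that] by (metis det_I det_mul mult_zero_left zero_neq_one)
  \<comment> \<open>Column \<open>i\<close> of \<open>F q\<close> is replaced by the
    \<open>j\<close>-th unit vector, as Cramer's rule prescribes for the entry in row
    \<open>i\<close> of column \<open>j\<close> of the inverse.\<close>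
  define H where "H q = (\<chi> k l. if l = i then axis j 1 $ k else F q $ k $ l)" for q
  have eq: "G q $ i $ j = det (H q) * inverse (det (F q))" if "q \<in> V" for q
  proof -
    have "F q *v column j (G q) = axis j 1"
      using assms(3)[OF that]
      by (simp add: vec_eq_iff matrix_matrix_mult_def matrix_vector_mult_def mat_def axis_def column_def)
    then have "column j (G q) = (\<chi> k. det (\<chi> i l. if l = k then axis j 1 $ i else F q $ i $ l) / det (F q))"
      by (rule iffD1[OF cramer[OF det[OF that]]])
    then have "column j (G q) $ i = det (H q) / det (F q)" by (simp add: H_def)
    then show ?thesis by (simp add: column_def divide_inverse)
  qed
  have "smooth A V (\<lambda>q. det (H q) * inverse (det (F q)))"
  proof (intro smooth_mult smooth_inverse smooth_det assms(1,2) det)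
    show "smooth A V (\<lambda>q. H q $ k $ l)" for k l
      using assms(2) by (cases "l = i") (simp_all add: H_def)
  qed auto
  then show ?thesis using smooth_cong[of V "\<lambda>q. G q $ i $ j" "\<lambda>q. det (H q) * inverse (det (F q))"] eq assms(1) by blast
qed

end

context adapted
begin

text \<open>The frame is orthonormal inside the span of the coordinate fields, and the coordinate
  fields are independent inside the span of the frame: each count bounds the other. This is what
  allows square transition matrices.\<close>

lemma card_eq: "p \<in> U \<Longrightarrow> CARD('n) = d + h"
proof -
  assume p: "p \<in> U"
  obtain c where c: "c \<in> A" "p \<in> fst c" by (rule chart_cover)
  let ?e = "\<lambda>a. E a p" and ?c = "\<lambda>k. coord_field A c k p"
  have on: "gR.orthonormal p (d + h) ?e"
    using gR_EE[OF p] E_tangent[OF p] by (auto simp: gR.orthonormal_def)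
  have "tangent_space A p \<subseteq> span (range ?c)"
  proof
    fix v assume "v \<in> tangent_space A p"
    then show "v \<in> span (range ?c)"
      by (subst tangent_expand[OF _ c], assumption, intro span_sum span_scale)
         (rule span_base, rule rangeI)
  qed
  from gR.orthonormal_bound[OF on this] have "d + h \<le> card (range ?c)" by simp
  also have "\<dots> \<le> CARD('n)" by (rule card_image_le) simp
  finally have le: "d + h \<le> CARD('n)" .
  have lin: "linear (\<lambda>v :: 'm tvec. v (\<lambda>q. snd c q $ k))" for k by (rule linearI) auto
  have inj: "inj ?c" and "independent (range ?c)"
    using independent_dual[of UNIV "\<lambda>k v. v (\<lambda>q. snd c q $ k)" ?c] lin coord_field_coord[OF c] by simp_all
  moreover have "range ?c \<subseteq> span (?e ` {..<d+h})"
  proof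
    fix v assume "v \<in> range ?c"
    then have "v \<in> tangent_space A p" using coord_field_tangent[OF c] by auto
    then show "v \<in> span (?e ` {..<d+h})"
      by (subst frame_expand[OF p], assumption, intro span_sum span_scale) (rule span_base, simp)
  qed
  ultimately have "card (range ?c) \<le> card (?e ` {..<d+h})"
    using real_vector.independent_span_bound[of "?e ` {..<d+h}"] by simp
  also have "\<dots> \<le> d + h" using card_image_le[of "{..<d+h}" ?e] by simp
  finally show ?thesis using le card_image[OF inj] by simp
qed

end


text \<open>The base point \<open>p0\<close> makes \<open>U\<close> nonempty, which the dimension
  count requires, and is later the point at which \<open>L\<close> is computed.\<close>

locale adapted_chart = adapted M d h U X Z \<omega> \<gamma> \<delta>
  for M :: "('m::{t2_space,second_countable_topology}, 'n::finite) subriem" and d h U X Z \<omega> \<gamma> \<delta> +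
  fixes c and p0
  assumes c: "c \<in> atlas M" and U_chart: "U \<subseteq> fst c" and p0: "p0 \<in> U"
begin

abbreviation crd :: "'n \<Rightarrow> 'm \<Rightarrow> real" where "crd k \<equiv> \<lambda>q. snd c q $ k"

abbreviation dd :: "'n \<Rightarrow> 'm vfield" where "dd k \<equiv> coord_field A c k"

definition idx :: "'n \<Rightarrow> nat" where "idx = (SOME e. bij_betw e UNIV {..<d+h})"

lemma idx: "bij_betw idx UNIV {..<d+h}"
proof -
  have "\<exists>e. bij_betw e (UNIV :: 'n set) {..<d+h}"
    by (rule finite_same_card_bij) (simp_all add: card_eq[OF p0])
  then show ?thesis unfolding idx_def by (rule someI_ex)
qed

lemma idx_less: "idx \<alpha> < d + h"
  using idx by (auto simp: bij_betw_def)

lemma sum_idx: "(\<Sum>\<alpha>\<in>UNIV. F (idx \<alpha>)) = (\<Sum>a<d+h. F a)"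
  using sum.reindex_bij_betw[OF idx] .

lemma crd_smooth: "V \<subseteq> U \<Longrightarrow> smooth A V (crd k)"
  using smooth_subset[OF smooth_coord[OF c]] U_chart by blast

lemma dd_vfields: "V \<subseteq> U \<Longrightarrow> dd k \<in> vfields A V"
  using vfields_subset[OF coord_field_vfields[OF c]] U_chart by blast

lemma dd_tangent: "q \<in> U \<Longrightarrow> dd k q \<in> tangent_space A q"
  using vfields_tangent[OF dd_vfields[OF subset_refl]] .

lemma dd_crd: "q \<in> U \<Longrightarrow> dd k q (crd l) = (if k = l then 1 else 0)"
  using coord_field_coord[OF c] U_chart by blast

lemma expand_dd: "q \<in> U \<Longrightarrow> v \<in> tangent_space A q \<Longrightarrow> v f = (\<Sum>k\<in>UNIV. v (crd k) * dd k q f)"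
proof -
  assume "q \<in> U" "v \<in> tangent_space A q"
  then have "v = (\<Sum>k\<in>UNIV. v (crd k) *\<^sub>R dd k q)" using tangent_expand c U_chart by blast
  then have "v f = (\<Sum>k\<in>UNIV. v (crd k) *\<^sub>R dd k q) f" by (rule arg_cong)
  then show ?thesis by (simp add: sum_fun_apply)
qed

text \<open>The rows of \<open>Fm\<close> are the frame fields in coordinates; \<open>Gm\<close> is its inverse, and \<open>Gm (Gm)\<^sup>T\<close> is the
  Gram matrix of the coordinate fields. \<open>idx\<close> only makes these matrices square in the index type.\<close>

definition Fm :: "'m \<Rightarrow> real ^ 'n ^ 'n" where
  "Fm q = (\<chi> \<alpha> k. E (idx \<alpha>) q (crd k))"

definition Gm :: "'m \<Rightarrow> real ^ 'n ^ 'n" where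
  "Gm q = (\<chi> k \<alpha>. gR M q (dd k q) (E (idx \<alpha>) q))"

lemma expand_E:
  assumes "q \<in> U" "v \<in> tangent_space A q"
  shows "v f = (\<Sum>\<alpha>\<in>UNIV. gR M q v (E (idx \<alpha>) q) * E (idx \<alpha>) q f)"
proof -
  have "v f = (\<Sum>a<d+h. gR M q v (E a q) *\<^sub>R E a q) f"
    by (rule arg_cong[OF frame_expand[OF assms]])
  then show ?thesis by (simp add: sum_fun_apply sum_idx[of "\<lambda>a. gR M q v (E a q) * E a q f"])
qed

lemma Gm_Fm:
  assumes q: "q \<in> U"
  shows "Gm q ** Fm q = mat 1"
proof -
  have "(Gm q ** Fm q) $ k $ l = (if k = l then 1 else 0)" for k l
    using expand_E[OF q dd_tangent[OF q, of k], of "crd l"] dd_crd[OF q, of k l]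
    by (simp add: matrix_matrix_mult_def Gm_def Fm_def)
  then show ?thesis by (simp add: vec_eq_iff mat_def)
qed

lemma Fm_Gm: "q \<in> U \<Longrightarrow> Fm q ** Gm q = mat 1"
  using Gm_Fm matrix_left_right_inverse by blast

lemma Fm_smooth: "smooth A U (\<lambda>q. Fm q $ \<alpha> $ k)"
  using vfields_smooth[OF E_vfields[OF idx_less] open_U subset_refl crd_smooth[OF subset_refl]]
  by (simp add: Fm_def)

lemma Gm_smooth: "smooth A U (\<lambda>q. Gm q $ k $ \<alpha>)"
  using smooth_right_inverse_matrix[OF open_U Fm_smooth Fm_Gm] .

lemma frame_coeff:
  assumes "q \<in> U" "v \<in> tangent_space A q"
  shows "gR M q v (E (idx \<alpha>) q) = (\<Sum>k\<in>UNIV. v (crd k) * Gm q $ k $ \<alpha>)"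
proof -
  have "gR M q v (E (idx \<alpha>) q) = gR M q (\<Sum>k\<in>UNIV. v (crd k) *\<^sub>R dd k q) (E (idx \<alpha>) q)"
    by (rule arg_cong[where f="\<lambda>z. gR M q z (E (idx \<alpha>) q)", OF tangent_expand[OF assms(2) c subsetD[OF U_chart assms(1)]]])
  also have "\<dots> = (\<Sum>k\<in>UNIV. v (crd k) * gR M q (dd k q) (E (idx \<alpha>) q))"
    using assms(1) dd_tangent E_tangent idx_less by (intro gR.combination_left) auto
  finally show ?thesis by (simp add: Gm_def)
qed

text \<open>Coordinate components of a smooth field are smooth by definition of
  \<open>vfields\<close>; the smooth matrix \<open>Gm\<close> converts them to frame
  components.\<close>

lemma frame_coeff_smooth:
  assumes Y: "Y \<in> vfields A V" "open V" "V \<subseteq> U" and a: "a < d + h"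
  shows "smooth A V (\<lambda>q. gR M q (Y q) (E a q))"
proof -
  obtain \<alpha> where \<alpha>: "a = idx \<alpha>" using idx a by (auto simp: bij_betw_def set_eq_iff)
  have "smooth A V (\<lambda>q. Y q (crd k) * Gm q $ k $ \<alpha>)" for k
    by (rule smooth_mult[OF vfields_smooth[OF Y(1,2) subset_refl crd_smooth[OF Y(3)]]
          smooth_subset[OF Gm_smooth Y(3)] Y(2)])
  then have "smooth A V (\<lambda>q. \<Sum>k\<in>UNIV. Y q (crd k) * Gm q $ k $ \<alpha>)"
    by (rule smooth_sum[OF _ Y(2)])
  moreover have "gR M q (Y q) (E a q) = (\<Sum>k\<in>UNIV. Y q (crd k) * Gm q $ k $ \<alpha>)" if "q \<in> V" for q
    unfolding \<alpha> using frame_coeff[OF _ vfields_tangent[OF Y(1) that]] that Y(3) by blast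
  ultimately show ?thesis
    using smooth_cong[of V "\<lambda>q. gR M q (Y q) (E a q)" "\<lambda>q. \<Sum>k\<in>UNIV. Y q (crd k) * Gm q $ k $ \<alpha>"] Y(2) by blast
qed

lemma bracket_EE_vfields:
  assumes "a < d + h" "b < d + h" "open V" "V \<subseteq> U"
  shows "lie_bracket A (E a) (E b) \<in> vfields A V"
proof -
  have sm: "smooth A V f" if "smooth A U f" for f using smooth_subset[OF that assms(4)] .
  have vx: "X i \<in> vfields A V" if "i < d" for i using vfields_subset[OF X_vfields[OF that] assms(4)] .
  have XX: "lie_bracket A (X i) (X j) \<in> vfields A V" if ij: "i < d" "j < d" for i j
  proof (rule vfields_cong[OF assms(3)])
    show "(\<Sum>l<d. fscale (\<omega> i j l) (X l)) + (\<Sum>m<h. fscale (\<gamma> i j m) (Z m)) \<in> vfields A V"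
      using ij by (intro vfields_add vfields_sum vfields_fscale vx Z_vfields sm structure_smooth) auto
  qed (use assms(4) ij in \<open>auto simp: bracket_XX sum_fun_apply\<close>)
  have XZ: "lie_bracket A (X i) (Z m) \<in> vfields A V" if im: "i < d" "m < h" for i m
  proof (rule vfields_cong[OF assms(3)])
    show "(\<Sum>l<d. fscale (\<delta> i m l) (X l)) \<in> vfields A V"
      using im by (intro vfields_sum vfields_fscale vx sm structure_smooth) auto
  qed (use assms(4) im in \<open>auto simp: bracket_XZ sum_fun_apply\<close>)
  have ZX: "lie_bracket A (Z m) (X i) \<in> vfields A V" if im: "i < d" "m < h" for i m
  proof -
    have "lie_bracket A (Z m) (X i) = - lie_bracket A (X i) (Z m)"
      by (intro ext) (simp add: lie_bracket_def)
    then show ?thesis using vfields_uminus[OF XZ[OF im]] by simp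
  qed
  have ZZ: "lie_bracket A (Z m) (Z n) \<in> vfields A V" if "m < h" "n < h" for m n
    using vert_vfields[OF vert_bracket[OF Z_vert[OF that(1)] Z_vert[OF that(2)]]] .
  show ?thesis
    using assms(1,2) by (elim E_cases) (auto simp: XX XZ ZX ZZ)
qed

text \<open>That a commutator is again a directional derivative is not visible from its definition.
  Expanding both arguments in the frame reduces it to brackets of frame fields, which the structure
  equations and the subalgebra property control, plus multiples of frame fields.\<close>

lemma lie_bracket_vfields:
  assumes Y: "Y \<in> vfields A V" and W: "W \<in> vfields A V" and V: "open V" "V \<subseteq> U"
  shows "lie_bracket A Y W \<in> vfields A V"
proof -
  have Ev: "E a \<in> vfields A V" if "a < d + h" for a using vfields_subset[OF E_vfields[OF that] V(2)] .
  define w where "w a q = gR M q (W q) (E a q)" for a q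
  define y where "y a q = gR M q (Y q) (E a q)" for a q
  have sw: "smooth A V (w a)" if "a < d + h" for a
    unfolding w_def[abs_def] by (rule frame_coeff_smooth[OF W V that])
  have sy: "smooth A V (y a)" if "a < d + h" for a
    unfolding y_def[abs_def] by (rule frame_coeff_smooth[OF Y V that])
  have Weq: "W q = (\<Sum>a<d+h. w a q *\<^sub>R E a q)" if "q \<in> V" for q
    using frame_expand[OF _ vfields_tangent[OF W that]] that V(2) by (auto simp: w_def)
  have Yeq: "Y q = (\<Sum>a<d+h. y a q *\<^sub>R E a q)" if "q \<in> V" for q
    using frame_expand[OF _ vfields_tangent[OF Y that]] that V(2) by (auto simp: y_def)
  have EW: "lie_bracket A (E a) W \<in> vfields A V" if a: "a < d + h" for a
  proof (rule vfields_cong[OF V(1)])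
    show "(\<Sum>b<d+h. fscale (w b) (lie_bracket A (E a) (E b)) + fscale (\<lambda>q. E a q (w b)) (E b)) \<in> vfields A V"
      using a by (intro vfields_sum vfields_add vfields_fscale Ev sw bracket_EE_vfields V
          vfields_smooth[OF Ev[OF a] V(1) subset_refl]) simp_all
    show "(\<Sum>b<d+h. fscale (w b) (lie_bracket A (E a) (E b)) + fscale (\<lambda>q. E a q (w b)) (E b)) q
      = lie_bracket A (E a) W q" if q: "q \<in> V" for q
      using lie_bracket_combination_right[OF V(1) q finite_lessThan[of "d+h"] sw Ev Weq W Ev[OF a]]
      by (simp add: sum_fun_apply)
  qed
  show ?thesis
  proof (rule vfields_cong[OF V(1)])
    show "(\<Sum>a<d+h. fscale (y a) (lie_bracket A (E a) W) - fscale (\<lambda>q. W q (y a)) (E a)) \<in> vfields A V"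
      by (intro vfields_sum vfields_diff vfields_fscale Ev sy EW vfields_smooth[OF W V(1) subset_refl]) auto
    show "(\<Sum>a<d+h. fscale (y a) (lie_bracket A (E a) W) - fscale (\<lambda>q. W q (y a)) (E a)) q
      = lie_bracket A Y W q" if q: "q \<in> V" for q
      using lie_bracket_combination_left[OF V(1) q finite_lessThan[of "d+h"] sy Ev Yeq Y W]
      by (simp add: sum_fun_apply)
  qed
qed


subsection \<open>The Riemannian density and the divergence of the frame\<close>

definition dens :: "'m \<Rightarrow> real" where "dens q = sqrt (gram_det M c q)"

lemma dens_eq:
  assumes q: "q \<in> U"
  shows "dens q = \<bar>det (Gm q)\<bar>"
proof -
  have "gR M q (dd k q) (dd l q) = (\<Sum>\<alpha>\<in>UNIV. Gm q $ k $ \<alpha> * Gm q $ l $ \<alpha>)" for k l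
    using gR_expand[OF q dd_tangent[OF q] dd_tangent[OF q], of k l]
      sum_idx[of "\<lambda>a. gR M q (dd k q) (E a q) * gR M q (dd l q) (E a q)"]
    by (simp add: Gm_def)
  then have "(\<chi> k l. gR M q (dd k q) (dd l q)) = Gm q ** transpose (Gm q)"
    by (simp add: vec_eq_iff matrix_matrix_mult_def transpose_def)
  then have "gram_det M c q = (det (Gm q))\<^sup>2"
    by (simp add: gram_det_def det_mul det_transpose power2_eq_square)
  then show ?thesis by (simp add: dens_def)
qed

lemma det_Fm_Gm: "q \<in> U \<Longrightarrow> det (Fm q) * det (Gm q) = 1"
  using Fm_Gm by (metis det_I det_mul)

lemma dens_pos: "q \<in> U \<Longrightarrow> 0 < dens q"
  using det_Fm_Gm[of q] dens_eq[of q] by auto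

text \<open>The squared relation is free of the absolute value in \<open>dens_eq\<close> and can be
  differentiated directly.\<close>

lemma dens_det: "q \<in> U \<Longrightarrow> dens q * dens q * (det (Fm q) * det (Fm q)) = 1"
proof -
  assume q: "q \<in> U"
  have "dens q * dens q = det (Gm q) * det (Gm q)" using dens_eq[OF q] by simp
  then have "dens q * dens q * (det (Fm q) * det (Fm q)) = (det (Fm q) * det (Gm q)) * (det (Fm q) * det (Gm q))"
    by (simp add: algebra_simps)
  then show ?thesis using det_Fm_Gm[OF q] by simp
qed

lemma det_Gm_smooth: "smooth A U (\<lambda>q. det (Gm q))"
  by (rule smooth_det[OF open_U Gm_smooth])

lemma det_Fm_smooth: "smooth A U (\<lambda>q. det (Fm q))"
  by (rule smooth_det[OF open_U Fm_smooth])

text \<open>The determinant keeps its sign near each point, so there the absolute value is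
  multiplication by a constant.\<close>

lemma dens_smooth: "smooth A U dens"
proof (rule smooth_local)
  fix p assume p: "p \<in> U"
  define s where "s = sgn (det (Gm p))"
  have s: "s * s = 1" "0 < s * det (Gm p)"
    using det_Fm_Gm[OF p] by (auto simp: s_def sgn_if)
  let ?V = "{q \<in> U. 0 < s * det (Gm q)}"
  have "open ?V"
  proof -
    have "continuous_on U (\<lambda>q. s * det (Gm q))"
      using smooth_continuous_on[OF open_U det_Gm_smooth] by (intro continuous_intros)
    from continuous_open_preimage[OF this open_U open_greaterThan[of 0]]
    show ?thesis by (simp add: vimage_def Int_def)
  qed
  moreover have "smooth A ?V (\<lambda>q. s * det (Gm q))"
    using \<open>open ?V\<close> smooth_subset[OF det_Gm_smooth, of ?V] by (intro smooth_mult) auto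
  moreover have "dens q = s * det (Gm q)" if "q \<in> ?V" for q
    using that dens_eq[of q] s(1) abs_mult[of s "det (Gm q)"] by (auto simp: square_eq_1_iff)
  ultimately have "open ?V \<and> p \<in> ?V \<and> smooth A ?V dens"
    using p s smooth_cong[of ?V dens "\<lambda>q. s * det (Gm q)"] by blast
  then show "\<exists>V. open V \<and> p \<in> V \<and> smooth A V dens" by blast
qed

lemma near: "q \<in> U \<Longrightarrow> smooth A U f \<Longrightarrow> smooth_near A q f"
  using smooth_nearI[OF _ open_U] .

lemma tangent_det_Fm:
  assumes q: "q \<in> U" and v: "v \<in> tangent_space A q"
  shows "v (\<lambda>q. det (Fm q)) = det (Fm q) * (\<Sum>k\<in>UNIV. \<Sum>\<alpha>\<in>UNIV. Gm q $ k $ \<alpha> * v (\<lambda>q. Fm q $ \<alpha> $ k))"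
proof -
  have qc: "q \<in> fst c" using q U_chart by blast
  obtain w where w: "v = chart_deriv A c w q" using v tangent_space_chart[OF c qc] by blast
  have qq: "chart_inv c (snd c q) = q" by (rule chart_inv_chart[OF c qc])
  have D: "((\<lambda>x. Fm (chart_inv c x) $ \<alpha> $ k) has_derivative
      frechet_derivative (\<lambda>x. Fm (chart_inv c x) $ \<alpha> $ k) (at (snd c q))) (at (snd c q))" for \<alpha> k
    by (rule smooth_near_has_derivative[OF c qc near[OF q Fm_smooth]])
  have "Gm q ** Fm (chart_inv c (snd c q)) = mat 1" using Gm_Fm[OF q] qq by simp
  from has_derivative_det[OF D this]
  have "v (\<lambda>q. det (Fm q)) = det (Fm q) * (\<Sum>k\<in>UNIV. \<Sum>\<alpha>\<in>UNIV. Gm q $ k $ \<alpha> *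
      frechet_derivative (\<lambda>x. Fm (chart_inv c x) $ \<alpha> $ k) (at (snd c q)) w)"
    unfolding w by (subst chart_deriv_eqI[OF near[OF q det_Fm_smooth]]) (auto simp: qq)
  then show ?thesis
    by (simp add: w chart_deriv_apply[OF near[OF q Fm_smooth]])
qed

text \<open>Differentiating the constant in \<open>dens_det\<close> shows that the logarithmic
  derivative of \<open>dens\<close> is the negative of that of \<open>det (Fm q)\<close>, which
  Jacobi's formula computes.\<close>

lemma tangent_dens:
  assumes q: "q \<in> U" and v: "v \<in> tangent_space A q"
  shows "v dens = - dens q * (\<Sum>k\<in>UNIV. \<Sum>\<alpha>\<in>UNIV. Gm q $ k $ \<alpha> * v (\<lambda>q. Fm q $ \<alpha> $ k))"
proof -
  let ?D = "\<lambda>q. det (Fm q)"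
  let ?s = "\<Sum>k\<in>UNIV. \<Sum>\<alpha>\<in>UNIV. Gm q $ k $ \<alpha> * v (\<lambda>q. Fm q $ \<alpha> $ k)"
  note n = near[OF q dens_smooth] near[OF q det_Fm_smooth]
  have "v (\<lambda>q. dens q * dens q * (?D q * ?D q)) = v (\<lambda>q. 1)"
    by (rule tangent_cong[OF v open_U q]) (rule dens_det)
  also have "\<dots> = 0" by (rule tangent_const[OF v])
  also have "v (\<lambda>q. dens q * dens q * (?D q * ?D q)) =
      (v dens * dens q + dens q * v dens) * (?D q * ?D q) + dens q * dens q * (v ?D * ?D q + ?D q * v ?D)"
    by (simp only: tangent_mult[OF v smooth_near_mult[OF n(1) n(1)] smooth_near_mult[OF n(2) n(2)]]
        tangent_mult[OF v n(1) n(1)] tangent_mult[OF v n(2) n(2)])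
  finally have "2 * (dens q * ?D q * ?D q) * (v dens + dens q * ?s) = 0"
    unfolding tangent_det_Fm[OF q v] by (simp add: algebra_simps)
  moreover have "dens q * ?D q * ?D q \<noteq> 0" using dens_det[OF q] by auto
  ultimately show ?thesis by simp
qed

text \<open>This is the divergence of \<open>X\<^sub>i\<close> with respect to \<open>\<mu>\<close>: no \<open>\<delta>\<close> enters since \<open>[X\<^sub>i, Z\<^sub>m]\<close> is horizontal.\<close>

definition dvg :: "nat \<Rightarrow> 'm \<Rightarrow> real" where "dvg i q = - (\<Sum>l<d. \<omega> i l l q)"

text \<open>By \<open>frame_coeff\<close> the contraction is a trace in the orthonormal frame. Its
  vertical diagonal entries vanish since the bracket of \<open>X i\<close> with \<open>Z m\<close>
  is horizontal, and the horizontal ones are \<open>\<omega> i l l\<close>.\<close>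

lemma trace_bracket:
  assumes q: "q \<in> U" and i: "i < d"
  shows "(\<Sum>k\<in>UNIV. \<Sum>\<alpha>\<in>UNIV. Gm q $ k $ \<alpha> * lie_bracket A (X i) (E (idx \<alpha>)) q (crd k)) = - dvg i q"
proof -
  have t: "lie_bracket A (X i) (E (idx \<alpha>)) q \<in> tangent_space A q" for \<alpha>
    using vfields_tangent[OF bracket_EE_vfields[of i "idx \<alpha>", OF _ idx_less open_U subset_refl] q] i by simp
  have "(\<Sum>k\<in>UNIV. \<Sum>\<alpha>\<in>UNIV. Gm q $ k $ \<alpha> * lie_bracket A (X i) (E (idx \<alpha>)) q (crd k))
      = (\<Sum>\<alpha>\<in>UNIV. gR M q (lie_bracket A (X i) (E (idx \<alpha>)) q) (E (idx \<alpha>) q))"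
    by (subst sum.swap) (simp add: frame_coeff[OF q t] mult.commute)
  also have "\<dots> = (\<Sum>a<d+h. gR M q (lie_bracket A (X i) (E a) q) (E a q))"
    by (rule sum_idx)
  also have "\<dots> = (\<Sum>l<d. \<omega> i l l q)"
  proof -
    have "gR M q (lie_bracket A (X i) (Z m) q) (Z m q) = 0" if "m < h" for m
      unfolding bracket_XZ[OF q i that] using hor_combination[OF q] Z_vert[OF that] by (rule gR_hor_vert)
    moreover have "gR M q (lie_bracket A (X i) (X l) q) (X l q) = \<omega> i l l q" if "l < d" for l
      by (rule bracket_XX_coeff[OF q i that that])
    ultimately show ?thesis by (simp add: sum_lessThan_add)
  qed
  finally show ?thesis by (simp add: dvg_def)
qed

text \<open>The product rule leaves the derivative of the density along \<open>X i\<close>, the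
  coordinate divergence of \<open>X i\<close>, and \<open>X i q u\<close>. In terms of the frame,
  the first contains the derivatives of the components of \<open>E (idx \<alpha>)\<close> along
  \<open>X i\<close>, the second those of \<open>X i\<close> along \<open>E (idx \<alpha>)\<close>;
  together they form the trace of a bracket.\<close>

lemma divergence:
  assumes V: "open V" "V \<subseteq> U" "q \<in> V" and i: "i < d" and u: "smooth A V u"
  shows "(\<Sum>k\<in>UNIV. dd k q (\<lambda>q. dens q * X i q (crd k) * u q)) = dens q * (X i q u + dvg i q * u q)"
proof -
  have q: "q \<in> U" using V by blast
  have t: "X i q \<in> tangent_space A q" using X_hor[OF i q] hor_tangent by blast
  have nu: "smooth_near A q u" by (rule smooth_nearI[OF u V(1,3)])
  have nd: "smooth_near A q dens" by (rule near[OF q dens_smooth])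
  have nX: "smooth_near A q (\<lambda>q. X i q (crd k))" for k
    by (rule near[OF q vfields_smooth[OF X_vfields[OF i] open_U subset_refl crd_smooth[OF subset_refl]]])
  note dt = dd_tangent[OF q]
  have "(\<Sum>k\<in>UNIV. dd k q (\<lambda>q. dens q * X i q (crd k) * u q))
      = (\<Sum>k\<in>UNIV. (dd k q dens * X i q (crd k) + dens q * dd k q (\<lambda>q. X i q (crd k))) * u q
          + dens q * X i q (crd k) * dd k q u)"
    by (simp only: tangent_mult[OF dt smooth_near_mult[OF nd nX] nu] tangent_mult[OF dt nd nX])
  also have "\<dots> = u q * (\<Sum>k\<in>UNIV. X i q (crd k) * dd k q dens)
      + dens q * u q * (\<Sum>k\<in>UNIV. dd k q (\<lambda>q. X i q (crd k))) + dens q * (\<Sum>k\<in>UNIV. X i q (crd k) * dd k q u)"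
    by (simp add: sum.distrib sum_distrib_left algebra_simps)
  also have "(\<Sum>k\<in>UNIV. X i q (crd k) * dd k q dens) = X i q dens"
    by (rule expand_dd[OF q t, symmetric])
  also have "(\<Sum>k\<in>UNIV. X i q (crd k) * dd k q u) = X i q u"
    by (rule expand_dd[OF q t, symmetric])
  also have "(\<Sum>k\<in>UNIV. dd k q (\<lambda>q. X i q (crd k)))
      = (\<Sum>k\<in>UNIV. \<Sum>\<alpha>\<in>UNIV. Gm q $ k $ \<alpha> * E (idx \<alpha>) q (\<lambda>q. X i q (crd k)))"
    using expand_E[OF q dt] by (simp add: Gm_def)
  also have "X i q dens = - dens q * (\<Sum>k\<in>UNIV. \<Sum>\<alpha>\<in>UNIV. Gm q $ k $ \<alpha> * X i q (\<lambda>q. E (idx \<alpha>) q (crd k)))"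
    using tangent_dens[OF q t] by (simp add: Fm_def)
  also have "u q * (- dens q * (\<Sum>k\<in>UNIV. \<Sum>\<alpha>\<in>UNIV. Gm q $ k $ \<alpha> * X i q (\<lambda>q. E (idx \<alpha>) q (crd k))))
      + dens q * u q * (\<Sum>k\<in>UNIV. \<Sum>\<alpha>\<in>UNIV. Gm q $ k $ \<alpha> * E (idx \<alpha>) q (\<lambda>q. X i q (crd k)))
      + dens q * X i q u
    = - dens q * u q * (\<Sum>k\<in>UNIV. \<Sum>\<alpha>\<in>UNIV. Gm q $ k $ \<alpha> * lie_bracket A (X i) (E (idx \<alpha>)) q (crd k)) + dens q * X i q u"
    by (simp add: lie_bracket_apply[OF near[OF q crd_smooth[OF subset_refl]]] algebra_simps sum_subtractf sum_distrib_left sum_negf)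
  also have "\<dots> = dens q * (X i q u + dvg i q * u q)"
    by (simp add: trace_bracket[OF q i] algebra_simps)
  finally show ?thesis .
qed

end


section \<open>The sub-Laplacian in an adapted frame\<close>

context manifold
begin

text \<open>A Euclidean bump is carried through the chart and extended by 0. The extension is smooth
  because the support lies in the image \<open>K\<close> of a closed ball, which is compact, hence
  closed in a Hausdorff space, and contained in \<open>V\<close>: the open sets \<open>V\<close> and
  the complement of \<open>K\<close> cover the manifold.\<close>

lemma chart_bump:
  assumes c: "c \<in> A" and V: "open V" "V \<subseteq> fst c" and R: "0 < r" "r < R" "cball x0 R \<subseteq> snd c ` V"
  obtains \<eta> where "smooth A UNIV \<eta>" "\<And>q. 0 \<le> \<eta> q" "\<And>q. q \<in> V \<Longrightarrow> dist (snd c q) x0 \<le> r \<Longrightarrow> \<eta> q = 1"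
    "\<And>q. \<eta> q \<noteq> 0 \<Longrightarrow> q \<in> V \<and> dist (snd c q) x0 < R" "compact (closure {q. \<eta> q \<noteq> 0})"
proof -
  obtain b :: "real ^ 'n \<Rightarrow> real" where b: "Cinf_on UNIV b" "\<And>x. 0 \<le> b x"
    "\<And>x. dist x x0 \<le> r \<Longrightarrow> b x = 1" "\<And>x. R \<le> dist x x0 \<Longrightarrow> b x = 0"
    by (rule smooth_bump[OF R(1,2), of x0], rule that)
  define \<eta> where "\<eta> q = (if q \<in> V then b (snd c q) else 0)" for q
  define K where "K = chart_inv c ` cball x0 R"
  have sub: "cball x0 R \<subseteq> snd c ` fst c" using R(3) V(2) by blast
  have "continuous_on (cball x0 R) (chart_inv c)"
    using homeomorphism_cont2[OF chart_homeomorphism[OF c]] sub continuous_on_subset by blast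
  then have K: "compact K" unfolding K_def by (rule compact_continuous_image) simp
  have KV: "K \<subseteq> V"
  proof
    fix q assume "q \<in> K"
    then obtain x where x: "x \<in> cball x0 R" "q = chart_inv c x" by (auto simp: K_def)
    then obtain q' where q': "q' \<in> V" "x = snd c q'" using R(3) by blast
    then show "q \<in> V" using chart_inv_chart[OF c] V(2) x by auto
  qed
  have supp: "q \<in> K \<and> dist (snd c q) x0 < R" if "\<eta> q \<noteq> 0" for q
  proof -
    have q: "q \<in> V" "b (snd c q) \<noteq> 0" using that by (auto simp: \<eta>_def split: if_splits)
    then have d: "dist (snd c q) x0 < R" using b(4)[of "snd c q"] by linarith
    have "q = chart_inv c (snd c q)" using chart_inv_chart[OF c] q(1) V(2) by auto
    then show ?thesis using d unfolding K_def by (auto simp: dist_commute)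
  qed
  have sm: "smooth A UNIV \<eta>"
  proof (rule smooth_local)
    fix q
    show "\<exists>W. open W \<and> q \<in> W \<and> smooth A W \<eta>"
    proof (cases "q \<in> V")
      case True
      have "smooth A V \<eta>"
      proof (rule smooth_chartI[OF c V(2,1)])
        have o: "open (snd c ` V)" using open_chart_image[OF c V(1)] V(2) by (simp add: Int_absorb2)
        have "\<eta> (chart_inv c x) = b x" if "x \<in> snd c ` V" for x
          using that chart_inv_chart[OF c] V(2) by (auto simp: \<eta>_def)
        then show "Cinf_on (snd c ` V) (\<lambda>x. \<eta> (chart_inv c x))"
          using Cinf_on_cong[OF o, of "\<lambda>x. \<eta> (chart_inv c x)" b] Cinf_on_subset[OF b(1)] by simp
      qed
      with True V(1) show ?thesis by blast
    next
      case False
      have "smooth A (- K) \<eta>"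
        using smooth_cong[of "- K" \<eta> "\<lambda>q. 0"] compact_imp_closed[OF K] supp by (auto simp: open_Compl)
      then show ?thesis using False KV compact_imp_closed[OF K] by (intro exI[of _ "- K"]) (auto simp: open_Compl)
    qed
  qed
  have "closure {q. \<eta> q \<noteq> 0} \<subseteq> K"
    using supp compact_imp_closed[OF K] by (intro closure_minimal) auto
  then have "compact (closure {q. \<eta> q \<noteq> 0})"
    using compact_Int_closed[OF K, of "closure {q. \<eta> q \<noteq> 0}"] by (simp add: Int_absorb1)
  with sm show ?thesis
    using b(2,3) supp KV by (intro that[of \<eta>]) (auto simp: \<eta>_def)
qed

lemma bump_at:
  assumes "open V" "p \<in> V"
  obtains \<eta> where "smooth A UNIV \<eta>" "\<eta> p = 1" "\<And>q. q \<notin> V \<Longrightarrow> \<eta> q = 0"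
proof -
  obtain c where c: "c \<in> A" "p \<in> fst c" by (rule chart_cover)
  let ?V = "V \<inter> fst c"
  have o: "open (snd c ` ?V)" using open_chart_image[OF c(1) assms(1)] .
  then obtain R where R: "0 < R" "cball (snd c p) R \<subseteq> snd c ` ?V"
    using assms(2) c(2) open_contains_cball[of "snd c ` ?V"] by blast
  have Vo: "open ?V" using assms(1) open_chart[OF c(1)] by auto
  have r: "0 < R / 2" "R / 2 < R" using R by auto
  obtain \<eta> where \<eta>: "smooth A UNIV \<eta>" "\<And>q. 0 \<le> \<eta> q"
    "\<And>q. q \<in> ?V \<Longrightarrow> dist (snd c q) (snd c p) \<le> R / 2 \<Longrightarrow> \<eta> q = 1"
    "\<And>q. \<eta> q \<noteq> 0 \<Longrightarrow> q \<in> ?V \<and> dist (snd c q) (snd c p) < R" "compact (closure {q. \<eta> q \<noteq> 0})"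
    by (rule chart_bump[OF c(1) Vo Int_lower2 r R(2)], rule that)
  show ?thesis
    using \<eta>(1) \<eta>(3)[of p] \<eta>(4) assms(2) c(2) R(1) by (intro that[of \<eta>]) auto
qed

end

section \<open>Locality of the sub-Laplacian\<close>

locale sub_lap = subriemannian M d h
  for M :: "('m::{t2_space,second_countable_topology}, 'n::finite) subriem" and d h +
  fixes \<mu> :: "'m measure" and L
  assumes riemannian_measure: "riemannian_measure M \<mu>" and sub_laplacian: "sub_laplacian M \<mu> L"
begin

lemma L_smooth: "smooth A UNIV f \<Longrightarrow> smooth A UNIV (L f)"
  and L_scale: "smooth A UNIV f \<Longrightarrow> L (a *\<^sub>R f) = a *\<^sub>R L f"
  and L_add: "smooth A UNIV f \<Longrightarrow> smooth A UNIV g \<Longrightarrow> L (f + g) = L f + L g"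
  using sub_laplacian[unfolded sub_laplacian_def, THEN conjunct1] by auto

lemma L_mult:
  assumes "smooth A UNIV f" "smooth A UNIV g"
  shows "L (\<lambda>q. f q * g q) p = f p * L g p + g p * L f p + 2 * Gam M f g p"
proof -
  have "(L (\<lambda>q. f q * g q) p - f p * L g p - g p * L f p) / 2 = Gam M f g p"
    using sub_laplacian[unfolded sub_laplacian_def, THEN conjunct2, THEN conjunct1] assms by blast
  then show ?thesis by (simp add: field_simps)
qed

lemma L_symmetric:
  assumes "f \<in> test_functions M" "g \<in> test_functions M"
  shows "(LINT p|\<mu>. f p * L g p) = (LINT p|\<mu>. g p * L f p)"
  using sub_laplacian[unfolded sub_laplacian_def, THEN conjunct2, THEN conjunct2] assms by blast

text \<open>The product identity for \<open>1 * 1\<close> reads \<open>L 1 = 2 * L 1\<close>;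
  linearity does the rest.\<close>

lemma L_const: "L (\<lambda>q. a) p = 0"
proof -
  have "L (\<lambda>q. 1) p = 0"
    using L_mult[of "\<lambda>q. 1" "\<lambda>q. 1" p] Gam_locally_const[of UNIV p "\<lambda>q. 1" 1 "\<lambda>q. 1"] by simp
  moreover have "(\<lambda>q. a) = a *\<^sub>R (\<lambda>q. 1 :: real)" by (simp add: fun_eq_iff)
  then have "L (\<lambda>q. a) = a *\<^sub>R L (\<lambda>q. 1)" by (rule ssubst) (rule L_scale[OF smooth_const])
  ultimately show ?thesis by simp
qed

text \<open>With a bump \<open>\<eta>\<close> that vanishes outside \<open>V\<close>, the product
  \<open>\<eta> f\<close> is identically 0. At \<open>p\<close> its product identity reduces to
  \<open>\<eta> p * L f p\<close>, and \<open>\<eta> p = 1\<close>.\<close>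

lemma L_locally_zero:
  assumes f: "smooth A UNIV f" and V: "open V" "p \<in> V" and 0: "\<And>q. q \<in> V \<Longrightarrow> f q = 0"
  shows "L f p = 0"
proof -
  obtain \<eta> where \<eta>: "smooth A UNIV \<eta>" "\<eta> p = 1" "\<And>q. q \<notin> V \<Longrightarrow> \<eta> q = 0" by (rule bump_at[OF V], rule that)
  have "(\<lambda>q. \<eta> q * f q) = (\<lambda>q. 0)"
  proof
    fix q show "\<eta> q * f q = 0" using \<eta>(3)[of q] 0[of q] by (cases "q \<in> V") auto
  qed
  then have "0 = \<eta> p * L f p + f p * L \<eta> p + 2 * Gam M \<eta> f p"
    using L_mult[OF \<eta>(1) f, of p] L_const[of 0 p] by simp
  moreover have "Gam M \<eta> f p = 0" by (rule Gam_locally_const(2)[OF V 0])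
  ultimately show ?thesis using \<eta>(2) 0[OF V(2)] by simp
qed

lemma L_cong:
  assumes f: "smooth A UNIV f" and g: "smooth A UNIV g" and V: "open V" "p \<in> V"
    and eq: "\<And>q. q \<in> V \<Longrightarrow> f q = g q"
  shows "L f p = L g p"
proof -
  have m: "smooth A UNIV (-1 *\<^sub>R g)" using smooth_mult[OF smooth_const g, of "-1"] by (simp add: scaleR_fun_def)
  have s: "smooth A UNIV (f + (-1 *\<^sub>R g))" using smooth_add[OF f m] by (simp add: plus_fun_def)
  have "L (f + (-1 *\<^sub>R g)) p = 0"
    by (rule L_locally_zero[OF s V]) (simp add: eq)
  then show ?thesis using L_add[OF f m] L_scale[OF g, of "-1"] by simp
qed

end

section \<open>Integration by parts in a chart\<close>

locale sub_lap_chart = sub_lap M d h \<mu> L + adapted_chart M d h U X Z \<omega> \<gamma> \<delta> c p0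
  for M :: "('m::{t2_space,second_countable_topology}, 'n::finite) subriem" and d h \<mu> L U X Z \<omega> \<gamma> \<delta> c p0
begin

text \<open>The coordinate expression is extended by 0 so that all integrals run over the whole
  Euclidean space.\<close>

definition pull :: "('m \<Rightarrow> real) \<Rightarrow> real ^ 'n \<Rightarrow> real" where
  "pull F x = (if x \<in> snd c ` U then F (chart_inv c x) else 0)"

abbreviation "x0 \<equiv> snd c p0"

lemma open_range: "open (snd c ` U)"
  using open_chart_image[OF c open_U] U_chart by (simp add: Int_absorb2)

lemma inv_chart: "q \<in> U \<Longrightarrow> chart_inv c (snd c q) = q"
  using chart_inv_chart[OF c] U_chart by blast

lemma pull_eq: "q \<in> U \<Longrightarrow> pull F (snd c q) = F q"
  by (simp add: pull_def inv_chart)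

lemma pull_Cinf:
  assumes "smooth A U F" and "\<And>q. q \<in> U \<Longrightarrow> F q \<noteq> 0 \<Longrightarrow> dist (snd c q) x0 \<le> R" "cball x0 R \<subseteq> snd c ` U"
  shows "Cinf_on UNIV (pull F)"
proof (rule Cinf_on_local)
  fix x
  show "\<exists>T. open T \<and> x \<in> T \<and> Cinf_on T (pull F)"
  proof (cases "x \<in> snd c ` U")
    case True
    have "Cinf_on (snd c ` U) (pull F)"
      using Cinf_on_cong[OF open_range, of "pull F" "\<lambda>x. F (chart_inv c x)"]
        smooth_chart_smooth[OF c assms(1) U_chart] by (simp add: pull_def)
    with True open_range show ?thesis by blast
  next
    case False
    have "pull F y = 0" if "y \<notin> cball x0 R" for y
    proof (cases "y \<in> snd c ` U")
      case True
      then obtain q where q: "q \<in> U" "y = snd c q" by blast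
      then have "F q = 0" using assms(2)[OF q(1)] that by (auto simp: dist_commute)
      then show ?thesis using pull_eq[OF q(1)] q(2) by simp
    qed (simp add: pull_def)
    then have "Cinf_on (- cball x0 R) (pull F)"
      using Cinf_on_cong[of "- cball x0 R" "pull F" "\<lambda>x. 0"] by (simp add: open_Compl)
    then show ?thesis using False assms(3) by (intro exI[of _ "- cball x0 R"]) (auto simp: open_Compl)
  qed
qed

text \<open>On \<open>U\<close>, the measure \<open>\<mu>\<close> is the image under the inverse
  chart of Lebesgue measure with density \<open>dens\<close>: both sides agree on Borel sets by the
  defining formula of \<open>riemannian_measure\<close>. Integrability and integrals then follow
  from the rules for densities and image measures.\<close>

lemma transfer:
  assumes F: "F \<in> borel_measurable borel" "\<And>q. q \<notin> U \<Longrightarrow> F q = 0"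
  shows "integrable \<mu> F \<longleftrightarrow> integrable lborel (pull (\<lambda>q. dens q * F q))" (is ?int)
    and "(LINT q|\<mu>. F q) = (LINT x|lborel. pull (\<lambda>q. dens q * F q) x)" (is ?eq)
proof -
  let ?D = "snd c ` U"
  have sets: "sets \<mu> = sets borel" using riemannian_measure by (simp add: riemannian_measure_def)
  \<comment> \<open>Outside the coordinate image, \<open>k\<close> takes the value \<open>p0\<close>
    merely to be a total measurable map; the weight \<open>w\<close> is 0 there.\<close>
  define k where "k x = (if x \<in> ?D then chart_inv c x else p0)" for x
  have k: "k \<in> borel_measurable borel"
  proof (rule borel_measurableI)
    fix S :: "'m set" assume S: "open S"
    have "continuous_on ?D (chart_inv c)"
      by (rule continuous_on_subset[OF homeomorphism_cont2[OF chart_homeomorphism[OF c]] image_mono[OF U_chart]])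
    from continuous_open_preimage[OF this open_range S]
    have o: "?D \<inter> chart_inv c -` S \<in> sets borel" by simp
    have "k -` S \<inter> space borel = (?D \<inter> chart_inv c -` S) \<union> (if p0 \<in> S then - ?D else {})"
      by (auto simp: k_def split: if_splits)
    moreover have "- ?D \<in> sets borel" using open_range by auto
    ultimately show "k -` S \<inter> space borel \<in> sets borel" using o by auto
  qed
  define w where "w = pull dens"
  have wnn: "0 \<le> w x" for x using dens_pos inv_chart by (auto simp: w_def pull_def intro: less_imp_le)
  have w: "w \<in> borel_measurable borel"
  proof -
    have "continuous_on ?D (\<lambda>x. dens (chart_inv c x))"
      using smooth_chart_smooth[OF c dens_smooth U_chart] by (rule Cinf_on_continuous_on)
    then have "(\<lambda>x. if x \<in> ?D then dens (chart_inv c x) else 0) \<in> borel_measurable borel"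
      using open_range by (intro borel_measurable_continuous_on_if continuous_on_const) auto
    then show ?thesis by (simp add: w_def pull_def[abs_def])
  qed
  define N where "N = distr (density lborel (\<lambda>x. ennreal (w x))) borel k"
  have U: "U \<in> sets borel" using open_U by auto
  have eq: "density \<mu> (\<lambda>q. ennreal (indicator U q)) = N"
  proof (rule measure_eqI)
    show "sets (density \<mu> (\<lambda>q. ennreal (indicator U q))) = sets N" by (simp add: N_def sets)
    fix S assume "S \<in> sets (density \<mu> (\<lambda>q. ennreal (indicator U q)))"
    then have S: "S \<in> sets borel" by (simp add: sets)
    have SU: "S \<inter> U \<in> sets borel" "S \<inter> U \<subseteq> fst c" using S U U_chart by auto
    have "emeasure (density \<mu> (\<lambda>q. ennreal (indicator U q))) S
        = (\<integral>\<^sup>+q. ennreal (indicator U q) * indicator S q \<partial>\<mu>)"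
      using S U sets by (intro emeasure_density) auto
    also have "\<dots> = (\<integral>\<^sup>+q. indicator (S \<inter> U) q \<partial>\<mu>)"
      by (intro nn_integral_cong) (auto simp: indicator_def)
    also have "\<dots> = emeasure \<mu> (S \<inter> U)" using SU(1) sets by simp
    also have "\<dots> = (\<integral>\<^sup>+ x \<in> snd c ` (S \<inter> U). ennreal (sqrt (gram_det M c (chart_inv c x))) \<partial>lborel)"
      using riemannian_measure c SU unfolding riemannian_measure_def by blast
    also have "\<dots> = (\<integral>\<^sup>+ x. ennreal (w x) * indicator (k -` S) x \<partial>lborel)"
    proof (intro nn_integral_cong)
      fix x
      have "x \<in> snd c ` (S \<inter> U) \<longleftrightarrow> x \<in> ?D \<and> k x \<in> S"
        using inv_chart by (auto simp: k_def)
      then show "ennreal (sqrt (gram_det M c (chart_inv c x))) * indicator (snd c ` (S \<inter> U)) x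
          = ennreal (w x) * indicator (k -` S) x"
        by (auto simp: w_def pull_def dens_def indicator_def)
    qed
    also have "\<dots> = emeasure N S"
      using S k w unfolding N_def
      by (subst emeasure_distr) (auto simp: emeasure_density measurable_sets_borel)
    finally show "emeasure (density \<mu> (\<lambda>q. ennreal (indicator U q))) S = emeasure N S" .
  qed
  have F\<mu>: "F \<in> borel_measurable \<mu>" using F(1) measurable_cong_sets[OF sets refl] by blast
  have U\<mu>: "(\<lambda>q. indicator U q :: real) \<in> borel_measurable \<mu>" using U sets by simp
  have IF: "(\<lambda>q. indicator U q *\<^sub>R F q) = F"
    using F(2) by (auto simp: fun_eq_iff indicator_def)
  have PF: "(\<lambda>x. w x *\<^sub>R F (k x)) = pull (\<lambda>q. dens q * F q)"
    by (auto simp: fun_eq_iff w_def pull_def k_def)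
  have km: "k \<in> density lborel (\<lambda>x. ennreal (w x)) \<rightarrow>\<^sub>M borel" using k by simp
  have Fk: "(\<lambda>x. F (k x)) \<in> borel_measurable lborel" using measurable_compose[OF k F(1)] by simp
  have wl: "w \<in> borel_measurable lborel" using w by simp
  have "integrable \<mu> F \<longleftrightarrow> integrable (density \<mu> (\<lambda>q. ennreal (indicator U q))) F"
    using integrable_density[OF F\<mu> U\<mu>] unfolding IF by simp
  also have "\<dots> \<longleftrightarrow> integrable (density lborel (\<lambda>x. ennreal (w x))) (\<lambda>x. F (k x))"
    unfolding eq N_def using integrable_distr_eq[OF km F(1)] .
  also have "\<dots> \<longleftrightarrow> integrable lborel (pull (\<lambda>q. dens q * F q))"
    using integrable_density[OF Fk wl] wnn unfolding PF by simp
  finally show ?int .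
  have "(LINT q|\<mu>. F q) = (LINT q|density \<mu> (\<lambda>q. ennreal (indicator U q)). F q)"
    using integral_density[OF F\<mu> U\<mu>] unfolding IF by simp
  also have "\<dots> = (LINT x|density lborel (\<lambda>x. ennreal (w x)). F (k x))"
    unfolding eq N_def using integral_distr[OF km F(1)] .
  also have "\<dots> = (LINT x|lborel. pull (\<lambda>q. dens q * F q) x)"
    using integral_density[OF Fk wl] wnn unfolding PF by simp
  finally show ?eq .
qed


text \<open>Test functions supported in the coordinate ball of radius \<open>r\<close>, with a cutoff that equals 1
  on a larger ball, replace the missing global integrability of \<open>L f\<close>.\<close>

lemma integral_L_by_parts:
  assumes R: "0 < r" "r < R" "cball x0 R \<subseteq> snd c ` U"
    and \<phi>: "smooth A UNIV \<phi>" "\<And>q. \<phi> q \<noteq> 0 \<Longrightarrow> q \<in> U \<and> dist (snd c q) x0 \<le> r" "compact (closure {q. \<phi> q \<noteq> 0})"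
    and g: "smooth A UNIV g"
  shows "(LINT x|lborel. pull (\<lambda>q. dens q * (\<phi> q * L g q + Gam M \<phi> g q)) x) = 0"
proof -
  \<comment> \<open>An intermediate radius, so that the cutoff \<open>\<eta>\<close> equals 1 on an
    open neighbourhood \<open>B\<close> of the set \<open>K\<close> outside which
    \<open>\<phi>\<close> vanishes; then \<open>L \<eta>\<close> vanishes on \<open>B\<close> by
    locality.\<close>
  define r1 where "r1 = (r + R) / 2"
  have r1: "r < r1" "0 < r1" "r1 < R" using R by (auto simp: r1_def)
  obtain \<eta> where \<eta>: "smooth A UNIV \<eta>" "\<And>q. 0 \<le> \<eta> q"
    "\<And>q. q \<in> U \<Longrightarrow> dist (snd c q) x0 \<le> r1 \<Longrightarrow> \<eta> q = 1"
    "\<And>q. \<eta> q \<noteq> 0 \<Longrightarrow> q \<in> U \<and> dist (snd c q) x0 < R" "compact (closure {q. \<eta> q \<noteq> 0})"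
    by (rule chart_bump[OF c open_U U_chart r1(2,3) R(3)], rule that)
  define K where "K = chart_inv c ` cball x0 r"
  define B where "B = U \<inter> snd c -` ball x0 r1"
  have sub: "cball x0 r \<subseteq> snd c ` U" using R(2,3) by (auto simp: subset_iff)
  have "continuous_on (cball x0 r) (chart_inv c)"
    by (rule continuous_on_subset[OF homeomorphism_cont2[OF chart_homeomorphism[OF c]] subset_trans[OF sub image_mono[OF U_chart]]])
  then have "closed K" unfolding K_def by (intro compact_imp_closed compact_continuous_image) auto
  then have K: "open (- K)" by (simp add: open_Compl)
  have KB: "K \<subseteq> B"
  proof
    fix q assume "q \<in> K"
    then obtain q' where q': "q' \<in> U" "q = chart_inv c (snd c q')" "snd c q' \<in> cball x0 r"
      using sub unfolding K_def by blast
    then show "q \<in> B" using r1(1) inv_chart[OF q'(1)] by (simp add: B_def)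
  qed
  have B: "open B" unfolding B_def
    by (rule continuous_open_preimage[OF continuous_on_subset[OF homeomorphism_cont1[OF chart_homeomorphism[OF c]] U_chart]
          open_U open_ball])
  have \<phi>K: "\<phi> q = 0" if "q \<in> - K" for q
  proof (rule ccontr)
    assume "\<phi> q \<noteq> 0"
    from \<phi>(2)[OF this] have "q \<in> U" "snd c q \<in> cball x0 r" by (simp_all add: dist_commute)
    then have "q \<in> K" using inv_chart[of q] unfolding K_def by (metis imageI)
    with that show False by simp
  qed
  have \<eta>B: "\<eta> q = 1" if "q \<in> B" for q
    using that \<eta>(3)[of q] by (simp add: B_def dist_commute)
  let ?\<psi> = "\<lambda>q. \<phi> q * g q" and ?\<eta>g = "\<lambda>q. \<eta> q * g q"
  have \<psi>: "smooth A UNIV ?\<psi>" and \<eta>g: "smooth A UNIV ?\<eta>g"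
    using smooth_mult[OF \<phi>(1) g] smooth_mult[OF \<eta>(1) g] by auto
  have test: "f \<in> test_functions M" if "smooth A UNIV f" "compact (closure {q. b q \<noteq> 0})" "\<And>q. f q \<noteq> 0 \<Longrightarrow> b q \<noteq> 0"
    for f b :: "'m \<Rightarrow> real"
  proof -
    have "closure {q. f q \<noteq> 0} \<subseteq> closure {q. b q \<noteq> 0}" using that(3) by (intro closure_mono) auto
    then have "compact (closure {q. f q \<noteq> 0})"
      using compact_Int_closed[OF that(2) closed_closure, of "{q. f q \<noteq> 0}"] by (simp add: Int_absorb1)
    then show ?thesis using that(1) by (simp add: test_functions_def)
  qed
  have tests: "\<phi> \<in> test_functions M" "\<eta> \<in> test_functions M" "?\<psi> \<in> test_functions M" "?\<eta>g \<in> test_functions M"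
    using test[OF \<phi>(1,3)] test[OF \<eta>(1,5)] test[OF \<psi> \<phi>(3)] test[OF \<eta>g \<eta>(5)] by auto
  have L0: "L \<phi> q = 0" "L ?\<psi> q = 0" if "q \<notin> K" for q
  proof -
    have q: "q \<in> - K" using that by simp
    show "L \<phi> q = 0" by (rule L_locally_zero[OF \<phi>(1) K q \<phi>K])
    show "L ?\<psi> q = 0" by (rule L_locally_zero[OF \<psi> K q]) (simp add: \<phi>K)
  qed
  have L\<eta>: "L \<eta> q = 0" "L ?\<eta>g q = L g q" if "q \<in> B" for q
  proof -
    have "L \<eta> q = L (\<lambda>q. 1) q" by (rule L_cong[OF \<eta>(1) smooth_const B that \<eta>B])
    then show "L \<eta> q = 0" by (simp add: L_const)
    show "L ?\<eta>g q = L g q" by (rule L_cong[OF \<eta>g g B that]) (simp add: \<eta>B)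
  qed
  \<comment> \<open>Symmetry is available for test functions only, so \<open>\<eta>\<close> plays
    the role of the constant 1: it equals 1 where \<open>L ?\<psi>\<close> lives, and
    \<open>L \<eta>\<close> is 0 where \<open>?\<psi>\<close> lives.\<close>
  have i1: "(LINT q|\<mu>. L ?\<psi> q) = 0"
  proof -
    have "(LINT q|\<mu>. L ?\<psi> q) = (LINT q|\<mu>. \<eta> q * L ?\<psi> q)"
      using L0(2) \<eta>B KB by (intro Bochner_Integration.integral_cong refl) (metis mult.left_neutral mult_zero_right subsetD)
    also have "\<dots> = (LINT q|\<mu>. ?\<psi> q * L \<eta> q)" by (rule L_symmetric[OF tests(2,3)])
    also have "\<dots> = (LINT q|\<mu>. 0)"
    proof (intro Bochner_Integration.integral_cong refl)
      fix q show "?\<psi> q * L \<eta> q = 0"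
        using \<phi>K[of q] L\<eta>(1)[of q] KB by (cases "q \<in> K") auto
    qed
    finally show ?thesis by simp
  qed
  \<comment> \<open>Here \<open>g\<close>, which need not have compact support, is replaced by the
    test function \<open>\<eta> g\<close>, with which it agrees near the support of
    \<open>\<phi>\<close>.\<close>
  have i2: "(LINT q|\<mu>. \<phi> q * L g q) = (LINT q|\<mu>. g q * L \<phi> q)"
  proof -
    have "(LINT q|\<mu>. \<phi> q * L g q) = (LINT q|\<mu>. \<phi> q * L ?\<eta>g q)"
    proof (intro Bochner_Integration.integral_cong refl)
      fix q show "\<phi> q * L g q = \<phi> q * L ?\<eta>g q"
        using \<phi>K[of q] L\<eta>(2)[of q] KB by (cases "q \<in> K") auto
    qed
    also have "\<dots> = (LINT q|\<mu>. ?\<eta>g q * L \<phi> q)" by (rule L_symmetric[OF tests(1,4)])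
    also have "\<dots> = (LINT q|\<mu>. g q * L \<phi> q)"
    proof (intro Bochner_Integration.integral_cong refl)
      fix q show "?\<eta>g q * L \<phi> q = g q * L \<phi> q"
        using L0(1)[of q] \<eta>B[of q] KB by (cases "q \<in> K") auto
    qed
    finally show ?thesis .
  qed
  have Lg: "smooth A UNIV (L g)" and L\<phi>: "smooth A UNIV (L \<phi>)" and L\<psi>: "smooth A UNIV (L ?\<psi>)"
    using L_smooth g \<phi>(1) \<psi> by auto
  have Gam: "Gam M \<phi> g = (\<lambda>q. (L ?\<psi> q - \<phi> q * L g q - g q * L \<phi> q) / 2)"
    using L_mult[OF \<phi>(1) g] by (simp add: fun_eq_iff field_simps)
  have int: "integrable \<mu> F" if F: "smooth A UNIV F" "\<And>q. q \<in> - K \<Longrightarrow> F q = 0" for F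
  proof -
    have FU: "F q = 0" if "q \<notin> U" for q using F(2)[of q] that KB by (auto simp: B_def)
    have Fd: "dist (snd c q) x0 \<le> r" if "q \<in> U" "F q \<noteq> 0" for q
    proof -
      have "q \<in> K" using F(2)[of q] that(2) by auto
      then obtain x where x: "x \<in> cball x0 r" "q = chart_inv c x" by (auto simp: K_def)
      have "x \<in> snd c ` fst c" using x(1) sub U_chart by blast
      then have "snd c q = x" using chart_chart_inv[OF c] x(2) by simp
      then show ?thesis using x(1) by (simp add: dist_commute)
    qed
    have s: "smooth A U (\<lambda>q. dens q * F q)"
      using smooth_mult[OF dens_smooth smooth_subset[OF F(1)] open_U] by simp
    have C: "Cinf_on UNIV (pull (\<lambda>q. dens q * F q))"
      by (rule pull_Cinf[OF s _ sub]) (auto intro: Fd)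
    have "integrable lborel (pull (\<lambda>q. dens q * F q))"
    proof (rule integrable_compact_support[OF continuous_on_subset[OF Cinf_on_continuous_on[OF C] subset_UNIV] compact_cball])
      fix x assume x: "x \<notin> cball x0 r"
      show "pull (\<lambda>q. dens q * F q) x = 0"
      proof (cases "x \<in> snd c ` U")
        case True
        then obtain q where q: "q \<in> U" "x = snd c q" by blast
        then have "F q = 0" using Fd[OF q(1)] x by (auto simp: dist_commute)
        then show ?thesis using pull_eq[OF q(1)] q(2) by simp
      qed (simp add: pull_def)
    qed
    moreover have "F \<in> borel_measurable borel"
      using smooth_continuous_on[OF open_UNIV F(1)] by (rule borel_measurable_continuous_onI)
    ultimately show ?thesis using transfer(1)[of F, OF _ FU] by blast
  qed
  have n1: "integrable \<mu> (\<lambda>q. \<phi> q * L g q)" and n2: "integrable \<mu> (\<lambda>q. g q * L \<phi> q)" and n3: "integrable \<mu> (\<lambda>q. L ?\<psi> q)"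
    using int[OF smooth_mult[OF \<phi>(1) Lg open_UNIV]] int[OF smooth_mult[OF g L\<phi> open_UNIV]] int[OF L\<psi>]
      \<phi>K L0 by auto
  \<comment> \<open>Substituting the product identity for \<open>Gam\<close> leaves half of
    \<open>L\<close> of the product, whose integral is 0 by \<open>i1\<close>, and half the
    difference of the two integrals identified in \<open>i2\<close>.\<close>
  have "(LINT q|\<mu>. \<phi> q * L g q + Gam M \<phi> g q) = (LINT q|\<mu>. (\<phi> q * L g q - g q * L \<phi> q + L ?\<psi> q) / 2)"
    unfolding Gam by (intro Bochner_Integration.integral_cong refl) (simp add: field_simps)
  also have "\<dots> = 0"
    using n1 n2 n3 i1 i2 by simp
  finally have 0: "(LINT q|\<mu>. \<phi> q * L g q + Gam M \<phi> g q) = 0" .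
  have s: "smooth A UNIV (\<lambda>q. \<phi> q * L g q + Gam M \<phi> g q)"
  proof -
    have "(\<lambda>q. \<phi> q * L g q + Gam M \<phi> g q) = (\<lambda>q. (\<phi> q * L g q - g q * L \<phi> q + L ?\<psi> q) * (1/2))"
      unfolding Gam by (simp add: fun_eq_iff field_simps)
    then show ?thesis
      using smooth_mult[OF smooth_add[OF smooth_diff[OF smooth_mult[OF \<phi>(1) Lg] smooth_mult[OF g L\<phi>]] L\<psi>] smooth_const[of UNIV "1/2"]]
      by simp
  qed
  have m: "(\<lambda>q. \<phi> q * L g q + Gam M \<phi> g q) \<in> borel_measurable borel"
    using smooth_continuous_on[OF open_UNIV s] by (rule borel_measurable_continuous_onI)
  have z: "\<phi> q * L g q + Gam M \<phi> g q = 0" if "q \<notin> U" for q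
  proof -
    have "q \<in> - K" using that KB by (auto simp: B_def)
    then show ?thesis using \<phi>K[of q] L0[of q] by (simp add: Gam)
  qed
  show ?thesis using transfer(2)[of "\<lambda>q. \<phi> q * L g q + Gam M \<phi> g q", OF m z] 0 by simp
qed

end


context sub_lap_chart
begin

context
  fixes r assumes r: "0 < r" "cball x0 r \<subseteq> snd c ` U"
begin

definition supported :: "('m \<Rightarrow> real) \<Rightarrow> bool" where
  "supported F \<longleftrightarrow> smooth A U F \<and> (\<forall>q\<in>U. F q \<noteq> 0 \<longrightarrow> dist (snd c q) x0 \<le> r)"

lemma supported_Cinf: "supported F \<Longrightarrow> Cinf_on UNIV (pull F)"
  by (rule pull_Cinf[OF _ _ r(2)]) (auto simp: supported_def)

lemma supported_outside: "supported F \<Longrightarrow> x \<notin> cball x0 r \<Longrightarrow> pull F x = 0"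
  by (auto simp: supported_def pull_def inv_chart dist_commute)

lemma supported_integrable: "supported F \<Longrightarrow> integrable lborel (pull F)"
  by (rule integrable_compact_support[OF continuous_on_subset[OF Cinf_on_continuous_on[OF supported_Cinf] subset_UNIV] compact_cball])
     (auto intro: supported_outside)

lemma supported_dd:
  assumes W: "supported W"
  shows "supported (\<lambda>q. dd k q W)"
  unfolding supported_def
proof (intro conjI ballI impI)
  have sW: "smooth A U W" using W by (simp add: supported_def)
  show "smooth A U (\<lambda>q. dd k q W)"
    by (rule vfields_smooth[OF dd_vfields[OF subset_refl] open_U subset_refl sW])
  fix q assume q: "q \<in> U" "dd k q W \<noteq> 0"
  show "dist (snd c q) x0 \<le> r"
  proof (rule ccontr)
    assume "\<not> dist (snd c q) x0 \<le> r"
    then have q': "q \<in> U \<inter> snd c -` (- cball x0 r)" using q(1) by (simp add: dist_commute)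
    have o: "open (U \<inter> snd c -` (- cball x0 r))"
      by (rule continuous_open_preimage[OF continuous_on_subset[OF homeomorphism_cont1[OF chart_homeomorphism[OF c]] U_chart]
          open_U]) (simp add: open_Compl)
    have "dd k q W = dd k q (\<lambda>q. 0)"
      by (rule tangent_cong[OF dd_tangent[OF q(1)] o q']) (use W in \<open>auto simp: supported_def dist_commute\<close>)
    then show False using q(2) tangent_const[OF dd_tangent[OF q(1)]] by simp
  qed
qed

text \<open>In coordinates \<open>dd k\<close> is a partial derivative, and the pulled-back function
  is smooth with compact support. This turns coordinate divergences into null terms.\<close>

lemma integral_dd:
  assumes W: "supported W"
  shows "(LINT x|lborel. pull (\<lambda>q. dd k q W) x) = 0"
proof -
  have sW: "smooth A U W" using W by (simp add: supported_def)
  have C: "Cinf_on UNIV (pull W)" by (rule supported_Cinf[OF W])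
  have D: "(pull W has_derivative frechet_derivative (pull W) (at x)) (at x)" for x
    using Cinf_on_differentiable[OF C] by (simp add: frechet_derivative_works)
  have 0: "(LINT x|lborel. frechet_derivative (pull W) (at x) (axis k 1)) = 0"
    by (rule integral_directional_derivative_eq_0[OF D Cinf_on_continuous_on[OF Cinf_on_frechet_derivative[OF C]]
          compact_cball supported_outside[OF W]])
  have "pull (\<lambda>q. dd k q W) x = frechet_derivative (pull W) (at x) (axis k 1)" for x
  proof (cases "x \<in> snd c ` U")
    case True
    then obtain q where q: "q \<in> U" "x = snd c q" by blast
    have qc: "q \<in> fst c" using q U_chart by blast
    have n: "smooth_near A q W" by (rule near[OF q(1) sW])
    have "(pull W has_derivative frechet_derivative (\<lambda>x. W (chart_inv c x)) (at (snd c q))) (at (snd c q))"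
      by (rule has_derivative_transform_within_open[OF smooth_near_has_derivative[OF c qc n] open_range])
         (use q in \<open>auto simp: pull_def\<close>)
    from frechet_derivative_at[OF this] show ?thesis
      using pull_eq[OF q(1)] by (simp add: q(2) coord_field_def chart_deriv_apply[OF n])
  next
    case False
    then have x: "x \<in> - cball x0 r" using r(2) by auto
    have "((\<lambda>x. 0) has_derivative (\<lambda>v. 0)) (at x)" by simp
    then have "(pull W has_derivative (\<lambda>v. 0)) (at x)"
      by (rule has_derivative_transform_within_open[of _ _ _ _ "- cball x0 r"])
         (use x supported_outside[OF W] in \<open>auto simp: open_Compl\<close>)
    from frechet_derivative_at[OF this] show ?thesis using False by (simp add: pull_def fun_eq_iff)
  qed
  then show ?thesis using 0 by simp
qed

end

text \<open>The frame expression for \<open>L\<close>; unlike \<open>L\<close> itself it is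
  meaningful for functions that are smooth on \<open>U\<close> only, such as those arising in
  \<open>Lx_Z_commute\<close>.\<close>

definition Lx :: "('m \<Rightarrow> real) \<Rightarrow> 'm \<Rightarrow> real" where
  "Lx g q = (\<Sum>i<d. X i q (\<lambda>q. X i q g) + dvg i q * X i q g)"

lemma dvg_smooth: "i < d \<Longrightarrow> smooth A U (dvg i)"
  unfolding dvg_def[abs_def] by (intro smooth_minus smooth_sum open_U) (auto intro: structure_smooth)

lemma Lx_smooth:
  assumes g: "smooth A U g"
  shows "smooth A U (Lx g)"
  unfolding Lx_def[abs_def]
proof (rule smooth_sum[OF _ open_U])
  fix i assume "i \<in> {..<d}"
  then have i: "i < d" by simp
  show "smooth A U (\<lambda>q. X i q (\<lambda>q. X i q g) + dvg i q * X i q g)"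
    by (rule smooth_add[OF X_smooth[OF i X_smooth[OF i g]] smooth_mult[OF dvg_smooth[OF i] X_smooth[OF i g] open_U] open_U])
qed

text \<open>The fundamental lemma of the calculus of variations. If the difference \<open>e\<close>
  were nonzero at \<open>p0\<close>, a bump supported where \<open>e\<close> keeps its sign would
  give a nonnegative integrand with integral 0 that is positive at \<open>p0\<close>.\<close>

lemma L_eq_Lx_p0:
  assumes g: "smooth A UNIV g"
  shows "L g p0 = Lx g p0"
proof (rule ccontr)
  assume neq: "L g p0 \<noteq> Lx g p0"
  have gU: "smooth A U g" using smooth_subset[OF g] by simp
  define e where "e q = L g q - Lx g q" for q
  have e: "smooth A U e"
    unfolding e_def[abs_def] by (rule smooth_diff[OF smooth_subset[OF L_smooth[OF g] subset_UNIV] Lx_smooth[OF gU] open_U])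
  define s where "s = sgn (e p0)"
  have s: "0 < s * e p0" using neq by (simp add: s_def e_def sgn_if)
  define V where "V = {q \<in> U. 0 < s * e q}"
  have V: "open V" "p0 \<in> V" "V \<subseteq> U"
  proof -
    have "continuous_on U (\<lambda>q. s * e q)"
      using smooth_continuous_on[OF open_U e] by (intro continuous_intros)
    from continuous_open_preimage[OF this open_U open_greaterThan[of 0]]
    show "open V" by (simp add: V_def vimage_def Int_def)
  qed (use s p0 in \<open>auto simp: V_def\<close>)
  have "open (snd c ` V)" using open_chart_image[OF c V(1)] V(3) U_chart by (simp add: Int_absorb2)
  then obtain R where R: "0 < R" "cball x0 R \<subseteq> snd c ` V"
    using V(2) open_contains_cball[of "snd c ` V"] by blast
  have RU: "cball x0 R \<subseteq> snd c ` U" using R(2) V(3) by blast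
  \<comment> \<open>\<open>\<phi>\<close> is supported within radius \<open>r\<close>; the gap to
    \<open>R\<close> leaves room for the second cutoff in \<open>integral_L_by_parts\<close>, and
    \<open>r / 2\<close> is the radius of the region where \<open>\<phi>\<close> equals 1.\<close>
  define r where "r = R / 2"
  have r: "0 < r" "r < R" "0 < r / 2" "r / 2 < r" using R by (auto simp: r_def)
  have rU: "cball x0 r \<subseteq> snd c ` U" and rV: "cball x0 r \<subseteq> snd c ` V"
    using RU R(2) r(2) by (auto simp: subset_iff)
  obtain \<phi> where \<phi>: "smooth A UNIV \<phi>" "\<And>q. 0 \<le> \<phi> q"
    "\<And>q. q \<in> U \<Longrightarrow> dist (snd c q) x0 \<le> r / 2 \<Longrightarrow> \<phi> q = 1"
    "\<And>q. \<phi> q \<noteq> 0 \<Longrightarrow> q \<in> U \<and> dist (snd c q) x0 < r" "compact (closure {q. \<phi> q \<noteq> 0})"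
    by (rule chart_bump[OF c open_U U_chart r(3,4) rU], rule that)
  have \<phi>U: "smooth A U \<phi>" using smooth_subset[OF \<phi>(1)] by simp
  define u where "u i q = \<phi> q * X i q g" for i q
  \<comment> \<open>The components of the field \<open>\<phi> * hgrad M g\<close>, split over the
    frame and weighted by the density; their coordinate divergence produces
    \<open>Gam M \<phi> g\<close> and \<open>\<phi> * Lx g\<close> at once.\<close>
  define W where "W i k q = dens q * X i q (crd k) * u i q" for i k q
  note sup = supported_def[OF r(1) rU]
  have u: "smooth A U (u i)" if "i < d" for i
    unfolding u_def[abs_def] by (rule smooth_mult[OF \<phi>U X_smooth[OF that gU] open_U])
  have W: "supported r (W i k)" if i: "i < d" for i k
  proof -
    have "smooth A U (W i k)"
      unfolding W_def[abs_def]
      by (rule smooth_mult[OF smooth_mult[OF dens_smooth X_smooth[OF i crd_smooth[OF subset_refl]] open_U] u[OF i] open_U])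
    moreover have "dist (snd c q) x0 \<le> r" if "W i k q \<noteq> 0" for q
      using \<phi>(4)[of q] that by (auto simp: W_def u_def)
    ultimately show ?thesis by (simp add: sup)
  qed
  have int0: "(LINT x|lborel. pull (\<lambda>q. dens q * (\<phi> q * L g q + Gam M \<phi> g q)) x) = 0"
    by (rule integral_L_by_parts[OF r(1,2) RU \<phi>(1) _ \<phi>(5) g]) (use \<phi>(4) in force)
  \<comment> \<open>The integrand of \<open>int0\<close> differs from the \<open>e\<close>-term by
    coordinate divergences alone, which integrate to 0.\<close>
  have key: "dens q * (\<phi> q * L g q + Gam M \<phi> g q) = dens q * (\<phi> q * e q) + (\<Sum>i<d. \<Sum>k\<in>UNIV. dd k q (W i k))"
    if q: "q \<in> U" for q
  proof -
    have "(\<Sum>k\<in>UNIV. dd k q (W i k)) = dens q * (X i q \<phi> * X i q g + \<phi> q * (X i q (\<lambda>q. X i q g) + dvg i q * X i q g))"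
      if i: "i < d" for i
    proof -
      have t: "X i q \<in> tangent_space A q" using X_hor[OF i q] hor_tangent by blast
      have "X i q (u i) = X i q \<phi> * X i q g + \<phi> q * X i q (\<lambda>q. X i q g)"
        unfolding u_def[abs_def] by (rule tangent_mult[OF t near[OF q \<phi>U] near[OF q X_smooth[OF i gU]]])
      moreover have "(\<Sum>k\<in>UNIV. dd k q (W i k)) = dens q * (X i q (u i) + dvg i q * u i q)"
        unfolding W_def[abs_def] by (rule divergence[OF open_U subset_refl q i u[OF i]])
      ultimately show ?thesis by (simp add: u_def algebra_simps)
    qed
    then have "(\<Sum>i<d. \<Sum>k\<in>UNIV. dd k q (W i k)) = dens q * (Gam M \<phi> g q + \<phi> q * Lx g q)"
      by (simp add: Gam_frame[OF q] Lx_def sum_distrib_left sum.distrib algebra_simps)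
    then show ?thesis by (simp add: e_def algebra_simps)
  qed
  define G where "G q = s * (dens q * (\<phi> q * e q))" for q
  have G: "supported r G"
  proof -
    have "smooth A U G" unfolding G_def[abs_def]
      by (rule smooth_mult[OF smooth_const smooth_mult[OF dens_smooth smooth_mult[OF \<phi>U e open_U] open_U] open_U])
    moreover have "dist (snd c q) x0 \<le> r" if "G q \<noteq> 0" for q
      using \<phi>(4)[of q] that by (auto simp: G_def)
    ultimately show ?thesis by (simp add: sup)
  qed
  have F: "supported r (\<lambda>q. dens q * (\<phi> q * L g q + Gam M \<phi> g q))"
    unfolding sup
  proof (intro conjI ballI impI)
    have "smooth A U (Gam M \<phi> g)"
      using smooth_cong[OF open_U, of "Gam M \<phi> g" "\<lambda>q. \<Sum>i<d. X i q \<phi> * X i q g"] Gam_frame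
        smooth_sum[of "{..<d}" U "\<lambda>i q. X i q \<phi> * X i q g", OF _ open_U]
        smooth_mult[OF X_smooth[OF _ \<phi>U] X_smooth[OF _ gU] open_U] by simp
    then show "smooth A U (\<lambda>q. dens q * (\<phi> q * L g q + Gam M \<phi> g q))"
      using smooth_mult[OF dens_smooth smooth_add[OF smooth_mult[OF \<phi>U smooth_subset[OF L_smooth[OF g] subset_UNIV] open_U] _ open_U] open_U]
      by blast
    fix q assume q: "q \<in> U" "dens q * (\<phi> q * L g q + Gam M \<phi> g q) \<noteq> 0"
    show "dist (snd c q) x0 \<le> r"
    proof (rule ccontr)
      assume far: "\<not> dist (snd c q) x0 \<le> r"
      have o: "open (U \<inter> snd c -` (- cball x0 r))"
        by (rule continuous_open_preimage[OF continuous_on_subset[OF homeomorphism_cont1[OF chart_homeomorphism[OF c]] U_chart]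
            open_U]) (simp add: open_Compl)
      have z: "\<phi> q' = 0" if "q' \<in> U \<inter> snd c -` (- cball x0 r)" for q'
        using that \<phi>(4)[of q'] by (auto simp: dist_commute)
      have q': "q \<in> U \<inter> snd c -` (- cball x0 r)" using q(1) far by (simp add: dist_commute)
      have "Gam M \<phi> g q = 0" by (rule Gam_locally_const(1)[OF o q' z])
      with q(2) z[OF q'] show False by simp
    qed
  qed
  note dW = supported_dd[OF r(1) rU W]
  have "pull G x = s * (pull (\<lambda>q. dens q * (\<phi> q * L g q + Gam M \<phi> g q)) x
      - (\<Sum>i<d. \<Sum>k\<in>UNIV. pull (\<lambda>q. dd k q (W i k)) x))" for x
  proof (cases "x \<in> snd c ` U")
    case True
    then obtain q where q: "q \<in> U" "x = snd c q" by blast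
    show ?thesis unfolding q(2) pull_eq[OF q(1)] key[OF q(1)] by (simp add: G_def)
  qed (simp add: pull_def)
  then have "(LINT x|lborel. pull G x) = (LINT x|lborel. s * (pull (\<lambda>q. dens q * (\<phi> q * L g q + Gam M \<phi> g q)) x
      - (\<Sum>i<d. \<Sum>k\<in>UNIV. pull (\<lambda>q. dd k q (W i k)) x)))" by simp
  also have "\<dots> = s * ((LINT x|lborel. pull (\<lambda>q. dens q * (\<phi> q * L g q + Gam M \<phi> g q)) x)
      - (\<Sum>i<d. \<Sum>k\<in>UNIV. (LINT x|lborel. pull (\<lambda>q. dd k q (W i k)) x)))"
  proof -
    note iF = supported_integrable[OF r(1) rU F]
    have iW: "integrable lborel (pull (\<lambda>q. dd k q (W i k)))" if "i < d" for i k
      by (rule supported_integrable[OF r(1) rU dW[OF that]])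
    have iS: "integrable lborel (\<lambda>x. \<Sum>k\<in>UNIV. pull (\<lambda>q. dd k q (W i k)) x)" if "i < d" for i
      using iW[OF that] by (intro Bochner_Integration.integrable_sum) auto
    have "(LINT x|lborel. (\<Sum>i<d. \<Sum>k\<in>UNIV. pull (\<lambda>q. dd k q (W i k)) x))
        = (\<Sum>i<d. (LINT x|lborel. (\<Sum>k\<in>UNIV. pull (\<lambda>q. dd k q (W i k)) x)))"
      by (rule Bochner_Integration.integral_sum) (use iS in simp)
    also have "\<dots> = (\<Sum>i<d. \<Sum>k\<in>UNIV. (LINT x|lborel. pull (\<lambda>q. dd k q (W i k)) x))"
      by (intro sum.cong refl Bochner_Integration.integral_sum) (use iW in simp)
    finally have "(LINT x|lborel. (\<Sum>i<d. \<Sum>k\<in>UNIV. pull (\<lambda>q. dd k q (W i k)) x))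
        = (\<Sum>i<d. \<Sum>k\<in>UNIV. (LINT x|lborel. pull (\<lambda>q. dd k q (W i k)) x))" .
    moreover have "integrable lborel (\<lambda>x. \<Sum>i<d. \<Sum>k\<in>UNIV. pull (\<lambda>q. dd k q (W i k)) x)"
      by (rule Bochner_Integration.integrable_sum) (use iS in simp)
    ultimately show ?thesis using iF by simp
  qed
  also have "\<dots> = 0" using int0 integral_dd[OF r(1) rU W] by simp
  finally have intG: "(LINT x|lborel. pull G x) = 0" .
  have nn: "0 \<le> pull G x" for x
  proof (cases "x \<in> snd c ` U")
    case True
    then obtain q where q: "q \<in> U" "x = snd c q" by blast
    have "0 \<le> G q"
    proof (cases "\<phi> q = 0")
      case False
      then have "snd c q \<in> cball x0 r" using \<phi>(4)[OF False] by (simp add: dist_commute)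
      then obtain q' where q': "q' \<in> V" "snd c q = snd c q'" using rV by blast
      then have "q = q'" using inv_chart[OF q(1)] inv_chart[of q'] V(3) by auto
      then have "0 < s * e q" using q' by (simp add: V_def)
      then have "0 \<le> dens q * \<phi> q * (s * e q)"
        using dens_pos[OF q(1)] \<phi>(2)[of q] by (simp only: mult_nonneg_nonneg less_imp_le)
      then show ?thesis by (simp add: G_def algebra_simps)
    qed (simp add: G_def)
    then show ?thesis using pull_eq[OF q(1)] q(2) by simp
  qed (simp add: pull_def)
  have "pull G x0 = 0"
    by (rule integral_eq_0_imp_eq_0[OF Cinf_on_continuous_on[OF supported_Cinf[OF r(1) rU G]] nn compact_cball
          supported_outside[OF r(1) rU G] intG])
  then have "s * (dens p0 * (\<phi> p0 * e p0)) = 0" using pull_eq[OF p0, of G] by (simp add: G_def)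
  moreover have "\<phi> p0 = 1" using \<phi>(3)[OF p0] r by simp
  ultimately show False using s dens_pos[OF p0] by auto
qed

end


section \<open>The canonical connection\<close>

locale connection = subriemannian M d h
  for M :: "('m::{t2_space,second_countable_topology}, 'n::finite) subriem" and d h +
  fixes D :: "'m connection"
  assumes canonical_connection: "canonical_connection M D"
begin

lemma affine: "affine_connection A D"
  using canonical_connection by (simp add: canonical_connection_def)

abbreviation "T \<equiv> torsion A D"
abbreviation "Rc \<equiv> curvature A D"
abbreviation "DT \<equiv> deriv_torsion A D"

lemma T_apply: "T X Y p = D X Y p - D Y X p - lie_bracket A X Y p"
  by (simp add: torsion_def)

lemma T_swap: "T Y X = - T X Y"
  using lie_bracket_swap[of X Y] by (intro ext) (simp add: torsion_def)

context
  fixes V :: "'m set" assumes V: "open V"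
begin

lemmas affineV = affine[unfolded affine_connection_def, rule_format, OF V]

lemma D_vfields: "X \<in> vfields A V \<Longrightarrow> Y \<in> vfields A V \<Longrightarrow> D X Y \<in> vfields A V"
  using affineV by (rule conjunct1)

lemma D_tensorial: "Y \<in> vfields A V \<Longrightarrow> p \<in> V \<Longrightarrow> tensorial V p (\<lambda>X. D X Y p)"
proof (rule tensorialI)
  assume Y: "Y \<in> vfields A V" and p: "p \<in> V"
  fix X assume X: "X \<in> vfields A V"
  note a = affineV[OF X Y, THEN conjunct2]
  show "D (X + X') Y p = D X Y p + D X' Y p" if "X' \<in> vfields A V" for X'
    using a[THEN conjunct1] that p by blast
  show "D (fscale \<phi> X) Y p = \<phi> p *\<^sub>R D X Y p" if "smooth A V \<phi>" for \<phi>
    using a[THEN conjunct2, THEN conjunct2] that p by blast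
qed

lemma D_add_right:
  assumes "X \<in> vfields A V" "Y \<in> vfields A V" "Y' \<in> vfields A V" "p \<in> V"
  shows "D X (Y + Y') p = D X Y p + D X Y' p"
  using affineV[OF assms(1,2), THEN conjunct2, THEN conjunct2, THEN conjunct1] assms(3,4) by blast

lemma D_fscale_right:
  assumes "X \<in> vfields A V" "Y \<in> vfields A V" "smooth A V \<phi>" "p \<in> V"
  shows "D X (fscale \<phi> Y) p = X p \<phi> *\<^sub>R Y p + \<phi> p *\<^sub>R D X Y p"
  using affineV[OF assms(1,2), THEN conjunct2, THEN conjunct2, THEN conjunct2] assms(3,4) by blast

lemma D_uminus_right:
  assumes "X \<in> vfields A V" "Y \<in> vfields A V" "p \<in> V"
  shows "D X (- Y) p = - D X Y p"
  using D_fscale_right[OF assms(1,2) smooth_const assms(3), of "-1"]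
    tangent_const[OF vfields_tangent[OF assms(1,3)]] by (simp add: fscale_uminus)

text \<open>\<open>D\<close> is not tensorial in its second argument, but the Leibniz rule applied
  to the indicator of the complement of \<open>V\<close> suffices: the indicator and its derivative
  both vanish at \<open>p\<close>.\<close>

lemma D_cong_right:
  assumes X: "X \<in> vfields A V" and Y: "Y \<in> vfields A V" "Y' \<in> vfields A V" and p: "p \<in> V"
    and eq: "\<And>q. q \<in> V \<Longrightarrow> Y q = Y' q"
  shows "D X Y p = D X Y' p"
proof -
  let ?i = "\<lambda>q. if q \<in> V then 0 else 1 :: real"
  have s: "smooth A V ?i" using smooth_cong[of V ?i "\<lambda>q. 0"] V by simp
  have v: "Y - Y' \<in> vfields A V" by (rule vfields_diff[OF Y])
  have "X p ?i = X p (\<lambda>q. 0)" by (rule tangent_cong[OF vfields_tangent[OF X p] V p]) simp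
  then have i0: "X p ?i = 0" using tangent_const[OF vfields_tangent[OF X p]] by simp
  have e: "Y = Y' + fscale ?i (Y - Y')"
  proof
    fix q show "Y q = (Y' + fscale ?i (Y - Y')) q" using eq[of q] by (cases "q \<in> V") auto
  qed
  have "D X Y p = D X (Y' + fscale ?i (Y - Y')) p" by (rule arg_cong[where f="\<lambda>Y. D X Y p", OF e])
  also have "\<dots> = D X Y' p + D X (fscale ?i (Y - Y')) p"
    by (rule D_add_right[OF X Y(2) vfields_fscale[OF v s] p])
  also have "D X (fscale ?i (Y - Y')) p = 0"
    unfolding D_fscale_right[OF X v s p] i0 using p by simp
  finally show ?thesis by simp
qed

lemma D_combination_right:
  assumes X: "X \<in> vfields A V" and p: "p \<in> V" and "finite I"
    and \<phi>: "\<And>i. i \<in> I \<Longrightarrow> smooth A V (\<phi> i)" and E: "\<And>i. i \<in> I \<Longrightarrow> E i \<in> vfields A V"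
    and Y: "\<And>q. q \<in> V \<Longrightarrow> Y q = (\<Sum>i\<in>I. \<phi> i q *\<^sub>R E i q)"
  shows "D X Y p = (\<Sum>i\<in>I. X p (\<phi> i) *\<^sub>R E i p + \<phi> i p *\<^sub>R D X (E i) p)"
proof -
  have "D X (\<Sum>i\<in>J. fscale (\<phi> i) (E i)) p = (\<Sum>i\<in>J. X p (\<phi> i) *\<^sub>R E i p + \<phi> i p *\<^sub>R D X (E i) p)"
    if "J \<subseteq> I" for J
    using finite_subset[OF that \<open>finite I\<close>] that
  proof induction
    case empty
    have "fscale (\<lambda>q. 0) 0 = (0 :: 'm vfield)" by (simp add: fscale_def zero_fun_def)
    then have "D X 0 p = 0"
      using D_fscale_right[OF X vfields_zero smooth_const p, of 0] tangent_const[OF vfields_tangent[OF X p]]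
      by simp
    then show ?case unfolding sum.empty .
  next
    case (insert j J)
    then have S: "(\<Sum>i\<in>J. fscale (\<phi> i) (E i)) \<in> vfields A V" and j: "smooth A V (\<phi> j)" "E j \<in> vfields A V"
      and J: "J \<subseteq> I"
      using \<phi> E by (auto intro!: vfields_sum vfields_fscale)
    show ?case
      unfolding sum.insert[OF insert(1,2)] D_add_right[OF X vfields_fscale[OF j(2,1)] S p]
        D_fscale_right[OF X j(2,1) p] insert.IH[OF J] ..
  qed
  from this[OF subset_refl] show ?thesis
    using D_cong_right[OF X vfields_combination[OF V \<phi> E Y] _ p, of "\<Sum>i\<in>I. fscale (\<phi> i) (E i)"] Y
      vfields_sum[of I "\<lambda>i. fscale (\<phi> i) (E i)" V] vfields_fscale[OF E \<phi>]
    by (simp add: sum_fun_apply)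
qed

lemma D_cong_left:
  assumes "X \<in> vfields A V" "X' \<in> vfields A V" "Y \<in> vfields A V" "p \<in> V" "\<And>q. q \<in> V \<Longrightarrow> X q = X' q"
  shows "D X Y p = D X' Y p"
  by (rule tensorial_cong[OF D_tensorial[OF assms(3,4)] V assms(4,1,2,5)])

text \<open>The derivative of \<open>\<phi>\<close> along \<open>Y\<close> appears once from the
  Leibniz rule in the second argument of \<open>D\<close> and once from the bracket, with opposite
  signs.\<close>

lemma T_tensorial_left: "Y \<in> vfields A V \<Longrightarrow> p \<in> V \<Longrightarrow> tensorial V p (\<lambda>X. T X Y p)"
proof (rule tensorialI)
  assume Y: "Y \<in> vfields A V" and p: "p \<in> V"
  fix X assume X: "X \<in> vfields A V"
  show "T (X + X') Y p = T X Y p + T X' Y p" if X': "X' \<in> vfields A V" for X'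
    unfolding T_apply tensorial_add[OF D_tensorial[OF Y p] X X'] D_add_right[OF Y X X' p]
      lie_bracket_add_left[OF V p X X' Y] by simp
  show "T (fscale \<phi> X) Y p = \<phi> p *\<^sub>R T X Y p" if \<phi>: "smooth A V \<phi>" for \<phi>
    unfolding T_apply tensorial_fscale[OF D_tensorial[OF Y p] X \<phi>] D_fscale_right[OF Y X \<phi> p]
      lie_bracket_fscale_left[OF V p X Y \<phi>] by (simp add: algebra_simps)
qed

lemma tensorial_uminus: "tensorial V p \<Phi> \<Longrightarrow> tensorial V p (\<lambda>X. - \<Phi> X)"
  by (simp add: tensorial_def)

lemma T_tensorial_right:
  assumes "X \<in> vfields A V" "p \<in> V"
  shows "tensorial V p (\<lambda>Y. T X Y p)"
  using tensorial_uminus[OF T_tensorial_left[OF assms]] T_swap[of X] by (simp add: fun_Compl_def)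

end

end

section \<open>Tensoriality of the derivative of torsion and of the curvature\<close>

locale connection_chart = connection M d h D + adapted_chart M d h U X Z \<omega> \<gamma> \<delta> c p0
  for M :: "('m::{t2_space,second_countable_topology}, 'n::finite) subriem" and d h D U X Z \<omega> \<gamma> \<delta> c p0
begin

abbreviation "VF \<equiv> vfields A U"

lemmas Dv = D_vfields[OF open_U]
lemmas Bv = lie_bracket_vfields[OF _ _ open_U subset_refl]

lemma Tv: "Y \<in> VF \<Longrightarrow> W \<in> VF \<Longrightarrow> T Y W \<in> VF"
  unfolding torsion_def by (intro vfields_diff Dv Bv)

text \<open>The rules for \<open>D\<close> hold only at points of \<open>U\<close>, so the fields
  involved need not be equal as total functions. Substitution inside \<open>T\<close> therefore
  passes through \<open>tensorial_cong\<close>, and in the lemmas below substitution inside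
  \<open>D\<close> through \<open>D_cong_right\<close> and \<open>D_cong_left\<close>.\<close>

lemma DT_tensorial1:
  assumes Y: "Y \<in> VF" and W: "W \<in> VF" and p: "p \<in> U"
  shows "tensorial U p (\<lambda>V. DT V Y W p)"
proof (rule tensorialI)
  note t1 = T_tensorial_left[OF open_U W p] and t2 = T_tensorial_right[OF open_U Y p]
    and t3 = D_tensorial[OF open_U Tv[OF Y W] p]
  fix V assume V: "V \<in> VF"
  show "DT (V + V') Y W p = DT V Y W p + DT V' Y W p" if V': "V' \<in> VF" for V'
  proof -
    have "T (D (V + V') Y) W p = T (D V Y + D V' Y) W p"
      by (rule tensorial_cong[OF t1 open_U p Dv[OF vfields_add[OF V V'] Y] vfields_add[OF Dv[OF V Y] Dv[OF V' Y]]])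
         (simp add: tensorial_add[OF D_tensorial[OF open_U Y] V V'])
    moreover have "T Y (D (V + V') W) p = T Y (D V W + D V' W) p"
      by (rule tensorial_cong[OF t2 open_U p Dv[OF vfields_add[OF V V'] W] vfields_add[OF Dv[OF V W] Dv[OF V' W]]])
         (simp add: tensorial_add[OF D_tensorial[OF open_U W] V V'])
    ultimately show ?thesis
      using tensorial_add[OF t1 Dv[OF V Y] Dv[OF V' Y]] tensorial_add[OF t2 Dv[OF V W] Dv[OF V' W]]
        tensorial_add[OF t3 V V']
      by (simp add: deriv_torsion_def)
  qed
  show "DT (fscale \<phi> V) Y W p = \<phi> p *\<^sub>R DT V Y W p" if \<phi>: "smooth A U \<phi>" for \<phi>
  proof -
    have "T (D (fscale \<phi> V) Y) W p = T (fscale \<phi> (D V Y)) W p"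
      by (rule tensorial_cong[OF t1 open_U p Dv[OF vfields_fscale[OF V \<phi>] Y] vfields_fscale[OF Dv[OF V Y] \<phi>]])
         (simp add: tensorial_fscale[OF D_tensorial[OF open_U Y] V \<phi>])
    moreover have "T Y (D (fscale \<phi> V) W) p = T Y (fscale \<phi> (D V W)) p"
      by (rule tensorial_cong[OF t2 open_U p Dv[OF vfields_fscale[OF V \<phi>] W] vfields_fscale[OF Dv[OF V W] \<phi>]])
         (simp add: tensorial_fscale[OF D_tensorial[OF open_U W] V \<phi>])
    ultimately show ?thesis
      using tensorial_fscale[OF t1 Dv[OF V Y] \<phi>] tensorial_fscale[OF t2 Dv[OF V W] \<phi>]
        tensorial_fscale[OF t3 V \<phi>]
      by (simp add: deriv_torsion_def algebra_simps)
  qed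
qed

text \<open>Differentiating \<open>T (fscale \<phi> Y) W\<close> creates the term
  \<open>V p \<phi> *\<^sub>R T Y W p\<close>, and \<open>T (D V (fscale \<phi> Y)) W\<close>
  creates it again, to be subtracted.\<close>

lemma DT_tensorial2:
  assumes V: "V \<in> VF" and W: "W \<in> VF" and p: "p \<in> U"
  shows "tensorial U p (\<lambda>Y. DT V Y W p)"
proof (rule tensorialI)
  note t1 = T_tensorial_left[OF open_U W] and t2 = T_tensorial_left[OF open_U Dv[OF V W] p]
  fix Y assume Y: "Y \<in> VF"
  show "DT V (Y + Y') W p = DT V Y W p + DT V Y' W p" if Y': "Y' \<in> VF" for Y'
  proof -
    have "D V (T (Y + Y') W) p = D V (T Y W + T Y' W) p"
      by (rule D_cong_right[OF open_U V Tv[OF vfields_add[OF Y Y'] W] vfields_add[OF Tv[OF Y W] Tv[OF Y' W]] p])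
         (simp add: tensorial_add[OF t1 Y Y'])
    moreover have "T (D V (Y + Y')) W p = T (D V Y + D V Y') W p"
      by (rule tensorial_cong[OF t1[OF p] open_U p Dv[OF V vfields_add[OF Y Y']] vfields_add[OF Dv[OF V Y] Dv[OF V Y']]])
         (simp add: D_add_right[OF open_U V Y Y'])
    ultimately show ?thesis
      using D_add_right[OF open_U V Tv[OF Y W] Tv[OF Y' W] p] tensorial_add[OF t1[OF p] Dv[OF V Y] Dv[OF V Y']]
        tensorial_add[OF t2 Y Y']
      by (simp add: deriv_torsion_def)
  qed
  show "DT V (fscale \<phi> Y) W p = \<phi> p *\<^sub>R DT V Y W p" if \<phi>: "smooth A U \<phi>" for \<phi>
  proof -
    have sV: "smooth A U (\<lambda>q. V q \<phi>)" by (rule vfields_smooth[OF V open_U subset_refl \<phi>])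
    have "D V (T (fscale \<phi> Y) W) p = D V (fscale \<phi> (T Y W)) p"
      by (rule D_cong_right[OF open_U V Tv[OF vfields_fscale[OF Y \<phi>] W] vfields_fscale[OF Tv[OF Y W] \<phi>] p])
         (simp add: tensorial_fscale[OF t1 Y \<phi>])
    moreover have "T (D V (fscale \<phi> Y)) W p = T (fscale (\<lambda>q. V q \<phi>) Y + fscale \<phi> (D V Y)) W p"
      by (rule tensorial_cong[OF t1[OF p] open_U p Dv[OF V vfields_fscale[OF Y \<phi>]]
            vfields_add[OF vfields_fscale[OF Y sV] vfields_fscale[OF Dv[OF V Y] \<phi>]]])
         (simp add: D_fscale_right[OF open_U V Y \<phi>])
    ultimately show ?thesis
      using D_fscale_right[OF open_U V Tv[OF Y W] \<phi> p]
        tensorial_add[OF t1[OF p] vfields_fscale[OF Y sV] vfields_fscale[OF Dv[OF V Y] \<phi>]]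
        tensorial_fscale[OF t1[OF p] Y sV] tensorial_fscale[OF t1[OF p] Dv[OF V Y] \<phi>] tensorial_fscale[OF t2 Y \<phi>]
      by (simp add: deriv_torsion_def algebra_simps)
  qed
qed

lemma DT_swap:
  assumes V: "V \<in> VF" and Y: "Y \<in> VF" and W: "W \<in> VF" and p: "p \<in> U"
  shows "DT V Y W p = - DT V W Y p"
  using D_uminus_right[OF open_U V Tv[OF Y W] p] T_swap[of Y W] T_swap[of "D V Y" W] T_swap[of Y "D V W"]
  by (simp add: deriv_torsion_def)

lemma DT_tensorial3:
  assumes V: "V \<in> VF" and Y: "Y \<in> VF" and p: "p \<in> U"
  shows "tensorial U p (\<lambda>W. DT V Y W p)"
proof (rule tensorialI)
  note t = DT_tensorial2[OF V Y p]
  fix W assume W: "W \<in> VF"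
  show "DT V Y (W + W') p = DT V Y W p + DT V Y W' p" if W': "W' \<in> VF" for W'
    unfolding DT_swap[OF V Y vfields_add[OF W W'] p] DT_swap[OF V Y W p] DT_swap[OF V Y W' p]
      tensorial_add[OF t W W'] by simp
  show "DT V Y (fscale \<phi> W) p = \<phi> p *\<^sub>R DT V Y W p" if \<phi>: "smooth A U \<phi>" for \<phi>
    unfolding DT_swap[OF V Y vfields_fscale[OF W \<phi>] p] DT_swap[OF V Y W p]
      tensorial_fscale[OF t W \<phi>] by simp
qed

text \<open>The derivative of \<open>\<phi>\<close> along \<open>Y\<close> enters through the
  iterated connection term and through the bracket, and cancels.\<close>

lemma Rc_tensorial1:
  assumes Y: "Y \<in> VF" and W: "W \<in> VF" and p: "p \<in> U"
  shows "tensorial U p (\<lambda>V. Rc V Y W p)"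
proof (rule tensorialI)
  note t1 = D_tensorial[OF open_U Dv[OF Y W] p] and t2 = D_tensorial[OF open_U W]
  fix V assume V: "V \<in> VF"
  show "Rc (V + V') Y W p = Rc V Y W p + Rc V' Y W p" if V': "V' \<in> VF" for V'
  proof -
    have "D Y (D (V + V') W) p = D Y (D V W + D V' W) p"
      by (rule D_cong_right[OF open_U Y Dv[OF vfields_add[OF V V'] W] vfields_add[OF Dv[OF V W] Dv[OF V' W]] p])
         (simp add: tensorial_add[OF t2 V V'])
    moreover have "D (lie_bracket A (V + V') Y) W p = D (lie_bracket A V Y + lie_bracket A V' Y) W p"
      by (rule D_cong_left[OF open_U Bv[OF vfields_add[OF V V'] Y] vfields_add[OF Bv[OF V Y] Bv[OF V' Y]] W p])
         (simp add: lie_bracket_add_left[OF open_U _ V V' Y])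
    ultimately show ?thesis
      using tensorial_add[OF t1 V V'] D_add_right[OF open_U Y Dv[OF V W] Dv[OF V' W] p]
        tensorial_add[OF t2[OF p] Bv[OF V Y] Bv[OF V' Y]]
      by (simp add: curvature_def)
  qed
  show "Rc (fscale \<phi> V) Y W p = \<phi> p *\<^sub>R Rc V Y W p" if \<phi>: "smooth A U \<phi>" for \<phi>
  proof -
    have sY: "smooth A U (\<lambda>q. Y q \<phi>)" by (rule vfields_smooth[OF Y open_U subset_refl \<phi>])
    have "D Y (D (fscale \<phi> V) W) p = D Y (fscale \<phi> (D V W)) p"
      by (rule D_cong_right[OF open_U Y Dv[OF vfields_fscale[OF V \<phi>] W] vfields_fscale[OF Dv[OF V W] \<phi>] p])
         (simp add: tensorial_fscale[OF t2 V \<phi>])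
    moreover have "D (lie_bracket A (fscale \<phi> V) Y) W p = D (fscale \<phi> (lie_bracket A V Y) + - fscale (\<lambda>q. Y q \<phi>) V) W p"
      by (rule D_cong_left[OF open_U Bv[OF vfields_fscale[OF V \<phi>] Y]
            vfields_add[OF vfields_fscale[OF Bv[OF V Y] \<phi>] vfields_uminus[OF vfields_fscale[OF V sY]]] W p])
         (simp add: lie_bracket_fscale_left[OF open_U _ V Y \<phi>])
    moreover have "D (- fscale (\<lambda>q. Y q \<phi>) V) W p = - D (fscale (\<lambda>q. Y q \<phi>) V) W p"
      using tensorial_fscale[OF t2[OF p] vfields_fscale[OF V sY] smooth_const, of "-1"] by (simp add: fscale_uminus)
    ultimately show ?thesis
      using tensorial_fscale[OF t1 V \<phi>] D_fscale_right[OF open_U Y Dv[OF V W] \<phi> p]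
        tensorial_add[OF t2[OF p] vfields_fscale[OF Bv[OF V Y] \<phi>] vfields_uminus[OF vfields_fscale[OF V sY]]]
        tensorial_fscale[OF t2[OF p] Bv[OF V Y] \<phi>] tensorial_fscale[OF t2[OF p] V sY]
      by (simp add: curvature_def algebra_simps)
  qed
qed

lemma Rc_swap:
  assumes V: "V \<in> VF" and Y: "Y \<in> VF" and W: "W \<in> VF" and p: "p \<in> U"
  shows "Rc V Y W p = - Rc Y V W p"
proof -
  have "lie_bracket A V Y = fscale (\<lambda>q. -1) (lie_bracket A Y V)"
    using lie_bracket_swap[of V Y] by (intro ext) (simp add: fscale_def)
  then have "D (lie_bracket A V Y) W p = - D (lie_bracket A Y V) W p"
    using tensorial_fscale[OF D_tensorial[OF open_U W p] Bv[OF Y V] smooth_const, of "-1"] by simp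
  then show ?thesis by (simp add: curvature_def)
qed

lemma Rc_tensorial2:
  assumes V: "V \<in> VF" and W: "W \<in> VF" and p: "p \<in> U"
  shows "tensorial U p (\<lambda>Y. Rc V Y W p)"
proof (rule tensorialI)
  note t = Rc_tensorial1[OF V W p]
  fix Y assume Y: "Y \<in> VF"
  show "Rc V (Y + Y') W p = Rc V Y W p + Rc V Y' W p" if Y': "Y' \<in> VF" for Y'
    unfolding Rc_swap[OF V vfields_add[OF Y Y'] W p] Rc_swap[OF V Y W p] Rc_swap[OF V Y' W p]
      tensorial_add[OF t Y Y'] by simp
  show "Rc V (fscale \<phi> Y) W p = \<phi> p *\<^sub>R Rc V Y W p" if \<phi>: "smooth A U \<phi>" for \<phi>
    unfolding Rc_swap[OF V vfields_fscale[OF Y \<phi>] W p] Rc_swap[OF V Y W p]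
      tensorial_fscale[OF t Y \<phi>] by simp
qed

text \<open>The mixed first-derivative terms are symmetric in the two directions and cancel; the
  second derivatives of \<open>\<phi>\<close> leave a commutator, which the bracket term
  removes.\<close>

lemma Rc_tensorial3:
  assumes V: "V \<in> VF" and Y: "Y \<in> VF" and p: "p \<in> U"
  shows "tensorial U p (\<lambda>W. Rc V Y W p)"
proof (rule tensorialI)
  fix W assume W: "W \<in> VF"
  show "Rc V Y (W + W') p = Rc V Y W p + Rc V Y W' p" if W': "W' \<in> VF" for W'
  proof -
    have "D B (D C (W + W')) p = D B (D C W) p + D B (D C W') p" if B: "B \<in> VF" and C: "C \<in> VF" for B C
    proof -
      have "D B (D C (W + W')) p = D B (D C W + D C W') p"
        by (rule D_cong_right[OF open_U B Dv[OF C vfields_add[OF W W']] vfields_add[OF Dv[OF C W] Dv[OF C W']] p])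
           (simp add: D_add_right[OF open_U C W W'])
      then show ?thesis using D_add_right[OF open_U B Dv[OF C W] Dv[OF C W'] p] by simp
    qed
    from this[OF V Y] this[OF Y V] show ?thesis
      using D_add_right[OF open_U Bv[OF V Y] W W' p] by (simp add: curvature_def)
  qed
  show "Rc V Y (fscale \<phi> W) p = \<phi> p *\<^sub>R Rc V Y W p" if \<phi>: "smooth A U \<phi>" for \<phi>
  proof -
    have 2: "D B (D C (fscale \<phi> W)) p = B p (\<lambda>q. C q \<phi>) *\<^sub>R W p + C p \<phi> *\<^sub>R D B W p
        + B p \<phi> *\<^sub>R D C W p + \<phi> p *\<^sub>R D B (D C W) p" if B: "B \<in> VF" and C: "C \<in> VF" for B C
    proof -
      have sC: "smooth A U (\<lambda>q. C q \<phi>)" by (rule vfields_smooth[OF C open_U subset_refl \<phi>])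
      have "D B (D C (fscale \<phi> W)) p = D B (fscale (\<lambda>q. C q \<phi>) W + fscale \<phi> (D C W)) p"
        by (rule D_cong_right[OF open_U B Dv[OF C vfields_fscale[OF W \<phi>]]
              vfields_add[OF vfields_fscale[OF W sC] vfields_fscale[OF Dv[OF C W] \<phi>]] p])
           (simp add: D_fscale_right[OF open_U C W \<phi>])
      then show ?thesis
        using D_add_right[OF open_U B vfields_fscale[OF W sC] vfields_fscale[OF Dv[OF C W] \<phi>] p]
          D_fscale_right[OF open_U B W sC p] D_fscale_right[OF open_U B Dv[OF C W] \<phi> p] by simp
    qed
    have br: "lie_bracket A V Y p \<phi> = V p (\<lambda>q. Y q \<phi>) - Y p (\<lambda>q. V q \<phi>)"
      by (rule lie_bracket_apply[OF near[OF p \<phi>]])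
    show ?thesis
      by (simp add: curvature_def 2[OF V Y] 2[OF Y V] D_fscale_right[OF open_U Bv[OF V Y] W \<phi> p] br algebra_simps)
  qed
qed

end


context adapted
begin

lemma ZZ_coeff:
  assumes p: "p \<in> U"
  shows "gR M p (\<Sum>m<h. a m *\<^sub>R Z m p) (\<Sum>m<h. b m *\<^sub>R Z m p) = (\<Sum>m<h. a m * b m)"
proof -
  have t: "Z m p \<in> tangent_space A p" if "m < h" for m using vert_tangent[OF Z_vert[OF that]] .
  have on: "gR.orthonormal p h (\<lambda>i. Z i p)"
    using gR_ZZ[OF p] t by (simp add: gR.orthonormal_def)
  have S: "(\<Sum>m<h. a m *\<^sub>R Z m p) \<in> tangent_space A p"
    using t by (intro gR.closed(4) gR.closed(2)) auto
  have "gR M p (\<Sum>m<h. a m *\<^sub>R Z m p) (\<Sum>m<h. b m *\<^sub>R Z m p)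
      = (\<Sum>m<h. b m * gR M p (\<Sum>m<h. a m *\<^sub>R Z m p) (Z m p))"
    using t S by (intro gR.combination_right) auto
  also have "\<dots> = (\<Sum>m<h. a m * b m)"
    using gR.orthonormal_coeff[OF on] by (intro sum.cong) auto
  finally show ?thesis .
qed

lemma apply_hor:
  assumes "p \<in> U" "u \<in> hor M p"
  shows "u f = (\<Sum>i<d. gR M p u (X i p) * X i p f)"
proof -
  have "u f = (\<Sum>i<d. gR M p u (X i p) *\<^sub>R X i p) f"
    by (rule arg_cong[where f="\<lambda>v. v f", OF hor_expand[OF assms]])
  then show ?thesis by (simp add: sum_fun_apply)
qed

lemma hgrad_vfields:
  assumes f: "smooth A U f"
  shows "hgrad M f \<in> vfields A U"
  by (rule vfields_combination[OF open_U, of "{..<d}" "\<lambda>i q. X i q f" X])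
     (use f in \<open>auto simp: X_vfields hgrad_frame intro!: X_smooth[OF _ f]\<close>)

lemma vgrad_vfields:
  assumes f: "smooth A U f"
  shows "vgrad M f \<in> vfields A U"
  by (rule vfields_combination[OF open_U, of "{..<h}" "\<lambda>i q. Z i q f" Z])
     (use f in \<open>auto simp: Z_vfields vgrad_frame intro!: Z_smooth[OF _ f]\<close>)

end

context connection_chart
begin

lemma nabla_vert: "W \<in> VF \<Longrightarrow> m < h \<Longrightarrow> p \<in> U \<Longrightarrow> D W (Z m) p = 0"
  using canonical_connection[unfolded canonical_connection_def, THEN conjunct2, rule_format, OF open_U,
      THEN conjunct2, THEN conjunct2, THEN conjunct1] Z_vert by blast

lemma nabla_metric:
  assumes "W \<in> VF" "Y \<in> hfields M U" "Y' \<in> hfields M U" "p \<in> U"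
  shows "W p (\<lambda>q. hmet M q (Y q) (Y' q)) = hmet M p (D W Y p) (Y' p) + hmet M p (Y p) (D W Y' p)"
  using canonical_connection[unfolded canonical_connection_def, THEN conjunct2, rule_format, OF open_U,
      THEN conjunct1] assms by blast

lemma nabla_hfields: "Y \<in> hfields M U \<Longrightarrow> Y' \<in> hfields M U \<Longrightarrow> D Y Y' \<in> hfields M U"
  using canonical_connection[unfolded canonical_connection_def, THEN conjunct2, rule_format, OF open_U,
      THEN conjunct2, THEN conjunct1] by blast

lemma torsion_vert: "Y \<in> hfields M U \<Longrightarrow> Y' \<in> hfields M U \<Longrightarrow> p \<in> U \<Longrightarrow> T Y Y' p \<in> vspace M p"
  using canonical_connection[unfolded canonical_connection_def, THEN conjunct2, rule_format, OF open_U,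
      THEN conjunct2, THEN conjunct2, THEN conjunct2, THEN conjunct1] by blast

lemma torsion_hor_vert: "Y \<in> hfields M U \<Longrightarrow> m < h \<Longrightarrow> p \<in> U \<Longrightarrow> T Y (Z m) p = 0"
  using canonical_connection[unfolded canonical_connection_def, THEN conjunct2, rule_format, OF open_U,
      THEN conjunct2, THEN conjunct2, THEN conjunct2, THEN conjunct2] Z_vert by blast

text \<open>The axioms give this for horizontal directions. For a vertical direction, vanishing
  mixed torsion and \<open>\<nabla> Z = 0\<close> yield \<open>D (Z m) (X j) = - [X j, Z m]\<close>
  on \<open>U\<close>, which is horizontal by the structure equations.\<close>

lemma nabla_hor:
  assumes W: "W \<in> VF" and j: "j < d" and p: "p \<in> U"
  shows "D W (X j) p \<in> hor M p"
proof -
  have E: "D (E a) (X j) p \<in> hor M p" if "a < d + h" for a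
    using that
  proof (cases rule: E_cases)
    case (1 i)
    then show ?thesis using nabla_hfields[OF X_hfields X_hfields, of i j] j p hfieldsD(2) by simp
  next
    case (2 m)
    have "D (Z m) (X j) p = - lie_bracket A (X j) (Z m) p"
      using torsion_hor_vert[OF X_hfields[OF j] 2(1) p] nabla_vert[OF X_vfields[OF j] 2(1) p] T_apply[of "X j" "Z m" p]
      by (simp add: neg_equal_iff_equal eq_neg_iff_add_eq_0 add_eq_0_iff)
    then show ?thesis
      unfolding 2 E_simps bracket_XZ[OF p j 2(1)] using hor_combination[OF p] subspace_neg[OF hor_subspace] by metis
  qed
  have "D W (X j) p = (\<Sum>a\<in>{..<d+h}. gR M p (W p) (E a p) *\<^sub>R D (E a) (X j) p)"
    by (rule tensorial_combination[OF D_tensorial[OF open_U X_vfields[OF j] p] open_U p finite_lessThan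
          frame_coeff_smooth[OF W open_U subset_refl] E_vfields frame_expand[OF _ vfields_tangent[OF W]]]) auto
  also have "\<dots> \<in> hor M p"
    using E by (intro subspace_sum[OF hor_subspace] subspace_scale[OF hor_subspace]) auto
  finally show ?thesis .
qed

text \<open>The connection matrix of the horizontal bundle in the frame \<open>X\<close>; metric
  compatibility makes it skew in \<open>j\<close> and \<open>k\<close>.\<close>

definition G :: "'m vfield \<Rightarrow> nat \<Rightarrow> nat \<Rightarrow> 'm \<Rightarrow> real" where
  "G W j k q = gR M q (D W (X j) q) (X k q)"

lemma G_expand: "W \<in> VF \<Longrightarrow> j < d \<Longrightarrow> q \<in> U \<Longrightarrow> D W (X j) q = (\<Sum>k<d. G W j k q *\<^sub>R X k q)"
  unfolding G_def by (rule hor_expand[OF _ nabla_hor])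

lemma G_smooth: "W \<in> VF \<Longrightarrow> j < d \<Longrightarrow> k < d \<Longrightarrow> smooth A U (G W j k)"
  using frame_coeff_smooth[OF Dv[OF _ X_vfields] open_U subset_refl, of W j k] unfolding G_def[abs_def] by simp

lemma G_skew:
  assumes W: "W \<in> VF" and j: "j < d" "k < d" and p: "p \<in> U"
  shows "G W j k p = - G W k j p"
proof -
  have "W p (\<lambda>q. hmet M q (X j q) (X k q)) = W p (\<lambda>q. if j = k then 1 else 0)"
    by (rule tangent_cong[OF vfields_tangent[OF W p] open_U p])
       (use gR_XX j gR_hor[OF X_hor X_hor] in \<open>metis (no_types)\<close>)
  also have "\<dots> = 0" by (rule tangent_const[OF vfields_tangent[OF W p]])
  finally have "hmet M p (D W (X j) p) (X k p) + hmet M p (X j p) (D W (X k) p) = 0"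
    using nabla_metric[OF W X_hfields[OF j(1)] X_hfields[OF j(2)] p] by simp
  then show ?thesis
    using hmet.sym[OF X_hor[OF j(1) p] nabla_hor[OF W j(2) p]]
    by (simp add: G_def gR_hor[OF nabla_hor[OF W _ p] X_hor[OF _ p]] j)
qed

text \<open>The vector \<open>u\<close> is horizontal as a combination of the \<open>X k\<close> and
  vertical because torsion is, hence 0. Its vanishing says both that torsion is minus the vertical
  part of the bracket and that \<open>\<omega>\<close> is the antisymmetrised connection
  matrix.\<close>

lemma torsion_XX:
  assumes i: "i < d" "j < d" and p: "p \<in> U"
  shows "T (X i) (X j) p = - (\<Sum>m<h. \<gamma> i j m p *\<^sub>R Z m p)" (is ?T)
    and "\<And>k. k < d \<Longrightarrow> \<omega> i j k p = G (X i) j k p - G (X j) i k p"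
proof -
  define u where "u = (\<Sum>k<d. (G (X i) j k p - G (X j) i k p - \<omega> i j k p) *\<^sub>R X k p)"
  have "T (X i) (X j) p + (\<Sum>m<h. \<gamma> i j m p *\<^sub>R Z m p)
      = (\<Sum>k<d. G (X i) j k p *\<^sub>R X k p) - (\<Sum>k<d. G (X j) i k p *\<^sub>R X k p) - (\<Sum>k<d. \<omega> i j k p *\<^sub>R X k p)"
    using G_expand[OF X_vfields[OF i(1)] i(2) p] G_expand[OF X_vfields[OF i(2)] i(1) p] bracket_XX[OF p i]
    by (simp add: T_apply)
  also have "\<dots> = u" unfolding u_def by (simp only: scaleR_left_diff_distrib sum_subtractf)
  finally have e: "T (X i) (X j) p + (\<Sum>m<h. \<gamma> i j m p *\<^sub>R Z m p) = u" .
  have "u \<in> hor M p" unfolding u_def by (rule hor_combination[OF p])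
  moreover have "u \<in> vspace M p"
    unfolding e[symmetric]
    by (intro subspace_add[OF vspace_subspace] torsion_vert X_hfields i p vert_combination)
  ultimately have u0: "u = 0" using hor_vspace[of p] by blast
  then show ?T using e by (simp add: eq_neg_iff_add_eq_0)
  show "\<omega> i j k p = G (X i) j k p - G (X j) i k p" if k: "k < d" for k
  proof -
    have "gR M p u (X k p) = G (X i) j k p - G (X j) i k p - \<omega> i j k p"
      unfolding u_def by (rule X_coeff[OF p k])
    moreover have "gR M p u (X k p) = 0" unfolding u0 by (rule gR.zero_left[OF X_tangent[OF k p]])
    ultimately show ?thesis by simp
  qed
qed

lemma G_diag: "W \<in> VF \<Longrightarrow> j < d \<Longrightarrow> p \<in> U \<Longrightarrow> G W j j p = 0"
  using G_skew[of W j j p] by simp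

text \<open>This identity makes \<open>Lx\<close> the trace of the Hessian of
  \<open>\<nabla>\<close>: the first-order terms of both agree.\<close>

lemma dvg_G: "k < d \<Longrightarrow> p \<in> U \<Longrightarrow> dvg k p = - (\<Sum>l<d. G (X l) l k p)"
proof -
  assume k: "k < d" and p: "p \<in> U"
  have "\<omega> k l l p = G (X l) l k p" if l: "l < d" for l
    using torsion_XX(2)[OF k l p l] G_diag[OF X_vfields[OF k] l p] G_skew[OF X_vfields[OF l] k l p] by simp
  then show ?thesis by (simp add: dvg_def)
qed


subsection \<open>Curvature\<close>

lemma Rcv: "B \<in> VF \<Longrightarrow> C \<in> VF \<Longrightarrow> W \<in> VF \<Longrightarrow> Rc B C W \<in> VF"
  unfolding curvature_def by (intro vfields_diff Dv Bv)

lemma nabla2: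
  assumes B: "B \<in> VF" and C: "C \<in> VF" and j: "j < d" and p: "p \<in> U"
  shows "D B (D C (X j)) p \<in> hor M p"
    and "i < d \<Longrightarrow> gR M p (D B (D C (X j)) p) (X i p) = B p (G C j i) + (\<Sum>k<d. G C j k p * G B k i p)"
proof -
  have e: "D B (D C (X j)) p = (\<Sum>k\<in>{..<d}. B p (G C j k) *\<^sub>R X k p + G C j k p *\<^sub>R D B (X k) p)"
    by (rule D_combination_right[OF open_U B p finite_lessThan]) (use C j in \<open>auto intro: G_smooth X_vfields G_expand\<close>)
  then show "D B (D C (X j)) p \<in> hor M p"
    using nabla_hor[OF B _ p] X_hor[OF _ p] by (auto intro!: hmet.closed)
  assume i: "i < d"
  have "D B (D C (X j)) p = (\<Sum>k<d. B p (G C j k) *\<^sub>R X k p) + (\<Sum>k<d. G C j k p *\<^sub>R D B (X k) p)"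
    unfolding e by (rule sum.distrib)
  moreover have "(\<Sum>k<d. G C j k p *\<^sub>R D B (X k) p) \<in> hor M p"
    using nabla_hor[OF B _ p] by (auto intro!: hmet.closed)
  moreover have "gR M p (\<Sum>k<d. G C j k p *\<^sub>R D B (X k) p) (X i p) = (\<Sum>k<d. G C j k p * G B k i p)"
    unfolding G_def[of B] using nabla_hor[OF B _ p] hor_tangent X_tangent[OF i p]
    by (intro gR.combination_left) auto
  ultimately show "gR M p (D B (D C (X j)) p) (X i p) = B p (G C j i) + (\<Sum>k<d. G C j k p * G B k i p)"
    using gR.add_left[OF hor_tangent[OF hor_combination[OF p, of "\<lambda>k. B p (G C j k)"]] hor_tangent X_tangent[OF i p]]
      X_coeff[OF p i] by simp
qed

lemma curvature_hor:
  assumes B: "B \<in> VF" and C: "C \<in> VF" and j: "j < d" and p: "p \<in> U"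
  shows "Rc B C (X j) p \<in> hor M p"
  using nabla2(1)[OF B C j p] nabla2(1)[OF C B j p] nabla_hor[OF Bv[OF B C] j p]
  by (simp add: curvature_def hmet.closed)

lemma curvature_coeff:
  assumes B: "B \<in> VF" and C: "C \<in> VF" and i: "i < d" "j < d" and p: "p \<in> U"
  shows "gR M p (Rc B C (X j) p) (X i p) =
    B p (G C j i) + (\<Sum>k<d. G C j k p * G B k i p) - (C p (G B j i) + (\<Sum>k<d. G B j k p * G C k i p))
    - G (lie_bracket A B C) j i p"
proof -
  note t = hor_tangent[OF nabla2(1)[OF B C i(2) p]] hor_tangent[OF nabla2(1)[OF C B i(2) p]]
    hor_tangent[OF nabla_hor[OF Bv[OF B C] i(2) p]] X_tangent[OF i(1) p]
  have "gR M p (Rc B C (X j) p) (X i p) = gR M p (D B (D C (X j)) p) (X i p) - gR M p (D C (D B (X j)) p) (X i p)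
      - gR M p (D (lie_bracket A B C) (X j) p) (X i p)"
    unfolding curvature_def
    using gR.diff_left[OF gR.closed(5)[OF t(1,2)] t(3,4)] gR.diff_left[OF t(1,2,4)] by simp
  then show ?thesis unfolding nabla2(2)[OF B C i(2) p i(1)] nabla2(2)[OF C B i(2) p i(1)] G_def[of "lie_bracket A B C"] .
qed

text \<open>Curvature of a metric connection. In components, the derivative and bracket terms change
  sign by \<open>G_skew\<close>, while the two quadratic sums are exchanged with each other.\<close>

lemma curvature_skew:
  assumes B: "B \<in> VF" and C: "C \<in> VF" and i: "i < d" "j < d" and p: "p \<in> U"
  shows "gR M p (Rc B C (X j) p) (X i p) = - gR M p (Rc B C (X i) p) (X j p)"
proof -
  have 1: "V p (G W j i) = - V p (G W i j)" if V: "V \<in> VF" and W: "W \<in> VF" for V W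
  proof -
    have "V p (G W j i) = V p (\<lambda>q. - G W i j q)"
      by (rule tangent_cong[OF vfields_tangent[OF V p] open_U p]) (rule G_skew[OF W i(2,1)])
    also have "\<dots> = - V p (G W i j)"
      by (rule tangent_minus[OF vfields_tangent[OF V p] near[OF p G_smooth[OF W i]]])
    finally show ?thesis .
  qed
  have 2: "(\<Sum>k<d. G V j k p * G W k i p) = (\<Sum>k<d. G W i k p * G V k j p)" if V: "V \<in> VF" and W: "W \<in> VF" for V W
  proof (rule sum.cong)
    fix k assume "k \<in> {..<d}"
    then show "G V j k p * G W k i p = G W i k p * G V k j p"
      using G_skew[OF V i(2) _ p, of k] G_skew[OF W _ i(1) p, of k] by simp
  qed simp
  show ?thesis
    unfolding curvature_coeff[OF B C i p] curvature_coeff[OF B C i(2,1) p] 1[OF B C] 1[OF C B]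
      2[OF C B] 2[OF B C] G_skew[OF Bv[OF B C] i(2,1) p] by simp
qed

text \<open>A trace does not depend on the basis: \<open>Gm\<close> expands the coordinate fields in
  the frame, and the same matrix turns coordinate components into frame components.\<close>

lemma ricci_trace:
  assumes Y: "Y \<in> VF" and W: "W \<in> VF" and p: "p \<in> U"
  shows "(\<Sum>k\<in>UNIV. Rc (dd k) Y W p (crd k)) = (\<Sum>a<d+h. gR M p (Rc (E a) Y W p) (E a p))"
proof -
  have "Rc (dd k) Y W p = (\<Sum>\<alpha>\<in>UNIV. Gm p $ k $ \<alpha> *\<^sub>R Rc (E (idx \<alpha>)) Y W p)" for k
  proof (rule tensorial_combination[OF Rc_tensorial1[OF Y W p] open_U p])
    fix q assume q: "q \<in> U"
    show "dd k q = (\<Sum>\<alpha>\<in>UNIV. Gm q $ k $ \<alpha> *\<^sub>R E (idx \<alpha>) q)"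
      using frame_expand[OF q dd_tangent[OF q], of k] sum_idx[of "\<lambda>a. gR M q (dd k q) (E a q) *\<^sub>R E a q"]
      by (simp add: Gm_def)
  qed (auto intro: Gm_smooth E_vfields idx_less)
  then have "(\<Sum>k\<in>UNIV. Rc (dd k) Y W p (crd k))
      = (\<Sum>k\<in>UNIV. \<Sum>\<alpha>\<in>UNIV. Gm p $ k $ \<alpha> * Rc (E (idx \<alpha>)) Y W p (crd k))"
    by (simp add: sum_fun_apply)
  also have "\<dots> = (\<Sum>\<alpha>\<in>UNIV. \<Sum>k\<in>UNIV. Rc (E (idx \<alpha>)) Y W p (crd k) * Gm p $ k $ \<alpha>)"
    by (subst sum.swap) (simp add: mult.commute)
  also have "\<dots> = (\<Sum>\<alpha>\<in>UNIV. gR M p (Rc (E (idx \<alpha>)) Y W p) (E (idx \<alpha>) p))"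
    using frame_coeff[OF p vfields_tangent[OF Rcv[OF E_vfields[OF idx_less] Y W] p]] by simp
  also have "\<dots> = (\<Sum>a<d+h. gR M p (Rc (E a) Y W p) (E a p))" by (rule sum_idx)
  finally show ?thesis .
qed

text \<open>The curvature of a horizontal field is horizontal, so the vertical part of the trace
  drops out. Skewness then exchanges the gradient in the last slot with \<open>X l\<close>; this is
  the source of the minus sign, and the pairing with the gradient becomes application to
  \<open>f\<close>.\<close>

lemma ricci_hgrad:
  assumes f: "smooth A U f" and p: "p \<in> U"
  shows "(\<Sum>k\<in>UNIV. Rc (dd k) (hgrad M f) (hgrad M f) p (crd k))
    = - (\<Sum>k<d. X k p f * (\<Sum>l<d. Rc (X l) (X k) (X l) p f))"
proof -
  let ?u = "hgrad M f"
  note u = hgrad_vfields[OF f]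
  have sf: "\<And>i. i \<in> {..<d} \<Longrightarrow> smooth A U (\<lambda>q. X i q f)" using X_smooth[OF _ f] by simp
  have Xv: "\<And>i. i \<in> {..<d} \<Longrightarrow> X i \<in> VF" using X_vfields by simp
  have e: "Rc V ?u ?u p = (\<Sum>k<d. X k p f *\<^sub>R (\<Sum>j<d. X j p f *\<^sub>R Rc V (X k) (X j) p))" if V: "V \<in> VF" for V
  proof -
    have "Rc V ?u ?u p = (\<Sum>k<d. X k p f *\<^sub>R Rc V (X k) ?u p)"
      by (rule tensorial_combination[OF Rc_tensorial2[OF V u p] open_U p finite_lessThan sf Xv hgrad_frame])
    also have "\<dots> = (\<Sum>k<d. X k p f *\<^sub>R (\<Sum>j<d. X j p f *\<^sub>R Rc V (X k) (X j) p))"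
    proof (intro sum.cong refl)
      fix k assume "k \<in> {..<d}"
      then have k: "X k \<in> VF" by (rule Xv)
      show "X k p f *\<^sub>R Rc V (X k) ?u p = X k p f *\<^sub>R (\<Sum>j<d. X j p f *\<^sub>R Rc V (X k) (X j) p)"
        by (rule arg_cong[where f="\<lambda>v. X k p f *\<^sub>R v",
            OF tensorial_combination[OF Rc_tensorial3[OF V k p] open_U p finite_lessThan sf Xv hgrad_frame]])
    qed
    finally show ?thesis .
  qed
  have hor: "(\<Sum>j<d. X j p f *\<^sub>R Rc V (X k) (X j) p) \<in> hor M p" if "V \<in> VF" "k < d" for V k
    using curvature_hor[OF that(1) X_vfields[OF that(2)] _ p] by (auto intro!: hmet.closed)
  have horu: "Rc V ?u ?u p \<in> hor M p" if "V \<in> VF" for V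
    unfolding e[OF that] by (rule hmet.closed(4)) (simp add: hmet.closed(2) hor[OF that])
  have XX: "gR M p (Rc (X l) ?u ?u p) (X l p) = - (\<Sum>k<d. X k p f * Rc (X l) (X k) (X l) p f)" if l: "l < d" for l
  proof -
    note lv = X_vfields[OF l] and lt = X_tangent[OF l p]
    have "gR M p (Rc (X l) ?u ?u p) (X l p)
        = (\<Sum>k<d. X k p f * gR M p (\<Sum>j<d. X j p f *\<^sub>R Rc (X l) (X k) (X j) p) (X l p))"
      unfolding e[OF lv] using hor_tangent[OF hor[OF lv]] lt by (intro gR.combination_left) auto
    also have "\<dots> = (\<Sum>k<d. X k p f * - Rc (X l) (X k) (X l) p f)"
    proof (intro sum.cong refl arg_cong[where f="\<lambda>x. _ * x"])
      fix k assume "k \<in> {..<d}"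
      then have k: "k < d" by simp
      note kv = X_vfields[OF k]
      have "gR M p (\<Sum>j<d. X j p f *\<^sub>R Rc (X l) (X k) (X j) p) (X l p)
          = (\<Sum>j<d. X j p f * gR M p (Rc (X l) (X k) (X j) p) (X l p))"
        using hor_tangent[OF curvature_hor[OF lv kv _ p]] lt by (intro gR.combination_left) auto
      also have "\<dots> = (\<Sum>j<d. - (gR M p (Rc (X l) (X k) (X l) p) (X j p) * X j p f))"
        using curvature_skew[OF lv kv l _ p] by (intro sum.cong) auto
      also have "\<dots> = - Rc (X l) (X k) (X l) p f"
        unfolding sum_negf apply_hor[OF p curvature_hor[OF lv kv l p], of f] ..
      finally show "gR M p (\<Sum>j<d. X j p f *\<^sub>R Rc (X l) (X k) (X j) p) (X l p) = - Rc (X l) (X k) (X l) p f" .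
    qed
    finally show ?thesis by (simp add: sum_negf)
  qed
  have "(\<Sum>k\<in>UNIV. Rc (dd k) ?u ?u p (crd k)) = (\<Sum>l<d. gR M p (Rc (X l) ?u ?u p) (X l p))"
    unfolding ricci_trace[OF u u p] sum_lessThan_add
    using gR_hor_vert[OF horu[OF Z_vfields] Z_vert] by simp
  also have "\<dots> = - (\<Sum>l<d. \<Sum>k<d. X k p f * Rc (X l) (X k) (X l) p f)"
    using XX by (simp add: sum_negf)
  also have "\<dots> = - (\<Sum>k<d. X k p f * (\<Sum>l<d. Rc (X l) (X k) (X l) p f))"
    by (subst sum.swap) (simp add: sum_distrib_left)
  finally show ?thesis .
qed

text \<open>As the \<open>Z m\<close> are parallel, only the coefficients of the vertical gradient
  are differentiated. The sign of \<open>torsion_XX\<close> and that in the definition of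
  \<open>S_form\<close> combine to a plus.\<close>

lemma S_form_frame:
  assumes f: "smooth A U f" and p: "p \<in> U"
  shows "S_form M D d X f p = 2 * (\<Sum>k<d. X k p f * (\<Sum>l<d. \<Sum>m<h. \<gamma> l k m p * X l p (\<lambda>q. Z m q f)))"
proof -
  have sf: "\<And>i. i \<in> {..<d} \<Longrightarrow> smooth A U (\<lambda>q. X i q f)" using X_smooth[OF _ f] by simp
  have sz: "\<And>m. m \<in> {..<h} \<Longrightarrow> smooth A U (\<lambda>q. Z m q f)" using Z_smooth[OF _ f] by simp
  have Xv: "\<And>i. i \<in> {..<d} \<Longrightarrow> X i \<in> VF" using X_vfields by simp
  have Zv: "\<And>m. m \<in> {..<h} \<Longrightarrow> Z m \<in> VF" using Z_vfields by simp
  have "gR M p (D (X l) (vgrad M f) p) (T (X l) (hgrad M f) p)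
      = - (\<Sum>k<d. X k p f * (\<Sum>m<h. \<gamma> l k m p * X l p (\<lambda>q. Z m q f)))" if l: "l < d" for l
  proof -
    note lv = X_vfields[OF l]
    have "D (X l) (vgrad M f) p = (\<Sum>m<h. X l p (\<lambda>q. Z m q f) *\<^sub>R Z m p + Z m p f *\<^sub>R D (X l) (Z m) p)"
      by (rule D_combination_right[OF open_U lv p finite_lessThan sz Zv vgrad_frame])
    also have "\<dots> = (\<Sum>m<h. X l p (\<lambda>q. Z m q f) *\<^sub>R Z m p)"
      using nabla_vert[OF lv _ p] by simp
    finally have 1: "D (X l) (vgrad M f) p = (\<Sum>m<h. X l p (\<lambda>q. Z m q f) *\<^sub>R Z m p)" .
    have "T (X l) (hgrad M f) p = (\<Sum>k<d. X k p f *\<^sub>R T (X l) (X k) p)"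
      by (rule tensorial_combination[OF T_tensorial_right[OF open_U lv p] open_U p finite_lessThan sf Xv hgrad_frame])
    also have "\<dots> = (\<Sum>k<d. X k p f *\<^sub>R - (\<Sum>m<h. \<gamma> l k m p *\<^sub>R Z m p))"
      using torsion_XX(1)[OF l _ p] by simp
    also have "\<dots> = (\<Sum>m<h. - (\<Sum>k<d. X k p f * \<gamma> l k m p) *\<^sub>R Z m p)"
      by (simp only: scaleR_minus_right sum_negf scaleR_minus_left scaleR_sum_right scaleR_scaleR scaleR_sum_left)
         (subst sum.swap, rule refl)
    finally have 2: "T (X l) (hgrad M f) p = (\<Sum>m<h. - (\<Sum>k<d. X k p f * \<gamma> l k m p) *\<^sub>R Z m p)" .
    have "gR M p (D (X l) (vgrad M f) p) (T (X l) (hgrad M f) p)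
        = (\<Sum>m<h. X l p (\<lambda>q. Z m q f) * - (\<Sum>k<d. X k p f * \<gamma> l k m p))"
      unfolding 1 2 by (rule ZZ_coeff[OF p])
    also have "\<dots> = - (\<Sum>m<h. \<Sum>k<d. X k p f * (\<gamma> l k m p * X l p (\<lambda>q. Z m q f)))"
      by (simp add: sum_negf sum_distrib_left mult_ac)
    also have "\<dots> = - (\<Sum>k<d. X k p f * (\<Sum>m<h. \<gamma> l k m p * X l p (\<lambda>q. Z m q f)))"
      by (subst sum.swap) (simp add: sum_distrib_left)
    finally show ?thesis .
  qed
  then have "S_form M D d X f p = 2 * (\<Sum>l<d. \<Sum>k<d. X k p f * (\<Sum>m<h. \<gamma> l k m p * X l p (\<lambda>q. Z m q f)))"
    by (simp add: S_form_def sum_negf)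
  then show ?thesis by (subst (asm) sum.swap) (simp add: sum_distrib_left)
qed

end


section \<open>Symmetric and skew double sums\<close>

lemma sum_skew_sym:
  fixes g s :: "nat \<Rightarrow> nat \<Rightarrow> real"
  assumes "\<And>j k. j < d \<Longrightarrow> k < d \<Longrightarrow> g j k = - g k j" "\<And>j k. j < d \<Longrightarrow> k < d \<Longrightarrow> s j k = s k j"
  shows "(\<Sum>j<d. \<Sum>k<d. g j k * s j k) = 0"
proof -
  have "(\<Sum>j<d. \<Sum>k<d. g j k * s j k) = (\<Sum>j<d. \<Sum>k<d. - (g k j * s k j))"
    using assms by (intro sum.cong refl) (metis lessThan_iff mult_minus_left)
  also have "\<dots> = - (\<Sum>j<d. \<Sum>k<d. g j k * s j k)"
    by (subst sum.swap) (simp add: sum_negf)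
  finally show ?thesis by simp
qed

text \<open>The symmetric and skew parts of a matrix are orthogonal. The symmetric part is written
  as its diagonal plus twice the lower triangle to match \<open>hessian_norm2\<close>; the skew
  part, summed over all pairs, carries the factor 1/4.\<close>

lemma sum_squares_sym_skew:
  fixes H :: "nat \<Rightarrow> nat \<Rightarrow> real"
  shows "(\<Sum>l<d. \<Sum>k<d. (H l k)\<^sup>2) = (\<Sum>l<d. (H l l)\<^sup>2) + 2 * (\<Sum>j<d. \<Sum>l<j. ((H j l + H l j) / 2)\<^sup>2)
    + (\<Sum>l<d. \<Sum>k<d. 1/4 * (H l k - H k l)\<^sup>2)"
proof (induction d)
  case (Suc d)
  have split: "(\<Sum>l<Suc d. \<Sum>k<Suc d. F l k) = (\<Sum>l<d. \<Sum>k<d. F l k) + (\<Sum>l<d. F l d + F d l) + F d d"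
    for F :: "nat \<Rightarrow> nat \<Rightarrow> real"
    by (simp add: sum.distrib)
  have sq: "(H l d)\<^sup>2 + (H d l)\<^sup>2 = 2 * ((H d l + H l d) / 2)\<^sup>2 + (1/4 * (H l d - H d l)\<^sup>2 + 1/4 * (H d l - H l d)\<^sup>2)" for l
    by (simp add: power2_eq_square field_simps)
  show ?case
    unfolding split[of "\<lambda>l k. (H l k)\<^sup>2"] split[of "\<lambda>l k. 1/4 * (H l k - H k l)\<^sup>2"] Suc.IH sq
    by (simp add: sum.distrib sum_distrib_left)
qed simp

context manifold
begin

lemma tensorial_eval: "tensorial U p \<Phi> \<Longrightarrow> tensorial U p (\<lambda>B. \<Phi> B f)" for \<Phi> :: "'m vfield \<Rightarrow> 'm tvec"
  by (simp add: tensorial_def)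

lemma tensorial_mult_right: "tensorial U p \<Phi> \<Longrightarrow> tensorial U p (\<lambda>B. \<Phi> B * a)" for \<Phi> :: "'m vfield \<Rightarrow> real"
  by (simp add: tensorial_def algebra_simps)

lemma tensorial_mult_left: "tensorial U p \<Phi> \<Longrightarrow> tensorial U p (\<lambda>B. a * \<Phi> B)" for \<Phi> :: "'m vfield \<Rightarrow> real"
  by (simp add: tensorial_def algebra_simps)

lemma tensorial_field: "tensorial U p (\<lambda>B. B p f)"
  by (simp add: tensorial_def)

end

section \<open>The horizontal Bochner formula\<close>

context connection_chart
begin

definition Hess :: "('m \<Rightarrow> real) \<Rightarrow> 'm vfield \<Rightarrow> 'm vfield \<Rightarrow> 'm \<Rightarrow> real" where
  "Hess f B C p = B p (\<lambda>q. C q f) - D B C p f"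

context
  fixes f assumes f: "smooth A U f"
begin

lemma VF_smooth: "B \<in> VF \<Longrightarrow> smooth A U (\<lambda>q. B q f)"
  by (rule vfields_smooth[OF _ open_U subset_refl f])

lemma Hess_smooth: "B \<in> VF \<Longrightarrow> C \<in> VF \<Longrightarrow> smooth A U (Hess f B C)"
  unfolding Hess_def[abs_def]
  by (rule smooth_diff[OF vfields_smooth[OF _ open_U subset_refl VF_smooth] VF_smooth[OF Dv] open_U])

lemma Hess_tensorial1: "C \<in> VF \<Longrightarrow> p \<in> U \<Longrightarrow> tensorial U p (\<lambda>B. Hess f B C p)"
  using D_tensorial[OF open_U, of C p] by (simp add: tensorial_def Hess_def algebra_simps)

lemma Hess_tensorial2:
  assumes B: "B \<in> VF" and p: "p \<in> U"
  shows "tensorial U p (\<lambda>C. Hess f B C p)"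
proof (rule tensorialI)
  fix C assume C: "C \<in> VF"
  note t = vfields_tangent[OF B p] and nC = near[OF p VF_smooth[OF C]]
  show "Hess f B (C + C') p = Hess f B C p + Hess f B C' p" if C': "C' \<in> VF" for C'
    using tangent_add[OF t nC near[OF p VF_smooth[OF C']]] D_add_right[OF open_U B C C' p]
    by (simp add: Hess_def)
  show "Hess f B (fscale \<phi> C) p = \<phi> p *\<^sub>R Hess f B C p" if \<phi>: "smooth A U \<phi>" for \<phi>
    using tangent_mult[OF t near[OF p \<phi>] nC] D_fscale_right[OF open_U B C \<phi> p]
    by (simp add: Hess_def algebra_simps)
qed

lemma Hess_swap: "B \<in> VF \<Longrightarrow> C \<in> VF \<Longrightarrow> p \<in> U \<Longrightarrow> Hess f B C p = Hess f C B p - T B C p f"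
  using lie_bracket_apply[OF near[OF _ f]] by (simp add: Hess_def T_apply)

text \<open>\<open>third B C Y\<close> is \<open>(\<nabla>\<^sub>B Hess)(C, Y)\<close>, and the next lemma is the Ricci identity.\<close>

definition third :: "'m vfield \<Rightarrow> 'm vfield \<Rightarrow> 'm vfield \<Rightarrow> 'm \<Rightarrow> real" where
  "third B C Y p = B p (Hess f C Y) - Hess f (D B C) Y p - Hess f C (D B Y) p"

lemma third_commute:
  assumes B: "B \<in> VF" and C: "C \<in> VF" and Y: "Y \<in> VF" and p: "p \<in> U"
  shows "third B C Y p - third C B Y p = - Hess f (T B C) Y p - Rc B C Y p f"
proof -
  have d: "V p (Hess f W Y) = V p (\<lambda>q. W q (\<lambda>q. Y q f)) - V p (\<lambda>q. D W Y q f)" if V: "V \<in> VF" and W: "W \<in> VF" for V W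
    unfolding Hess_def[abs_def]
    by (rule tangent_diff[OF vfields_tangent[OF V p] near[OF p vfields_smooth[OF W open_U subset_refl VF_smooth[OF Y]]]
          near[OF p VF_smooth[OF Dv[OF W Y]]]])
  have t: "Hess f (T B C) Y p = Hess f (D B C) Y p - Hess f (D C B) Y p - Hess f (lie_bracket A B C) Y p"
  proof -
    note t1 = Hess_tensorial1[OF Y p]
    have m: "Hess f (V - W) Y p = Hess f V Y p - Hess f W Y p" if V: "V \<in> VF" and W: "W \<in> VF" for V W
      using tensorial_add[OF t1 V vfields_uminus[OF W]] tensorial_fscale[OF t1 W smooth_const, of "-1"]
      by (simp add: fscale_uminus)
    show ?thesis
      unfolding torsion_def m[OF vfields_diff[OF Dv[OF B C] Dv[OF C B]] Bv[OF B C]] m[OF Dv[OF B C] Dv[OF C B]] ..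
  qed
  have b: "lie_bracket A B C p (\<lambda>q. Y q f) = B p (\<lambda>q. C q (\<lambda>q. Y q f)) - C p (\<lambda>q. B q (\<lambda>q. Y q f))"
    by (rule lie_bracket_apply[OF near[OF p VF_smooth[OF Y]]])
  \<comment> \<open>The first derivatives of \<open>D B Y f\<close> and \<open>D C Y f\<close>
    cancel between the two orders. The commutator acting on \<open>Y f\<close> is absorbed by the
    Hessian of the bracket, which leaves just the bracket term of the curvature.\<close>
  show ?thesis
    unfolding third_def t d[OF B C] d[OF C B] by (simp add: Hess_def b curvature_def)
qed

abbreviation "H l k \<equiv> Hess f (X l) (X k)"

lemma Hess_nabla1:
  assumes "B \<in> VF" "j < d" "C \<in> VF" "p \<in> U"
  shows "Hess f (D B (X j)) C p = (\<Sum>k<d. G B j k p * Hess f (X k) C p)"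
  using tensorial_combination[OF Hess_tensorial1[OF assms(3,4)] open_U assms(4) finite_lessThan[of d], of "G B j" X "D B (X j)"]
    G_smooth[OF assms(1,2)] X_vfields G_expand[OF assms(1,2)] by simp

lemma Hess_nabla2:
  assumes "B \<in> VF" "j < d" "C \<in> VF" "p \<in> U"
  shows "Hess f C (D B (X j)) p = (\<Sum>k<d. G B j k p * Hess f C (X k) p)"
  using tensorial_combination[OF Hess_tensorial2[OF assms(3,4)] open_U assms(4) finite_lessThan[of d], of "G B j" X "D B (X j)"]
    G_smooth[OF assms(1,2)] X_vfields G_expand[OF assms(1,2)] by simp

lemma torsion_nabla:
  assumes "B \<in> VF" "j < d" "C \<in> VF" "p \<in> U"
  shows "T (D B (X j)) C p f = (\<Sum>k<d. G B j k p * T (X k) C p f)"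
    and "T C (D B (X j)) p f = (\<Sum>k<d. G B j k p * T C (X k) p f)"
  using tensorial_combination[OF tensorial_eval[OF T_tensorial_left[OF open_U assms(3,4)], of f] open_U assms(4) finite_lessThan[of d], of "G B j" X "D B (X j)"]
    tensorial_combination[OF tensorial_eval[OF T_tensorial_right[OF open_U assms(3,4)], of f] open_U assms(4) finite_lessThan[of d], of "G B j" X "D B (X j)"]
    G_smooth[OF assms(1,2)] X_vfields G_expand[OF assms(1,2)] by simp_all

text \<open>A metric connection commutes with the trace: the correction pairs the skew
  \<open>G\<close> with the symmetrised Hessian.\<close>

lemma sum_third:
  assumes B: "B \<in> VF" and p: "p \<in> U"
  shows "(\<Sum>l<d. third B (X l) (X l) p) = (\<Sum>l<d. B p (H l l))"
proof -
  have "(\<Sum>l<d. third B (X l) (X l) p) = (\<Sum>l<d. B p (H l l)) - (\<Sum>l<d. \<Sum>k<d. G B l k p * (H k l p + H l k p))"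
    by (simp add: third_def Hess_nabla1[OF B _ X_vfields p] Hess_nabla2[OF B _ X_vfields p]
        sum_subtractf sum.distrib algebra_simps)
  also have "(\<Sum>l<d. \<Sum>k<d. G B l k p * (H k l p + H l k p)) = 0"
    by (rule sum_skew_sym) (auto intro: G_skew[OF B _ _ p])
  finally show ?thesis by simp
qed

text \<open>Torsion is a combination of the \<open>Z m\<close>. These are parallel, so the Hessian
  reduces to iterated derivatives, and the mixed torsion vanishes, so the Hessian may be
  swapped.\<close>

lemma Hess_torsion:
  assumes l: "l < d" "k < d" and p: "p \<in> U"
  shows "Hess f (X l) (T (X l) (X k)) p = - (\<Sum>m<h. \<gamma> l k m p * X l p (\<lambda>q. Z m q f))"
    and "Hess f (T (X l) (X k)) (X l) p = Hess f (X l) (T (X l) (X k)) p"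
proof -
  note lv = X_vfields[OF l(1)] and tv = Tv[OF X_vfields[OF l(1)] X_vfields[OF l(2)]]
  have Te: "T (X l) (X k) q = (\<Sum>m\<in>{..<h}. - \<gamma> l k m q *\<^sub>R Z m q)" if "q \<in> U" for q
    unfolding torsion_XX(1)[OF l that] by (simp add: sum_negf)
  have s: "\<And>m. m \<in> {..<h} \<Longrightarrow> smooth A U (\<lambda>q. - \<gamma> l k m q)"
    using smooth_minus[OF structure_smooth(2)[OF l] open_U] by simp
  have z: "\<And>m. m \<in> {..<h} \<Longrightarrow> Z m \<in> VF" using Z_vfields by simp
  have "Hess f (X l) (T (X l) (X k)) p = (\<Sum>m\<in>{..<h}. - \<gamma> l k m p *\<^sub>R Hess f (X l) (Z m) p)"
    by (rule tensorial_combination[OF Hess_tensorial2[OF lv p] open_U p finite_lessThan s z Te])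
  then show "Hess f (X l) (T (X l) (X k)) p = - (\<Sum>m<h. \<gamma> l k m p * X l p (\<lambda>q. Z m q f))"
    using nabla_vert[OF lv _ p] by (simp add: Hess_def sum_negf)
  have "T (T (X l) (X k)) (X l) p = (\<Sum>m\<in>{..<h}. - \<gamma> l k m p *\<^sub>R T (Z m) (X l) p)"
    by (rule tensorial_combination[OF T_tensorial_left[OF open_U lv p] open_U p finite_lessThan s z Te])
  also have "\<dots> = 0"
    using torsion_hor_vert[OF X_hfields[OF l(1)] _ p] T_swap[of _ "X l"] by simp
  finally show "Hess f (T (X l) (X k)) (X l) p = Hess f (X l) (T (X l) (X k)) p"
    using Hess_swap[OF tv lv p] by simp
qed

text \<open>The left side is the covariant derivative of the Hessian in direction
  \<open>X l\<close>, evaluated at \<open>X l\<close> and \<open>X k\<close>. The term with the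
  Hessian of the torsion arises twice, from differentiating \<open>T (X l) (X k) f\<close> after the
  arguments are swapped and from the Ricci identity; hence the factor 2 that later appears in
  \<open>S_form\<close>.\<close>

lemma divergence_Hess:
  assumes l: "l < d" "k < d" and p: "p \<in> U"
  shows "X l p (H l k) - (\<Sum>j<d. G (X l) l j p * H j k p) - (\<Sum>j<d. G (X l) k j p * H l j p)
    = third (X k) (X l) (X l) p - Rc (X l) (X k) (X l) p f - DT (X l) (X l) (X k) p f
      + 2 * (\<Sum>m<h. \<gamma> l k m p * X l p (\<lambda>q. Z m q f))"
proof -
  note lv = X_vfields[OF l(1)] and kv = X_vfields[OF l(2)]
  note tv = Tv[OF lv kv] and t = vfields_tangent[OF lv p]
  have "X l p (H l k) = X l p (\<lambda>q. H k l q - T (X l) (X k) q f)"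
    by (rule tangent_cong[OF t open_U p]) (rule Hess_swap[OF lv kv])
  also have "\<dots> = X l p (H k l) - X l p (\<lambda>q. T (X l) (X k) q f)"
    by (rule tangent_diff[OF t near[OF p Hess_smooth[OF kv lv]] near[OF p VF_smooth[OF tv]]])
  finally have 1: "X l p (H l k) = X l p (H k l) - X l p (\<lambda>q. T (X l) (X k) q f)" .
  have 2: "X l p (\<lambda>q. T (X l) (X k) q f) = Hess f (X l) (T (X l) (X k)) p + D (X l) (T (X l) (X k)) p f"
    by (simp add: Hess_def)
  have 3: "D (X l) (T (X l) (X k)) p f = DT (X l) (X l) (X k) p f
      + (\<Sum>j<d. G (X l) l j p * T (X j) (X k) p f) + (\<Sum>j<d. G (X l) k j p * T (X l) (X j) p f)"
    using torsion_nabla(1)[OF lv l(1) kv p] torsion_nabla(2)[OF lv l(2) lv p] by (simp add: deriv_torsion_def)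
  have 4: "(\<Sum>j<d. G (X l) l j p * H j k p)
      = (\<Sum>j<d. G (X l) l j p * H k j p) - (\<Sum>j<d. G (X l) l j p * T (X j) (X k) p f)"
    unfolding sum_subtractf[symmetric] right_diff_distrib[symmetric]
    by (intro sum.cong refl arg_cong[where f="\<lambda>x. _ * x"] Hess_swap X_vfields kv p) simp
  have 5: "(\<Sum>j<d. G (X l) k j p * H l j p)
      = (\<Sum>j<d. G (X l) k j p * H j l p) - (\<Sum>j<d. G (X l) k j p * T (X l) (X j) p f)"
    unfolding sum_subtractf[symmetric] right_diff_distrib[symmetric]
    by (intro sum.cong refl arg_cong[where f="\<lambda>x. _ * x"] Hess_swap X_vfields lv p) simp
  have 6: "third (X l) (X k) (X l) p = X l p (H k l) - (\<Sum>j<d. G (X l) k j p * H j l p) - (\<Sum>j<d. G (X l) l j p * H k j p)"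
    by (simp add: third_def Hess_nabla1[OF lv l(2) lv p] Hess_nabla2[OF lv l(1) kv p])
  show ?thesis
    using third_commute[OF lv kv lv p] 6 Hess_torsion[OF l p] unfolding 1 2 3 4 5 by simp
qed

text \<open>By \<open>torsion_XX\<close> and skewness of \<open>G\<close>, the symmetrised
  \<open>\<omega>\<close> are the coefficients of the symmetrised \<open>D (X j) (X l)\<close>, so
  \<open>hessian_norm2\<close> is the squared norm of the symmetric part of the Hessian. The skew
  part is \<open>- T f / 2\<close> by \<open>Hess_swap\<close>.\<close>

lemma hessian_norm2_eq:
  assumes p: "p \<in> U"
  shows "hessian_norm2 d X \<omega> f p + (\<Sum>l<d. \<Sum>k<d. 1/4 * (T (X l) (X k) p f)\<^sup>2) = (\<Sum>l<d. \<Sum>k<d. (H l k p)\<^sup>2)"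
proof -
  have D: "D (X l) (X k) p f = (\<Sum>i<d. G (X l) k i p * X i p f)" if "l < d" "k < d" for l k
    unfolding G_expand[OF X_vfields[OF that(1)] that(2) p] by (simp add: sum_fun_apply)
  have w: "\<omega> i j l p + \<omega> i l j p = - (G (X j) i l p + G (X l) i j p)" if "i < d" "j < d" "l < d" for i j l
    using torsion_XX(2)[OF that(1,2) p that(3)] torsion_XX(2)[OF that(1,3) p that(2)]
      G_skew[OF X_vfields[OF that(1)] that(2,3) p] by simp
  have w': "(\<omega> i j l p + \<omega> i l j p) / 2 * X i p f = (G (X j) l i p * X i p f + G (X l) j i p * X i p f) / 2"
    if "i < d" "j < d" "l < d" for i j l
    using w[OF that] G_skew[OF X_vfields[OF that(2)] that(1,3) p] G_skew[OF X_vfields[OF that(3)] that(1,2) p]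
    by (simp add: algebra_simps)
  have off: "(X j p (app (X l) f) + X l p (app (X j) f)) / 2 - (\<Sum>i<d. (\<omega> i j l p + \<omega> i l j p) / 2 * X i p f)
      = (H j l p + H l j p) / 2" if jl: "j < d" "l < d" for j l
  proof -
    have "(\<Sum>i<d. (\<omega> i j l p + \<omega> i l j p) / 2 * X i p f) = (\<Sum>i<d. (G (X j) l i p * X i p f + G (X l) j i p * X i p f) / 2)"
      using w' jl by (intro sum.cong) auto
    also have "\<dots> = (D (X j) (X l) p f + D (X l) (X j) p f) / 2"
      unfolding D[OF jl] D[OF jl(2,1)] sum.distrib[symmetric] sum_divide_distrib ..
    finally show ?thesis by (simp add: Hess_def app_def field_simps)
  qed
  \<comment> \<open>The case \<open>j = l\<close> of the off-diagonal formula, where symmetrising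
    changes nothing.\<close>
  have diag: "X l p (app (X l) f) - (\<Sum>i<d. \<omega> i l l p * X i p f) = H l l p" if l: "l < d" for l
    using off[OF l l] by simp
  have s: "T (X l) (X k) p f = - (H l k p - H k l p)" if "l < d" "k < d" for l k
    using Hess_swap[OF X_vfields[OF that(1)] X_vfields[OF that(2)] p] by simp
  have "(\<Sum>l<d. \<Sum>k<d. 1/4 * (T (X l) (X k) p f)\<^sup>2) = (\<Sum>l<d. \<Sum>k<d. 1/4 * (H l k p - H k l p)\<^sup>2)"
    using s by (intro sum.cong refl) (simp del: minus_diff_eq)
  moreover have "(\<Sum>l<d. (X l p (app (X l) f) - (\<Sum>i<d. \<omega> i l l p * X i p f))\<^sup>2) = (\<Sum>l<d. (H l l p)\<^sup>2)"
    by (intro sum.cong refl arg_cong[where f="\<lambda>x. x\<^sup>2"] diag) simp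
  moreover have "(\<Sum>j<d. \<Sum>l<j. ((X j p (app (X l) f) + X l p (app (X j) f)) / 2
      - (\<Sum>i<d. (\<omega> i j l p + \<omega> i l j p) / 2 * X i p f))\<^sup>2) = (\<Sum>j<d. \<Sum>l<j. ((H j l p + H l j p) / 2)\<^sup>2)"
    by (intro sum.cong refl arg_cong[where f="\<lambda>x. x\<^sup>2"] off) simp_all
  ultimately show ?thesis
    using sum_squares_sym_skew[of "\<lambda>l k. H l k p" d] by (simp only: hessian_norm2_def)
qed

end

end


context sub_lap
begin

text \<open>Read off from the product identity, which gives smoothness on the whole manifold at
  once, whereas the frame formula is local.\<close>

lemma Gam_smooth:
  assumes f: "smooth A UNIV f" and g: "smooth A UNIV g"
  shows "smooth A UNIV (Gam M f g)"
proof -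
  have "Gam M f g = (\<lambda>q. (L (\<lambda>q. f q * g q) q - f q * L g q - g q * L f q) * (1/2))"
    using L_mult[OF f g] by (simp add: fun_eq_iff field_simps)
  then show ?thesis
    using smooth_mult[OF smooth_diff[OF smooth_diff[OF L_smooth[OF smooth_mult[OF f g open_UNIV]]
          smooth_mult[OF f L_smooth[OF g] open_UNIV] open_UNIV] smooth_mult[OF g L_smooth[OF f] open_UNIV] open_UNIV]
        smooth_const open_UNIV, of "1/2"] by simp
qed

end

context sub_lap_chart
begin

lemma L_eq_Lx:
  assumes g: "smooth A UNIV g" and q: "q \<in> U"
  shows "L g q = Lx g q"
proof -
  \<comment> \<open>The base point of the locale is arbitrary, so the result at \<open>p0\<close>
    transfers to every point of \<open>U\<close>.\<close>
  interpret q: sub_lap_chart M d h \<mu> L U X Z \<omega> \<gamma> \<delta> c q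
    by unfold_locales (rule c U_chart q)+
  show ?thesis using q.L_eq_Lx_p0[OF g] by (simp add: q.Lx_def Lx_def q.dvg_def dvg_def)
qed

end

locale bochner = sub_lap_chart M d h \<mu> L U X Z \<omega> \<gamma> \<delta> c p0 + connection_chart M d h D U X Z \<omega> \<gamma> \<delta> c p0
  for M :: "('m::{t2_space,second_countable_topology}, 'n::finite) subriem" and d h \<mu> L D U X Z \<omega> \<gamma> \<delta> c p0
begin

lemma Lx_Hess:
  assumes q: "q \<in> U"
  shows "Lx F q = (\<Sum>l<d. Hess F (X l) (X l) q)"
proof -
  have "(\<Sum>l<d. D (X l) (X l) q F) = (\<Sum>l<d. \<Sum>k<d. G (X l) l k q * X k q F)"
  proof (intro sum.cong refl)
    fix l assume "l \<in> {..<d}"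
    then show "D (X l) (X l) q F = (\<Sum>k<d. G (X l) l k q * X k q F)"
      using G_expand[OF X_vfields _ q, of l l] by (simp add: sum_fun_apply)
  qed
  also have "\<dots> = (\<Sum>k<d. (\<Sum>l<d. G (X l) l k q) * X k q F)"
    by (subst sum.swap) (simp add: sum_distrib_right)
  also have "\<dots> = - (\<Sum>k<d. dvg k q * X k q F)"
    by (simp add: dvg_G[OF _ q] sum_negf)
  finally show ?thesis by (simp add: Lx_def Hess_def sum.distrib sum_subtractf)
qed

context
  fixes f p assumes f: "smooth A UNIV f" and p: "p \<in> U"
begin

lemma fU: "smooth A U f"
  using smooth_subset[OF f] by simp

text \<open>Metric compatibility: writing \<open>X l (X k f)\<close> as a Hessian plus a connection
  term, the latter is skew in two indices and paired with the symmetric product of first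
  derivatives.\<close>

lemma X_Gam:
  assumes l: "l < d" and q: "q \<in> U"
  shows "X l q (Gam M f f) = 2 * (\<Sum>k<d. X k q f * Hess f (X l) (X k) q)"
proof -
  note t = X_tangent[OF l q]
  have n: "smooth_near A q (\<lambda>q. X k q f)" if "k < d" for k
    by (rule near[OF q X_smooth[OF that fU]])
  have "X l q (Gam M f f) = X l q (\<lambda>q. \<Sum>k<d. X k q f * X k q f)"
    by (rule tangent_cong[OF t open_U q]) (rule Gam_frame)
  also have "\<dots> = (\<Sum>k<d. X l q (\<lambda>q. X k q f * X k q f))"
    by (rule tangent_sum[OF t]) (auto intro!: smooth_near_mult n)
  also have "\<dots> = (\<Sum>k<d. 2 * (X k q f * Hess f (X l) (X k) q) + 2 * (\<Sum>j<d. G (X l) k j q * (X k q f * X j q f)))"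
  proof (intro sum.cong refl)
    fix k assume "k \<in> {..<d}"
    then have k: "k < d" by simp
    have "X l q (\<lambda>q. X k q f) = Hess f (X l) (X k) q + (\<Sum>j<d. G (X l) k j q * X j q f)"
      using G_expand[OF X_vfields[OF l] k q] by (simp add: Hess_def sum_fun_apply)
    then show "X l q (\<lambda>q. X k q f * X k q f)
        = 2 * (X k q f * Hess f (X l) (X k) q) + 2 * (\<Sum>j<d. G (X l) k j q * (X k q f * X j q f))"
      by (simp add: tangent_mult[OF t n[OF k] n[OF k]] sum_distrib_left sum_distrib_right algebra_simps)
  qed
  also have "\<dots> = 2 * (\<Sum>k<d. X k q f * Hess f (X l) (X k) q)
      + 2 * (\<Sum>k<d. \<Sum>j<d. G (X l) k j q * (X k q f * X j q f))"
    by (simp add: sum.distrib sum_distrib_left)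
  also have "(\<Sum>k<d. \<Sum>j<d. G (X l) k j q * (X k q f * X j q f)) = 0"
    by (rule sum_skew_sym) (auto intro: G_skew[OF X_vfields[OF l] _ _ q])
  finally show ?thesis by simp
qed

text \<open>\<open>X_Gam\<close> is differentiated once more. The second sum is arranged so that its
  inner factor is exactly the left side of \<open>divergence_Hess\<close>.\<close>

lemma Hess_Gam:
  assumes l: "l < d"
  shows "Hess (Gam M f f) (X l) (X l) p / 2 = (\<Sum>k<d. (Hess f (X l) (X k) p)\<^sup>2)
    + (\<Sum>k<d. X k p f * (X l p (Hess f (X l) (X k)) - (\<Sum>j<d. G (X l) l j p * Hess f (X j) (X k) p)
        - (\<Sum>j<d. G (X l) k j p * Hess f (X l) (X j) p)))"
proof -
  let ?H = "\<lambda>l k. Hess f (X l) (X k)"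
  note t = X_tangent[OF l p]
  have n: "smooth_near A p (\<lambda>q. X k q f)" if "k < d" for k
    by (rule near[OF p X_smooth[OF that fU]])
  have nH: "smooth_near A p (?H l k)" if "k < d" for k
    by (rule near[OF p Hess_smooth[OF fU X_vfields[OF l] X_vfields[OF that]]])
  have Xf: "X l p (\<lambda>q. X k q f) = ?H l k p + (\<Sum>j<d. G (X l) k j p * X j p f)" if "k < d" for k
    using G_expand[OF X_vfields[OF l] that p] by (simp add: Hess_def sum_fun_apply)
  have "X l p (\<lambda>q. X l q (Gam M f f)) = X l p (\<lambda>q. 2 * (\<Sum>k<d. X k q f * ?H l k q))"
    by (rule tangent_cong[OF t open_U p]) (rule X_Gam[OF l])
  also have "\<dots> = 2 * X l p (\<lambda>q. \<Sum>k<d. X k q f * ?H l k q)"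
    by (rule tangent_cmult[OF t]) (auto intro!: smooth_near_sum smooth_near_mult n nH)
  also have "X l p (\<lambda>q. \<Sum>k<d. X k q f * ?H l k q) = (\<Sum>k<d. X l p (\<lambda>q. X k q f * ?H l k q))"
    by (rule tangent_sum[OF t]) (auto intro!: smooth_near_mult n nH)
  also have "\<dots> = (\<Sum>k<d. (?H l k p)\<^sup>2 + (\<Sum>j<d. G (X l) k j p * X j p f) * ?H l k p + X k p f * X l p (?H l k))"
  proof (intro sum.cong refl)
    fix k assume "k \<in> {..<d}"
    then have k: "k < d" by simp
    show "X l p (\<lambda>q. X k q f * ?H l k q)
        = (?H l k p)\<^sup>2 + (\<Sum>j<d. G (X l) k j p * X j p f) * ?H l k p + X k p f * X l p (?H l k)"
      unfolding tangent_mult[OF t n[OF k] nH[OF k]] Xf[OF k] by (simp add: power2_eq_square algebra_simps)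
  qed
  also have "\<dots> = (\<Sum>k<d. (?H l k p)\<^sup>2) + (\<Sum>k<d. (\<Sum>j<d. G (X l) k j p * X j p f) * ?H l k p)
      + (\<Sum>k<d. X k p f * X l p (?H l k))"
    by (simp add: sum.distrib)
  \<comment> \<open>Exchanging the two summation indices and using skewness moves the connection
    term from the derivatives of \<open>f\<close> onto the Hessian.\<close>
  also have "(\<Sum>k<d. (\<Sum>j<d. G (X l) k j p * X j p f) * ?H l k p)
      = - (\<Sum>k<d. X k p f * (\<Sum>j<d. G (X l) k j p * ?H l j p))"
  proof -
    have "(\<Sum>k<d. (\<Sum>j<d. G (X l) k j p * X j p f) * ?H l k p) = (\<Sum>k<d. \<Sum>j<d. G (X l) k j p * X j p f * ?H l k p)"
      by (simp add: sum_distrib_right)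
    also have "\<dots> = (\<Sum>k<d. \<Sum>j<d. G (X l) j k p * X k p f * ?H l j p)"
      by (rule sum.swap)
    also have "\<dots> = (\<Sum>k<d. \<Sum>j<d. - (X k p f * (G (X l) k j p * ?H l j p)))"
    proof (intro sum.cong refl)
      fix k j assume "k \<in> {..<d}" "j \<in> {..<d}"
      then have "G (X l) j k p = - G (X l) k j p" by (intro G_skew[OF X_vfields[OF l] _ _ p]) simp_all
      then show "G (X l) j k p * X k p f * ?H l j p = - (X k p f * (G (X l) k j p * ?H l j p))" by simp
    qed
    finally show ?thesis by (simp add: sum_negf sum_distrib_left)
  qed
  finally have 1: "X l p (\<lambda>q. X l q (Gam M f f)) = 2 * ((\<Sum>k<d. (?H l k p)\<^sup>2)
      + - (\<Sum>k<d. X k p f * (\<Sum>j<d. G (X l) k j p * ?H l j p)) + (\<Sum>k<d. X k p f * X l p (?H l k)))" .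
  have "D (X l) (X l) p (Gam M f f) = (\<Sum>j<d. G (X l) l j p * (2 * (\<Sum>k<d. X k p f * ?H j k p)))"
    using G_expand[OF X_vfields[OF l] l p] by (simp add: sum_fun_apply X_Gam[OF _ p])
  also have "\<dots> = (\<Sum>j<d. \<Sum>k<d. 2 * (X k p f * (G (X l) l j p * ?H j k p)))"
    by (simp add: sum_distrib_left mult_ac)
  also have "\<dots> = 2 * (\<Sum>k<d. X k p f * (\<Sum>j<d. G (X l) l j p * ?H j k p))"
    by (subst sum.swap) (simp add: sum_distrib_left)
  finally have 2: "D (X l) (X l) p (Gam M f f) = 2 * (\<Sum>k<d. X k p f * (\<Sum>j<d. G (X l) l j p * ?H j k p))" .
  show ?thesis
    unfolding Hess_def[of "Gam M f f"] 1 2 right_diff_distrib sum_subtractf by simp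
qed

text \<open>The hypothesis \<open>c_eq\<close> identifies the chart of the locale with the one in
  which \<open>ricci\<close> takes its trace, so that \<open>ricci_hgrad\<close> applies to
  \<open>R_form\<close>.\<close>

lemma horizontal_bochner:
  assumes c_eq: "c = (SOME c. c \<in> A \<and> p \<in> fst c)"
  shows "Gam2 M L f p = hessian_norm2 d X \<omega> f p + R_form M D d X f p + S_form M D d X f p"
proof -
  let ?H = "\<lambda>l k. Hess f (X l) (X k)"
  let ?S = "\<lambda>l k. \<Sum>m<h. \<gamma> l k m p * X l p (\<lambda>q. Z m q f)"
  have "L (Gam M f f) p / 2 = (\<Sum>l<d. Hess (Gam M f f) (X l) (X l) p / 2)"
    unfolding L_eq_Lx[OF Gam_smooth[OF f f] p] Lx_Hess[OF p] by (rule sum_divide_distrib)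
  also have "\<dots> = (\<Sum>l<d. (\<Sum>k<d. (?H l k p)\<^sup>2) + (\<Sum>k<d. X k p f *
      (third f (X k) (X l) (X l) p - Rc (X l) (X k) (X l) p f - DT (X l) (X l) (X k) p f + 2 * ?S l k)))"
    by (intro sum.cong refl) (simp add: Hess_Gam divergence_Hess[OF fU _ _ p])
  also have "\<dots> = (\<Sum>l<d. \<Sum>k<d. (?H l k p)\<^sup>2) + (\<Sum>l<d. \<Sum>k<d. X k p f *
      (third f (X k) (X l) (X l) p - Rc (X l) (X k) (X l) p f - DT (X l) (X l) (X k) p f + 2 * ?S l k))"
    by (rule sum.distrib)
  also have "(\<Sum>l<d. \<Sum>k<d. X k p f *
      (third f (X k) (X l) (X l) p - Rc (X l) (X k) (X l) p f - DT (X l) (X l) (X k) p f + 2 * ?S l k))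
    = (\<Sum>k<d. X k p f * (\<Sum>l<d. third f (X k) (X l) (X l) p)) - (\<Sum>k<d. X k p f * (\<Sum>l<d. Rc (X l) (X k) (X l) p f))
      - (\<Sum>l<d. \<Sum>k<d. DT (X l) (X l) (X k) p f * X k p f) + 2 * (\<Sum>k<d. X k p f * (\<Sum>l<d. ?S l k))"
  proof -
    have sw: "(\<Sum>l<d. \<Sum>k<d. X k p f * g l k) = (\<Sum>k<d. X k p f * (\<Sum>l<d. g l k))" for g :: "nat \<Rightarrow> nat \<Rightarrow> real"
      by (subst sum.swap) (simp add: sum_distrib_left)
    have gen: "(\<Sum>l<d. \<Sum>k<d. X k p f * (t l k - r l k - e l k + 2 * s l k))
      = (\<Sum>l<d. \<Sum>k<d. X k p f * t l k) - (\<Sum>l<d. \<Sum>k<d. X k p f * r l k)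
      - (\<Sum>l<d. \<Sum>k<d. e l k * X k p f) + 2 * (\<Sum>l<d. \<Sum>k<d. X k p f * s l k)"
      for t r e s :: "nat \<Rightarrow> nat \<Rightarrow> real"
      unfolding sum_distrib_left[of 2] sum.distrib[symmetric] sum_subtractf[symmetric]
      by (intro sum.cong refl) (simp add: algebra_simps)
    show ?thesis unfolding gen sw ..
  qed
  \<comment> \<open>The trace of the third derivative is the derivative of \<open>L f\<close>, so
    this sum is the \<open>\<Gamma>(f, L f)\<close> term that \<open>Gam2\<close> subtracts.\<close>
  also have "(\<Sum>k<d. X k p f * (\<Sum>l<d. third f (X k) (X l) (X l) p)) = Gam M f (L f) p"
  proof -
    have "X k p (L f) = (\<Sum>l<d. third f (X k) (X l) (X l) p)" if k: "k < d" for k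
    proof -
      note t = X_tangent[OF k p]
      have "X k p (L f) = X k p (\<lambda>q. \<Sum>l<d. ?H l l q)"
        by (rule tangent_cong[OF t open_U p]) (simp add: L_eq_Lx[OF f] Lx_Hess)
      also have "\<dots> = (\<Sum>l<d. X k p (?H l l))"
        by (rule tangent_sum[OF t]) (auto intro!: near[OF p] Hess_smooth[OF fU] X_vfields)
      finally show ?thesis using sum_third[OF fU X_vfields[OF k] p] by simp
    qed
    then show ?thesis unfolding Gam_frame[OF p] by (intro sum.cong) auto
  qed
  also have "(\<Sum>l<d. \<Sum>k<d. (?H l k p)\<^sup>2) = hessian_norm2 d X \<omega> f p + (\<Sum>l<d. \<Sum>k<d. 1/4 * (T (X l) (X k) p f)\<^sup>2)"
    by (rule hessian_norm2_eq[OF fU p, symmetric])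
  finally have "Gam2 M L f p = hessian_norm2 d X \<omega> f p + (\<Sum>l<d. \<Sum>k<d. 1/4 * (T (X l) (X k) p f)\<^sup>2)
      - (\<Sum>k<d. X k p f * (\<Sum>l<d. Rc (X l) (X k) (X l) p f))
      - (\<Sum>l<d. \<Sum>k<d. DT (X l) (X l) (X k) p f * X k p f) + 2 * (\<Sum>k<d. X k p f * (\<Sum>l<d. ?S l k))"
    by (simp add: Gam2_def diff_divide_distrib)
  moreover have "R_form M D d X f p = - (\<Sum>k<d. X k p f * (\<Sum>l<d. Rc (X l) (X k) (X l) p f))
      - (\<Sum>l<d. \<Sum>k<d. DT (X l) (X l) (X k) p f * X k p f) + (\<Sum>l<d. \<Sum>k<d. 1/4 * (T (X l) (X k) p f)\<^sup>2)"
    unfolding R_form_def ricci_def Let_def c_eq[symmetric] ricci_hgrad[OF fU p]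
    by (simp add: sum.distrib sum_negf sum_subtractf)
  ultimately show ?thesis using S_form_frame[OF fU p] by simp
qed

end

end


subsection \<open>Independence of the horizontal frame\<close>

context connection_chart
begin

text \<open>The change-of-frame matrix \<open>Q\<close> is orthogonal at \<open>p\<close>, seen by
  expanding \<open>X a\<close> in the frame \<open>Y\<close>; bilinearity over functions then makes
  the trace invariant.\<close>

lemma frame_trace:
  fixes \<Phi> :: "'m vfield \<Rightarrow> 'm vfield \<Rightarrow> real"
  assumes Y: "horizontal_frame M d U Y" and p: "p \<in> U"
    and 1: "\<And>C. C \<in> VF \<Longrightarrow> tensorial U p (\<lambda>B. \<Phi> B C)" and 2: "\<And>B. B \<in> VF \<Longrightarrow> tensorial U p (\<Phi> B)"
  shows "(\<Sum>i<d. \<Phi> (Y i) (Y i)) = (\<Sum>i<d. \<Phi> (X i) (X i))"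
proof -
  define Q where "Q i a q = gR M q (Y i q) (X a q)" for i a q
  have Yh: "Y i \<in> hfields M U" if "i < d" for i using Y that by (simp add: horizontal_frame_def)
  have Yv: "Y i \<in> VF" if "i < d" for i using hfieldsD(1)[OF Yh[OF that]] .
  have sQ: "smooth A U (Q i a)" if "i < d" "a < d" for i a
    using frame_coeff_smooth[OF Yv[OF that(1)] open_U subset_refl, of a] that(2) by (simp add: Q_def[abs_def])
  have Ye: "Y i q = (\<Sum>a\<in>{..<d}. Q i a q *\<^sub>R X a q)" if "i < d" "q \<in> U" for i q
    unfolding Q_def by (rule hor_expand[OF that(2) hfieldsD(2)[OF Yh[OF that(1)] that(2)]])
  have orth: "(\<Sum>i<d. Q i a p * Q i b p) = (if a = b then 1 else 0)" if ab: "a < d" "b < d" for a b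
  proof -
    have Yt: "Y i p \<in> tangent_space A p" if "i < d" for i using vfields_tangent[OF Yv[OF that] p] .
    have "gR M p (X a p) (X b p) = gR M p (\<Sum>i<d. gR M p (X a p) (Y i p) *\<^sub>R Y i p) (X b p)"
      by (rule arg_cong[where f="\<lambda>v. gR M p v (X b p)", OF horizontal_frame_expand[OF Y p X_hor[OF ab(1) p]]])
    also have "\<dots> = (\<Sum>i<d. gR M p (X a p) (Y i p) * gR M p (Y i p) (X b p))"
      using Yt X_tangent[OF ab(2) p] by (intro gR.combination_left) auto
    also have "\<dots> = (\<Sum>i<d. Q i a p * Q i b p)"
      using gR.sym[OF X_tangent[OF ab(1) p] Yt] by (simp add: Q_def)
    finally show ?thesis using gR_XX[OF p ab] by simp
  qed
  have "\<Phi> (Y i) (Y i) = (\<Sum>a<d. \<Sum>b<d. Q i a p * Q i b p * \<Phi> (X a) (X b))" if i: "i < d" for i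
  proof -
    have s: "\<And>a. a \<in> {..<d} \<Longrightarrow> smooth A U (Q i a)" and v: "\<And>a. a \<in> {..<d} \<Longrightarrow> X a \<in> VF"
      using sQ[OF i] X_vfields by auto
    have "\<Phi> (Y i) (Y i) = (\<Sum>a\<in>{..<d}. Q i a p *\<^sub>R \<Phi> (X a) (Y i))"
      by (rule tensorial_combination[OF 1[OF Yv[OF i]] open_U p finite_lessThan s v Ye[OF i]])
    also have "\<dots> = (\<Sum>a\<in>{..<d}. Q i a p *\<^sub>R (\<Sum>b\<in>{..<d}. Q i b p *\<^sub>R \<Phi> (X a) (X b)))"
    proof (intro sum.cong refl)
      fix a assume a: "a \<in> {..<d}"
      show "Q i a p *\<^sub>R \<Phi> (X a) (Y i) = Q i a p *\<^sub>R (\<Sum>b\<in>{..<d}. Q i b p *\<^sub>R \<Phi> (X a) (X b))"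
        by (rule arg_cong[where f="\<lambda>x. Q i a p *\<^sub>R x",
            OF tensorial_combination[OF 2[OF v[OF a]] open_U p finite_lessThan s v Ye[OF i]]])
    qed
    finally show ?thesis by (simp add: sum_distrib_left mult_ac)
  qed
  then have "(\<Sum>i<d. \<Phi> (Y i) (Y i)) = (\<Sum>i<d. \<Sum>a<d. \<Sum>b<d. Q i a p * Q i b p * \<Phi> (X a) (X b))" by simp
  also have "\<dots> = (\<Sum>a<d. \<Sum>b<d. (\<Sum>i<d. Q i a p * Q i b p) * \<Phi> (X a) (X b))"
    by (subst sum.swap, rule sum.cong[OF refl], subst sum.swap) (simp add: sum_distrib_right)
  also have "\<dots> = (\<Sum>a<d. \<Sum>b<d. if b = a then \<Phi> (X a) (X b) else 0)"
    using orth by (intro sum.cong refl) auto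
  also have "\<dots> = (\<Sum>a<d. \<Phi> (X a) (X a))" by simp
  finally show ?thesis .
qed

context
  fixes f p Y assumes f: "smooth A U f" and p: "p \<in> U" and Y: "horizontal_frame M d U Y"
begin

lemma Y_vfields: "i < d \<Longrightarrow> Y i \<in> VF"
  using Y hfieldsD(1)[of "Y i" M U] by (simp add: horizontal_frame_def)

text \<open>The double sums are treated as iterated traces. One index is traced while the fields
  carrying the other are held fixed, and tensoriality in each slot lets \<open>frame_trace\<close>
  replace one frame at a time.\<close>

lemma R_form_frame_independent: "R_form M D d Y f p = R_form M D d X f p"
proof -
  have "(\<Sum>l<d. \<Sum>k<d. DT (Y l) (Y l) (Y k) p f * Y k p f) = (\<Sum>k<d. \<Sum>l<d. DT (Y l) (Y l) (Y k) p f * Y k p f)"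
    by (rule sum.swap)
  also have "\<dots> = (\<Sum>k<d. \<Sum>l<d. DT (X l) (X l) (Y k) p f * Y k p f)"
  proof (rule sum.cong[OF refl])
    fix k assume "k \<in> {..<d}"
    then have k: "Y k \<in> VF" using Y_vfields by simp
    show "(\<Sum>l<d. DT (Y l) (Y l) (Y k) p f * Y k p f) = (\<Sum>l<d. DT (X l) (X l) (Y k) p f * Y k p f)"
      by (rule frame_trace[OF Y p, where \<Phi>="\<lambda>B C. DT B C (Y k) p f * Y k p f"])
         (rule tensorial_mult_right tensorial_eval DT_tensorial1[OF _ k p] DT_tensorial2[OF _ k p] | assumption)+
  qed
  also have "\<dots> = (\<Sum>l<d. \<Sum>k<d. DT (X l) (X l) (Y k) p f * Y k p f)"
    by (rule sum.swap)
  also have "\<dots> = (\<Sum>l<d. \<Sum>k<d. DT (X l) (X l) (X k) p f * X k p f)"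
  proof (rule sum.cong[OF refl])
    fix l assume "l \<in> {..<d}"
    then have l: "X l \<in> VF" using X_vfields by simp
    show "(\<Sum>k<d. DT (X l) (X l) (Y k) p f * Y k p f) = (\<Sum>k<d. DT (X l) (X l) (X k) p f * X k p f)"
      by (rule frame_trace[OF Y p, where \<Phi>="\<lambda>B C. DT (X l) (X l) B p f * C p f"])
         (rule tensorial_mult_right[OF tensorial_eval[OF DT_tensorial3[OF l l p]]] tensorial_mult_left[OF tensorial_field])+
  qed
  finally have 1: "(\<Sum>l<d. \<Sum>k<d. DT (Y l) (Y l) (Y k) p f * Y k p f)
      = (\<Sum>l<d. \<Sum>k<d. DT (X l) (X l) (X k) p f * X k p f)" .
  have tt: "(\<Sum>k<d. T B (Y k) p f * T B (Y k) p f) = (\<Sum>k<d. T B (X k) p f * T B (X k) p f)" if B: "B \<in> VF" for B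
    by (rule frame_trace[OF Y p, where \<Phi>="\<lambda>C C'. T B C p f * T B C' p f"])
       (rule tensorial_mult_right tensorial_mult_left, rule tensorial_eval[OF T_tensorial_right[OF open_U B p]])+
  have tt': "(\<Sum>k<d. T (Y k) B p f * T (Y k) B p f) = (\<Sum>k<d. T (X k) B p f * T (X k) B p f)" if B: "B \<in> VF" for B
    by (rule frame_trace[OF Y p, where \<Phi>="\<lambda>C C'. T C B p f * T C' B p f"])
       (rule tensorial_mult_right tensorial_mult_left, rule tensorial_eval[OF T_tensorial_left[OF open_U B p]])+
  have "(\<Sum>l<d. \<Sum>k<d. T (Y l) (Y k) p f * T (Y l) (Y k) p f) = (\<Sum>l<d. \<Sum>k<d. T (Y l) (X k) p f * T (Y l) (X k) p f)"
    using tt Y_vfields by simp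
  also have "\<dots> = (\<Sum>k<d. \<Sum>l<d. T (Y l) (X k) p f * T (Y l) (X k) p f)"
    by (rule sum.swap)
  also have "\<dots> = (\<Sum>k<d. \<Sum>l<d. T (X l) (X k) p f * T (X l) (X k) p f)"
    using tt' X_vfields by simp
  also have "\<dots> = (\<Sum>l<d. \<Sum>k<d. T (X l) (X k) p f * T (X l) (X k) p f)"
    by (rule sum.swap)
  finally have 2: "(\<Sum>l<d. \<Sum>k<d. T (Y l) (Y k) p f * T (Y l) (Y k) p f)
      = (\<Sum>l<d. \<Sum>k<d. T (X l) (X k) p f * T (X l) (X k) p f)" .
  have e: "R_form M D d W f p = ricci A D (hgrad M f) (hgrad M f) p
      - (\<Sum>l<d. \<Sum>k<d. DT (W l) (W l) (W k) p f * W k p f)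
      + 1/4 * (\<Sum>l<d. \<Sum>k<d. T (W l) (W k) p f * T (W l) (W k) p f)" for W
    by (simp add: R_form_def sum.distrib sum_negf sum_subtractf sum_distrib_left power2_eq_square)
  show ?thesis unfolding e 1 2 ..
qed

lemma S_form_frame_independent: "S_form M D d Y f p = S_form M D d X f p"
proof -
  note u = hgrad_vfields[OF f] and v = vgrad_vfields[OF f]
  note Dt = vfields_tangent[OF Dv[OF _ v] p] and Tt = vfields_tangent[OF Tv[OF _ u] p]
  have "(\<Sum>i<d. gR M p (D (Y i) (vgrad M f) p) (T (Y i) (hgrad M f) p))
      = (\<Sum>i<d. gR M p (D (X i) (vgrad M f) p) (T (X i) (hgrad M f) p))"
  proof (rule frame_trace[OF Y p, where \<Phi>="\<lambda>B C. gR M p (D B (vgrad M f) p) (T C (hgrad M f) p)"])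
    fix C assume C: "C \<in> VF"
    note t = D_tensorial[OF open_U v p]
    show "tensorial U p (\<lambda>B. gR M p (D B (vgrad M f) p) (T C (hgrad M f) p))"
    proof (rule tensorialI)
      fix B assume B: "B \<in> VF"
      show "gR M p (D (B + B') (vgrad M f) p) (T C (hgrad M f) p)
          = gR M p (D B (vgrad M f) p) (T C (hgrad M f) p) + gR M p (D B' (vgrad M f) p) (T C (hgrad M f) p)"
        if "B' \<in> VF" for B'
        unfolding tensorial_add[OF t B that] by (rule gR.add_left[OF Dt[OF B] Dt[OF that] Tt[OF C]])
      show "gR M p (D (fscale \<phi> B) (vgrad M f) p) (T C (hgrad M f) p)
          = \<phi> p *\<^sub>R gR M p (D B (vgrad M f) p) (T C (hgrad M f) p)" if "smooth A U \<phi>" for \<phi>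
        unfolding tensorial_fscale[OF t B that] real_scaleR_def by (rule gR.scale_left[OF Dt[OF B] Tt[OF C]])
    qed
  next
    fix B assume B: "B \<in> VF"
    note t = T_tensorial_left[OF open_U u p]
    show "tensorial U p (\<lambda>C. gR M p (D B (vgrad M f) p) (T C (hgrad M f) p))"
    proof (rule tensorialI)
      fix C assume C: "C \<in> VF"
      show "gR M p (D B (vgrad M f) p) (T (C + C') (hgrad M f) p)
          = gR M p (D B (vgrad M f) p) (T C (hgrad M f) p) + gR M p (D B (vgrad M f) p) (T C' (hgrad M f) p)"
        if C': "C' \<in> VF" for C'
        unfolding tensorial_add[OF t C C'] gR.sym[OF Dt[OF B] Tt[OF C]] gR.sym[OF Dt[OF B] Tt[OF C']]
          gR.sym[OF Dt[OF B] gR.closed(1)[OF Tt[OF C] Tt[OF C']]]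
        by (rule gR.add_left[OF Tt[OF C] Tt[OF C'] Dt[OF B]])
      show "gR M p (D B (vgrad M f) p) (T (fscale \<phi> C) (hgrad M f) p)
          = \<phi> p *\<^sub>R gR M p (D B (vgrad M f) p) (T C (hgrad M f) p)" if "smooth A U \<phi>" for \<phi>
        unfolding tensorial_fscale[OF t C that] real_scaleR_def gR.sym[OF Dt[OF B] Tt[OF C]]
          gR.sym[OF Dt[OF B] gR.closed(2)[OF Tt[OF C]]]
        by (rule gR.scale_left[OF Tt[OF C] Dt[OF B]])
    qed
  qed
  then show ?thesis by (simp add: S_form_def)
qed

end

end


section \<open>The vertical Bochner formula\<close>

context adapted
begin

lemma bracket_XX_tangent:
  assumes "p \<in> U" "i < d" "j < d"
  shows "lie_bracket A (X i) (X j) p \<in> tangent_space A p"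
proof -
  have "(\<Sum>m<h. \<gamma> i j m p *\<^sub>R Z m p) \<in> tangent_space A p"
    using Z_vert vert_tangent by (intro gR.closed(4) gR.closed(2)) auto
  then show ?thesis
    unfolding bracket_XX[OF assms] by (rule gR.closed(1)[OF hor_tangent[OF hor_combination[OF assms(1)]]])
qed

lemma bracket_XZ_coeff:
  "p \<in> U \<Longrightarrow> j < d \<Longrightarrow> m < h \<Longrightarrow> l < d \<Longrightarrow> gR M p (lie_bracket A (X j) (Z m) p) (X l p) = \<delta> j m l p"
  by (simp add: bracket_XZ X_coeff)

lemma \<omega>_skew: "p \<in> U \<Longrightarrow> i < d \<Longrightarrow> j < d \<Longrightarrow> l < d \<Longrightarrow> \<omega> i j l p = - \<omega> j i l p"
proof -
  assume p: "p \<in> U" and i: "i < d" "j < d" and l: "l < d"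
  note t = bracket_XX_tangent[OF p i(2,1)]
  have "\<omega> i j l p = gR M p (- lie_bracket A (X j) (X i) p) (X l p)"
    using bracket_XX_coeff[OF p i l] lie_bracket_swap[of "X i" "X j" p] by simp
  also have "\<dots> = - gR M p (lie_bracket A (X j) (X i) p) (X l p)"
    using gR.scale_left[OF t X_tangent[OF l p], of "-1"] by simp
  finally show "\<omega> i j l p = - \<omega> j i l p" using bracket_XX_coeff[OF p i(2,1) l] by simp
qed

text \<open>The \<open>X l\<close>-component of the Jacobi identity for \<open>X i\<close>,
  \<open>X k\<close> and \<open>Z m\<close>, written out with the structure functions.\<close>

lemma jacobi_coeff:
  assumes p: "p \<in> U" and i: "i < d" and k: "k < d" and l: "l < d" and m: "m < h"
  shows "(\<Sum>j<d. \<omega> i k j p * \<delta> j m l p) - Z m p (\<omega> i k l)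
    = (\<Sum>j<d. \<delta> k m j p * \<omega> i j l p) + X i p (\<delta> k m l) - ((\<Sum>j<d. \<delta> i m j p * \<omega> k j l p) + X k p (\<delta> i m l))"
proof -
  note Zv = Z_vfields[OF m, of U]
  have Xv: "\<And>j. j \<in> {..<d} \<Longrightarrow> X j \<in> vfields A U" and Zn: "\<And>n. n \<in> {..<h} \<Longrightarrow> Z n \<in> vfields A U"
    using X_vfields Z_vfields by auto
  have so: "\<And>j. j \<in> {..<d} \<Longrightarrow> smooth A U (\<omega> i k j)" and sg: "\<And>n. n \<in> {..<h} \<Longrightarrow> smooth A U (\<gamma> i k n)"
    using structure_smooth(1,2)[OF i k] by auto
  note BXt = bracket_XX_tangent[OF p]
  have BZt: "lie_bracket A (X j) (Z m) p \<in> tangent_space A p" if "j < d" for j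
    unfolding bracket_XZ[OF p that m] by (rule hor_tangent[OF hor_combination[OF p]])
  have comb: "gR M p (\<Sum>j<d. a j *\<^sub>R u j + b j *\<^sub>R X j p) (X l p) = (\<Sum>j<d. a j * gR M p (u j) (X l p)) + b l"
    if u: "\<And>j. j < d \<Longrightarrow> u j \<in> tangent_space A p" for a b u
  proof -
    have t: "(\<Sum>j<d. a j *\<^sub>R u j) \<in> tangent_space A p" using u by (intro gR.closed(4) gR.closed(2)) auto
    have "gR M p (\<Sum>j<d. a j *\<^sub>R u j) (X l p) = (\<Sum>j<d. a j * gR M p (u j) (X l p))"
      using u X_tangent[OF l p] by (intro gR.combination_left) auto
    then show ?thesis
      unfolding sum.distrib using gR.add_left[OF t hor_tangent[OF hor_combination[OF p]] X_tangent[OF l p]]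
        X_coeff[OF p l] by simp
  qed
  \<comment> \<open>\<open>F1\<close> and \<open>F2\<close> are the horizontal and vertical parts of
    \<open>[X i, X k]\<close>. The bracket of \<open>F2\<close> with \<open>Z m\<close> stays
    vertical because the \<open>Z n\<close> span a subalgebra, so no \<open>\<gamma>\<close> appears
    in the result.\<close>
  define F1 where "F1 = (\<Sum>j<d. fscale (\<omega> i k j) (X j))"
  define F2 where "F2 = (\<Sum>n<h. fscale (\<gamma> i k n) (Z n))"
  have F: "F1 \<in> vfields A U" "F2 \<in> vfields A U"
    unfolding F1_def F2_def using so sg Xv Zn by (auto intro!: vfields_sum vfields_fscale)
  have F1e: "F1 q = (\<Sum>j\<in>{..<d}. \<omega> i k j q *\<^sub>R X j q)" and F2e: "F2 q = (\<Sum>n\<in>{..<h}. \<gamma> i k n q *\<^sub>R Z n q)" for q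
    by (simp_all add: F1_def F2_def sum_fun_apply)
  have "lie_bracket A (lie_bracket A (X i) (X k)) (Z m) p = lie_bracket A (F1 + F2) (Z m) p"
    by (rule lie_bracket_cong[OF open_U p vfields_add[OF F] Zv, symmetric])
       (simp_all add: F1e F2e bracket_XX[OF _ i k])
  also have "\<dots> = lie_bracket A F1 (Z m) p + lie_bracket A F2 (Z m) p"
    by (rule lie_bracket_add_left[OF open_U p F Zv])
  finally have l1: "lie_bracket A (lie_bracket A (X i) (X k)) (Z m) p = lie_bracket A F1 (Z m) p + lie_bracket A F2 (Z m) p" .
  have e1: "lie_bracket A F1 (Z m) p = (\<Sum>j<d. \<omega> i k j p *\<^sub>R lie_bracket A (X j) (Z m) p + (- Z m p (\<omega> i k j)) *\<^sub>R X j p)"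
    using lie_bracket_combination_left[OF open_U p finite_lessThan so Xv F1e F(1) Zv] by simp
  have e2: "lie_bracket A F2 (Z m) p = (\<Sum>n<h. \<gamma> i k n p *\<^sub>R lie_bracket A (Z n) (Z m) p - Z m p (\<gamma> i k n) *\<^sub>R Z n p)"
    by (rule lie_bracket_combination_left[OF open_U p finite_lessThan sg Zn F2e F(2) Zv])
  have "lie_bracket A F2 (Z m) p \<in> vspace M p"
    unfolding e2 using Z_vert vert_bracket[OF Z_vert Z_vert[OF m]]
    by (intro subspace_sum[OF vspace_subspace] subspace_diff[OF vspace_subspace] subspace_scale[OF vspace_subspace] vspaceI) auto
  then obtain W where W: "W \<in> vert M" "lie_bracket A F2 (Z m) p = W p" by (auto simp: vspace_def)
  have t1: "lie_bracket A F1 (Z m) p \<in> tangent_space A p"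
    unfolding e1 using BZt X_tangent[OF _ p] by (intro gR.closed(4) gR.closed(1) gR.closed(2)) auto
  have lhs: "gR M p (lie_bracket A (lie_bracket A (X i) (X k)) (Z m) p) (X l p)
      = (\<Sum>j<d. \<omega> i k j p * \<delta> j m l p) - Z m p (\<omega> i k l)"
    unfolding l1 W(2) gR.add_left[OF t1 vert_tangent[OF W(1)] X_tangent[OF l p]]
      gR_vert_hor[OF X_hor[OF l p] W(1)]
    unfolding e1 by (subst comb) (use BZt bracket_XZ_coeff[OF p _ m l] in auto)
  have rhs: "lie_bracket A (X a) (lie_bracket A (X b) (Z m)) p \<in> tangent_space A p
      \<and> gR M p (lie_bracket A (X a) (lie_bracket A (X b) (Z m)) p) (X l p)
        = (\<Sum>j<d. \<delta> b m j p * \<omega> a j l p) + X a p (\<delta> b m l)" if ab: "a < d" "b < d" for a b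
  proof -
    have sd: "\<And>j. j \<in> {..<d} \<Longrightarrow> smooth A U (\<delta> b m j)" using structure_smooth(3)[OF ab(2) m] by simp
    have be: "lie_bracket A (X b) (Z m) q = (\<Sum>j\<in>{..<d}. \<delta> b m j q *\<^sub>R X j q)" if "q \<in> U" for q
      by (rule bracket_XZ[OF that ab(2) m])
    have e: "lie_bracket A (X a) (lie_bracket A (X b) (Z m)) p
        = (\<Sum>j<d. \<delta> b m j p *\<^sub>R lie_bracket A (X a) (X j) p + X a p (\<delta> b m j) *\<^sub>R X j p)"
      by (rule lie_bracket_combination_right[OF open_U p finite_lessThan sd Xv be
            vfields_combination[OF open_U sd Xv be] X_vfields[OF ab(1)]])
    have "gR M p (\<Sum>j<d. \<delta> b m j p *\<^sub>R lie_bracket A (X a) (X j) p + X a p (\<delta> b m j) *\<^sub>R X j p) (X l p)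
        = (\<Sum>j<d. \<delta> b m j p * \<omega> a j l p) + X a p (\<delta> b m l)"
      using comb[OF BXt[OF ab(1)]] bracket_XX_coeff[OF p ab(1) _ l] by simp
    moreover have "(\<Sum>j<d. \<delta> b m j p *\<^sub>R lie_bracket A (X a) (X j) p + X a p (\<delta> b m j) *\<^sub>R X j p) \<in> tangent_space A p"
      using BXt[OF ab(1)] X_tangent[OF _ p] by (intro gR.closed(4) gR.closed(1) gR.closed(2)) auto
    ultimately show ?thesis unfolding e by blast
  qed
  have "gR M p (lie_bracket A (lie_bracket A (X i) (X k)) (Z m) p) (X l p)
      = gR M p (lie_bracket A (X i) (lie_bracket A (X k) (Z m)) p) (X l p)
        - gR M p (lie_bracket A (X k) (lie_bracket A (X i) (Z m)) p) (X l p)"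
    unfolding lie_bracket_jacobi[OF open_U p X_vfields[OF i] X_vfields[OF k] Zv]
    by (rule gR.diff_left[OF conjunct1[OF rhs[OF i k]] conjunct1[OF rhs[OF k i]] X_tangent[OF l p]])
  then show ?thesis unfolding lhs conjunct2[OF rhs[OF i k]] conjunct2[OF rhs[OF k i]] .
qed

end

context sub_lap
begin

lemma L_sum:
  assumes "finite I" "\<And>i. i \<in> I \<Longrightarrow> smooth A UNIV (F i)"
  shows "L (\<lambda>q. \<Sum>i\<in>I. F i q) p = (\<Sum>i\<in>I. L (F i) p)"
  using assms
proof (induction I)
  case empty
  show ?case using L_const[of 0 p] by simp
next
  case (insert i I)
  have s: "smooth A UNIV (\<lambda>q. \<Sum>i\<in>I. F i q)" using insert.prems by (intro smooth_sum) auto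
  have "(\<lambda>q. \<Sum>i\<in>insert i I. F i q) = F i + (\<lambda>q. \<Sum>i\<in>I. F i q)"
    using insert.hyps by (intro ext) simp
  then have "L (\<lambda>q. \<Sum>i\<in>insert i I. F i q) = L (F i) + L (\<lambda>q. \<Sum>i\<in>I. F i q)"
    using L_add[OF insert.prems[OF insertI1] s] by simp
  then show ?case using insert by simp
qed

end

context sub_lap_chart
begin

text \<open>The trace of the Jacobi identity of \<open>X\<^sub>i\<close>, \<open>X\<^sub>k\<close> and \<open>Z\<^sub>m\<close>.\<close>

lemma Z_dvg:
  assumes p: "p \<in> U" and k: "k < d" and m: "m < h"
  shows "Z m p (dvg k) = (\<Sum>i<d. X i p (\<delta> i m k) + dvg i p * \<delta> i m k p)"
proof -
  note t = vert_tangent[OF Z_vert[OF m], of p]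
  have dv: "dvg j q = (\<Sum>i<d. \<omega> i j i q)" if "j < d" "q \<in> U" for j q
    unfolding dvg_def sum_negf[symmetric]
  proof (intro sum.cong refl)
    fix i assume "i \<in> {..<d}"
    then show "- \<omega> j i i q = \<omega> i j i q" using \<omega>_skew[OF that(2) that(1), of i i] by simp
  qed
  have "Z m p (dvg k) = Z m p (\<lambda>q. \<Sum>i<d. \<omega> i k i q)"
    by (rule tangent_cong[OF t open_U p]) (rule dv[OF k])
  also have "\<dots> = (\<Sum>i<d. Z m p (\<omega> i k i))"
    by (rule tangent_sum[OF t]) (auto intro!: near[OF p] structure_smooth k)
  finally have 1: "Z m p (dvg k) = (\<Sum>i<d. Z m p (\<omega> i k i))" .
  \<comment> \<open>Skewness of \<open>\<delta>\<close> makes its diagonal vanish on all of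
    \<open>U\<close>, hence also the derivative.\<close>
  have 2: "X k p (\<delta> i m i) = 0" if i: "i < d" for i
  proof -
    have "X k p (\<delta> i m i) = X k p (\<lambda>q. 0)"
    proof (rule tangent_cong[OF X_tangent[OF k p] open_U p])
      fix q assume "q \<in> U"
      then show "\<delta> i m i q = 0" using \<delta>_skew[of q i m i] i m by simp
    qed
    then show ?thesis using tangent_const[OF X_tangent[OF k p]] by simp
  qed
  have 3: "X i p (\<delta> k m i) = - X i p (\<delta> i m k)" if i: "i < d" for i
  proof -
    have "X i p (\<delta> k m i) = X i p (\<lambda>q. - \<delta> i m k q)"
      by (rule tangent_cong[OF X_tangent[OF i p] open_U p]) (rule \<delta>_skew[OF _ k m i])
    also have "\<dots> = - X i p (\<delta> i m k)"
      by (rule tangent_minus[OF X_tangent[OF i p] near[OF p structure_smooth(3)[OF i m k]]])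
    finally show ?thesis .
  qed
  \<comment> \<open>These quadratic sums stand on opposite sides of the traced Jacobi identity and
    drop out of it together.\<close>
  have 4: "(\<Sum>i<d. \<Sum>j<d. \<omega> i k j p * \<delta> j m i p) = - (\<Sum>i<d. \<Sum>j<d. \<delta> i m j p * \<omega> k j i p)"
  proof -
    have "(\<Sum>i<d. \<Sum>j<d. \<omega> i k j p * \<delta> j m i p) = (\<Sum>i<d. \<Sum>j<d. \<omega> j k i p * \<delta> i m j p)"
      by (rule sum.swap)
    also have "\<dots> = (\<Sum>i<d. \<Sum>j<d. - (\<delta> i m j p * \<omega> k j i p))"
    proof (intro sum.cong refl)
      fix i j assume "i \<in> {..<d}" "j \<in> {..<d}"
      then have "\<omega> j k i p = - \<omega> k j i p" using p k by (intro \<omega>_skew) auto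
      then show "\<omega> j k i p * \<delta> i m j p = - (\<delta> i m j p * \<omega> k j i p)" by simp
    qed
    finally show ?thesis by (simp add: sum_negf)
  qed
  have 5: "(\<Sum>i<d. \<Sum>j<d. \<delta> k m j p * \<omega> i j i p) = - (\<Sum>j<d. dvg j p * \<delta> j m k p)"
  proof -
    have "(\<Sum>i<d. \<Sum>j<d. \<delta> k m j p * \<omega> i j i p) = (\<Sum>j<d. \<delta> k m j p * (\<Sum>i<d. \<omega> i j i p))"
      by (subst sum.swap) (simp add: sum_distrib_left)
    also have "\<dots> = (\<Sum>j<d. - (dvg j p * \<delta> j m k p))"
    proof (intro sum.cong refl)
      fix j assume "j \<in> {..<d}"
      then have j: "j < d" by simp
      show "\<delta> k m j p * (\<Sum>i<d. \<omega> i j i p) = - (dvg j p * \<delta> j m k p)"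
        unfolding dv[OF j p, symmetric] \<delta>_skew[OF p k m j] by simp
    qed
    finally show ?thesis by (simp add: sum_negf)
  qed
  have "(\<Sum>i<d. (\<Sum>j<d. \<omega> i k j p * \<delta> j m i p) - Z m p (\<omega> i k i))
      = (\<Sum>i<d. (\<Sum>j<d. \<delta> k m j p * \<omega> i j i p) + X i p (\<delta> k m i) - ((\<Sum>j<d. \<delta> i m j p * \<omega> k j i p) + X k p (\<delta> i m i)))"
    by (intro sum.cong refl jacobi_coeff p k m) simp_all
  then have "- (\<Sum>i<d. Z m p (\<omega> i k i)) = - (\<Sum>j<d. dvg j p * \<delta> j m k p) - (\<Sum>i<d. X i p (\<delta> i m k))"
    by (simp add: sum.distrib sum_subtractf sum_negf 2 3 4 5)
  then show ?thesis unfolding 1 by (simp add: sum.distrib)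
qed

text \<open>Commuting \<open>Z m\<close> past two horizontal derivatives leaves
  \<open>\<delta>\<close> against the symmetric expression \<open>X l X i f + X i X l f\<close>,
  which sums to 0. What remains is first order, and \<open>Z_dvg\<close> identifies it with the
  derivative of the divergence coefficients along \<open>Z m\<close>.\<close>

lemma Lx_Z_commute:
  assumes f: "smooth A U f" and p: "p \<in> U" and m: "m < h"
  shows "Lx (\<lambda>q. Z m q f) p = Z m p (Lx f)"
proof -
  define z where "z q = Z m q f" for q
  have zt: "Z m p \<in> tangent_space A p" by (rule vert_tangent[OF Z_vert[OF m]])
  have sZ: "smooth A U (\<lambda>q. Z m q g)" if "smooth A U g" for g by (rule Z_smooth[OF m that])
  have XZ: "X i q (\<lambda>q. Z m q g) = Z m q (\<lambda>q. X i q g) + (\<Sum>l<d. \<delta> i m l q * X l q g)"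
    if "i < d" "q \<in> U" "smooth A U g" for i q g
  proof -
    have "X i q (\<lambda>q. Z m q g) - Z m q (\<lambda>q. X i q g) = lie_bracket A (X i) (Z m) q g"
      by (rule lie_bracket_apply[OF near[OF that(2,3)], symmetric])
    then show ?thesis unfolding bracket_XZ[OF that(2,1) m] by (simp add: sum_fun_apply)
  qed
  have XX: "X i p (\<lambda>q. X i q (\<lambda>q. Z m q f)) = Z m p (\<lambda>q. X i q (\<lambda>q. X i q f)) + (\<Sum>l<d. \<delta> i m l p * X l p (\<lambda>q. X i q f))
      + (\<Sum>l<d. X i p (\<delta> i m l) * X l p f + \<delta> i m l p * X i p (\<lambda>q. X l q f))" if i: "i < d" for i
  proof -
    note t = X_tangent[OF i p] and sf = X_smooth[OF i f]
    have n: "smooth_near A p (\<delta> i m l)" "smooth_near A p (\<lambda>q. X l q f)" if "l < d" for l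
      using near[OF p structure_smooth(3)[OF i m that]] near[OF p X_smooth[OF that f]] by auto
    have "X i p (\<lambda>q. X i q (\<lambda>q. Z m q f)) = X i p (\<lambda>q. Z m q (\<lambda>q. X i q f) + (\<Sum>l<d. \<delta> i m l q * X l q f))"
      by (rule tangent_cong[OF t open_U p]) (rule XZ[OF i _ f])
    also have "\<dots> = X i p (\<lambda>q. Z m q (\<lambda>q. X i q f)) + X i p (\<lambda>q. \<Sum>l<d. \<delta> i m l q * X l q f)"
      by (rule tangent_add[OF t near[OF p sZ[OF sf]]]) (auto intro!: smooth_near_sum smooth_near_mult n)
    also have "X i p (\<lambda>q. \<Sum>l<d. \<delta> i m l q * X l q f) = (\<Sum>l<d. X i p (\<lambda>q. \<delta> i m l q * X l q f))"
      by (rule tangent_sum[OF t]) (auto intro!: smooth_near_mult n)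
    also have "\<dots> = (\<Sum>l<d. X i p (\<delta> i m l) * X l p f + \<delta> i m l p * X i p (\<lambda>q. X l q f))"
      by (intro sum.cong refl tangent_mult[OF t] n) simp_all
    finally show ?thesis unfolding XZ[OF i p sf] by simp
  qed
  have s1: "(\<Sum>i<d. \<Sum>l<d. \<delta> i m l p * (X l p (\<lambda>q. X i q f) + X i p (\<lambda>q. X l q f))) = 0"
    by (rule sum_skew_sym) (auto intro: \<delta>_skew[OF p _ m])
  have s2: "(\<Sum>i<d. \<Sum>l<d. (X i p (\<delta> i m l) + dvg i p * \<delta> i m l p) * X l p f) = (\<Sum>l<d. Z m p (dvg l) * X l p f)"
    by (subst sum.swap) (simp add: Z_dvg[OF p _ m] sum_distrib_right)
  have "Lx (\<lambda>q. Z m q f) p = (\<Sum>i<d. Z m p (\<lambda>q. X i q (\<lambda>q. X i q f)) + dvg i p * Z m p (\<lambda>q. X i q f)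
      + (\<Sum>l<d. \<delta> i m l p * (X l p (\<lambda>q. X i q f) + X i p (\<lambda>q. X l q f)))
      + (\<Sum>l<d. (X i p (\<delta> i m l) + dvg i p * \<delta> i m l p) * X l p f))"
    unfolding Lx_def
  proof (intro sum.cong refl)
    fix i assume "i \<in> {..<d}"
    then have i: "i < d" by simp
    show "X i p (\<lambda>q. X i q (\<lambda>q. Z m q f)) + dvg i p * X i p (\<lambda>q. Z m q f)
      = Z m p (\<lambda>q. X i q (\<lambda>q. X i q f)) + dvg i p * Z m p (\<lambda>q. X i q f)
      + (\<Sum>l<d. \<delta> i m l p * (X l p (\<lambda>q. X i q f) + X i p (\<lambda>q. X l q f)))
      + (\<Sum>l<d. (X i p (\<delta> i m l) + dvg i p * \<delta> i m l p) * X l p f)"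
      unfolding XX[OF i] XZ[OF i p f]
      by (simp add: distrib_left distrib_right sum.distrib sum_distrib_left mult.assoc)
  qed
  also have "\<dots> = (\<Sum>i<d. Z m p (\<lambda>q. X i q (\<lambda>q. X i q f)) + dvg i p * Z m p (\<lambda>q. X i q f))
      + (\<Sum>l<d. Z m p (dvg l) * X l p f)"
    unfolding sum.distrib[of "\<lambda>i. _ i + (\<Sum>l<d. _ i l)"] sum.distrib[of _ "\<lambda>i. \<Sum>l<d. _ i l"] s1 s2 by simp
  also have "\<dots> = (\<Sum>i<d. Z m p (\<lambda>q. X i q (\<lambda>q. X i q f) + dvg i q * X i q f))"
  proof -
    have "Z m p (\<lambda>q. X i q (\<lambda>q. X i q f) + dvg i q * X i q f)
        = Z m p (\<lambda>q. X i q (\<lambda>q. X i q f)) + (Z m p (dvg i) * X i p f + dvg i p * Z m p (\<lambda>q. X i q f))"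
      if i: "i < d" for i
    proof -
      note n = near[OF p X_smooth[OF i X_smooth[OF i f]]] near[OF p dvg_smooth[OF i]] near[OF p X_smooth[OF i f]]
      show ?thesis
        unfolding tangent_add[OF zt n(1) smooth_near_mult[OF n(2,3)]] tangent_mult[OF zt n(2,3)] ..
    qed
    then show ?thesis by (simp add: sum.distrib algebra_simps)
  qed
  also have "\<dots> = Z m p (Lx f)"
    unfolding Lx_def[abs_def]
  proof (rule tangent_sum[OF zt, symmetric])
    fix i assume "i \<in> {..<d}"
    then have i: "i < d" by simp
    show "smooth_near A p (\<lambda>q. X i q (\<lambda>q. X i q f) + dvg i q * X i q f)"
      by (rule near[OF p smooth_add[OF X_smooth[OF i X_smooth[OF i f]]
            smooth_mult[OF dvg_smooth[OF i] X_smooth[OF i f] open_U] open_U]])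
  qed
  finally show ?thesis .
qed

text \<open>\<open>GamZ M f f\<close> is globally a sum of squares of the \<open>Z m f\<close>. The
  product identity turns each square into \<open>\<Gamma>(Z m f)\<close> plus a term with
  \<open>L (Z m f)\<close>; since \<open>L\<close> commutes with \<open>Z m\<close>, the latter
  terms add up to the one subtracted in \<open>Gam2Z\<close>.\<close>

lemma vertical_bochner:
  assumes f: "smooth A UNIV f"
  shows "Gam2Z M L f p0 = mixed_norm2 d h X Z f p0"
proof -
  have fU: "smooth A U f" using smooth_subset[OF f] by simp
  have z: "smooth A UNIV (\<lambda>q. Z m q f)" if "m < h" for m
    by (rule vfields_smooth[OF Z_vfields[OF that] open_UNIV subset_refl f])
  have ZL: "Z m p0 (L f) = L (\<lambda>q. Z m q f) p0" if m: "m < h" for m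
  proof -
    have "Z m p0 (L f) = Z m p0 (Lx f)"
      by (rule tangent_cong[OF vert_tangent[OF Z_vert[OF m]] open_U p0]) (rule L_eq_Lx[OF f])
    also have "\<dots> = Lx (\<lambda>q. Z m q f) p0" by (rule Lx_Z_commute[OF fU p0 m, symmetric])
    also have "\<dots> = L (\<lambda>q. Z m q f) p0" by (rule L_eq_Lx[OF z[OF m] p0, symmetric])
    finally show ?thesis .
  qed
  have "L (GamZ M f f) p0 = L (\<lambda>q. \<Sum>m<h. Z m q f * Z m q f) p0"
    using GamZ_global[OF p0, of f f] by (metis ext)
  also have "\<dots> = (\<Sum>m<h. L (\<lambda>q. Z m q f * Z m q f) p0)"
    by (rule L_sum) (auto intro!: smooth_mult z)
  also have "\<dots> = (\<Sum>m<h. 2 * (Z m p0 f * Z m p0 (L f)) + 2 * Gam M (\<lambda>q. Z m q f) (\<lambda>q. Z m q f) p0)"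
    by (intro sum.cong refl) (simp add: L_mult[OF z z] ZL)
  also have "\<dots> = 2 * GamZ M f (L f) p0 + 2 * (\<Sum>m<h. Gam M (\<lambda>q. Z m q f) (\<lambda>q. Z m q f) p0)"
    by (simp add: GamZ_global[OF p0] sum.distrib sum_distrib_left)
  finally have "Gam2Z M L f p0 = (\<Sum>m<h. Gam M (\<lambda>q. Z m q f) (\<lambda>q. Z m q f) p0)"
    by (simp add: Gam2Z_def)
  also have "\<dots> = (\<Sum>m<h. \<Sum>i<d. (X i p0 (\<lambda>q. Z m q f))\<^sup>2)"
    by (simp add: Gam_frame[OF p0] power2_eq_square)
  also have "\<dots> = mixed_norm2 d h X Z f p0"
    unfolding mixed_norm2_def app_def by (rule sum.swap)
  finally show ?thesis .
qed

end

theorem theorem2p18: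
  fixes M :: "('m::{t2_space,second_countable_topology}, 'n::finite) subriem"
    and d h :: nat
    and \<mu> :: "'m measure"
    and L :: "('m \<Rightarrow> real) \<Rightarrow> 'm \<Rightarrow> real"
    and D :: "'m connection"
    and f :: "'m \<Rightarrow> real"
  assumes "transverse_symmetries M d h"
    and "riemannian_measure M \<mu>"
    and "sub_laplacian M \<mu> L"
    and "canonical_connection M D"
    and "f \<in> smooth_functions M"
  shows "(\<forall>p U X Z \<omega> \<gamma> \<delta> V Y.
            adapted_frame M d h U X Z \<omega> \<gamma> \<delta> \<and> p \<in> U \<and>
            horizontal_frame M d V Y \<and> p \<in> V \<longrightarrow>
              Gam2 M L f p =
                hessian_norm2 d X \<omega> f p + R_form M D d Y f p + S_form M D d Y f p) \<and>
         (\<forall>p U X Z \<omega> \<gamma> \<delta>.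
            adapted_frame M d h U X Z \<omega> \<gamma> \<delta> \<and> p \<in> U \<longrightarrow>
              Gam2Z M L f p = mixed_norm2 d h X Z f p)"
proof -
  interpret subriemannian M d h by unfold_locales (rule assms(1))
  have f: "smooth A UNIV f" using assms(5) by simp
  have chart: "\<exists>c. c = (SOME c. c \<in> A \<and> p \<in> fst c) \<and> c \<in> A \<and> p \<in> fst c" for p
  proof -
    obtain c where "c \<in> A \<and> p \<in> fst c" using chart_cover[of p] by blast
    from someI[of "\<lambda>c. c \<in> A \<and> p \<in> fst c", OF this] show ?thesis by blast
  qed
  have frame: "bochner M d h \<mu> L D W X Z \<omega> \<gamma> \<delta> c p"
    if "adapted_frame M d h U X Z \<omega> \<gamma> \<delta>" "W \<subseteq> U" "open W" "p \<in> W" "c \<in> A" "W \<subseteq> fst c" for U W X Z \<omega> \<gamma> \<delta> c p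
    by unfold_locales
       (rule adapted_frame_subset[OF that(1,3,2)] assms(2-4) that)+
  have "Gam2 M L f p = hessian_norm2 d X \<omega> f p + R_form M D d Y f p + S_form M D d Y f p"
    if h: "adapted_frame M d h U X Z \<omega> \<gamma> \<delta>" "p \<in> U" "horizontal_frame M d V Y" "p \<in> V" for p U X Z \<omega> \<gamma> \<delta> V Y
  proof -
    obtain c where cc: "c = (SOME c. c \<in> A \<and> p \<in> fst c)" "c \<in> A" "p \<in> fst c" using chart by blast
    \<comment> \<open>On \<open>W\<close> both frames and the chart selected by \<open>ricci\<close>
      are available. Restriction leaves every quantity at \<open>p\<close> unchanged, because the
      fields and structure functions themselves stay the same.\<close>
    define W where "W = U \<inter> V \<inter> fst c"
    have "open U" "open V" using h by (auto simp: adapted_frame_def horizontal_frame_def)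
    then have W: "W \<subseteq> U" "open W" "p \<in> W" "W \<subseteq> fst c" "W \<subseteq> V"
      using open_chart[OF cc(2)] h cc by (auto simp: W_def)
    interpret bochner M d h \<mu> L D W X Z \<omega> \<gamma> \<delta> c p
      by (rule frame[OF h(1) W(1,2,3) cc(2) W(4)])
    have Y: "horizontal_frame M d W Y" by (rule horizontal_frame_subset[OF h(3) W(2,5)])
    show ?thesis
      using horizontal_bochner[OF f p0 cc(1)] R_form_frame_independent[OF fU[OF f p0] p0 Y]
        S_form_frame_independent[OF fU[OF f p0] p0 Y] by simp
  qed
  moreover have "Gam2Z M L f p = mixed_norm2 d h X Z f p"
    if h: "adapted_frame M d h U X Z \<omega> \<gamma> \<delta>" "p \<in> U" for p U X Z \<omega> \<gamma> \<delta>
  proof -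
    obtain c where cc: "c \<in> A" "p \<in> fst c" using chart by blast
    define W where "W = U \<inter> fst c"
    have "open U" using h by (auto simp: adapted_frame_def horizontal_frame_def)
    then have W: "W \<subseteq> U" "open W" "p \<in> W" "W \<subseteq> fst c"
      using open_chart[OF cc(1)] h cc by (auto simp: W_def)
    interpret bochner M d h \<mu> L D W X Z \<omega> \<gamma> \<delta> c p
      by (rule frame[OF h(1) W(1,2,3) cc(1) W(4)])
    show ?thesis by (rule vertical_bochner[OF f])
  qed
  ultimately show ?thesis by blast
qed

end
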